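(* Let $d\ge 1$, let $K\subset\mathbb{R}^d$ be an open bounded convex set symmetric with respect to the origin and containing the origin, and let $C\subset\mathbb{R}^d$ be a nonempty open convex cone. Let $\mathfrak{M}$ be the family of charges $\nu\in\mathfrak{N}^{1,\infty}_K(C)$ such that $\big\||\nabla D_\mu\nu|_{K^\circ}\big\|_{L_\infty(C)}\le1$. Let $X=\mathfrak{N}_K(C)$ with the seminorm $\|\cdot\|_K$, $Y=L_\infty(C)$, and $\mathcal{L}=\mathcal{L}(X,Y)$. Then for all $\delta>0$ and $N>0$ $$\mathcal{E}_\delta(D_\mu,\mathfrak{M},\mathcal{L})=\Omega(D_\mu,\mathfrak{M};\delta)=\left(\frac{(d+1)\delta}{\mu(K\cap C)}\right)^{\frac1{d+1}}$$ and $$E_N(D_\mu,\mathfrak{M})=\frac d{d+1}\left(\frac1{N\mu(K\cap C)}\right)^{\frac1d}.$$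
   Context: $\mu$ is Lebesgue measure on $\mathbb{R}^d$ and $(x,y)$ is the dot product. A cone is a set closed under multiplication by positive scalars. $|x|_K=\inf\{\lambda>0: x\in\lambda K\}$ is the norm generated by $K$; $K^\circ=\{y\in\mathbb{R}^d:\sup_{x\in K}(x,y)\le 1\}$ is the polar set, and $|z|_{K^\circ}=\sup\{(x,z):|x|_K\le1\}$ is the dual norm. $\mathfrak{N}(C)$ is the linear space of charges (finite real-valued signed measures) $\nu$ on the Lebesgue measurable subsets of $C$ that are absolutely continuous with respect to $\mu$; $D_\mu\nu\in L_1(C)$ is the Radon--Nikodym derivative of $\nu$. For $h>0$, $\|\nu\|_{K,h}=\operatorname{ess\,sup}_{x\in C}|\nu(x+(hK\cap C))|$, and $\|\nu\|_K=\sup_{h>0}\|\nu\|_{K,h}$. $\mathfrak{N}_K(C)$ is the set of $\nu\in\mathfrak{N}(C)$ with $\|\nu\|_K<\infty$. $W^{1,\infty}(C)$ is the space of functions on $C$ that, together with all first-order distributional partial derivatives, belong to $L_\infty(C)$. $\mathfrak{N}^{1,\infty}_K(C)$ is the set of $\nu\in\mathfrak{N}_K(C)$ with $D_\mu\nu\in W^{1,\infty}(C)$; $\nabla$ is the distributional gradient. For a seminormed space $X$ and a normed space $Y$, $\mathcal{L}(X,Y)$ is the space of linear operators $S:X\to Y$ with $\|S\|=\sup_{\|x\|_X\le1}\|Sx\|_Y<\infty$. For an operator $A$ with domain $D_A\subset X$, values in $Y$, and a class $\mathfrak{M}\subset D_A$: - modulus of continuity: $\Omega(A,\mathfrak{M};\delta)=\sup\{\|Ax\|_Y: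 x\in\mathfrak{M},\ \|x\|_X\le\delta\}$; - Stechkin problem of best approximation by bounded operators: $E_N(A,\mathfrak{M})=\inf\big\{\sup_{x\in\mathfrak{M}}\|Ax-Sx\|_Y: S\in\mathcal{L}(X,Y),\ \|S\|\le N\big\}$; - optimal recovery from elements known with error $\delta$: $\mathcal{E}_\delta(A,\mathfrak{M},\mathcal{L}(X,Y))=\inf_{S\in\mathcal{L}(X,Y)}\sup\{\|Ax-S\eta\|_Y: x\in\mathfrak{M},\ \eta\in X,\ \|x-\eta\|_X\le\delta\}$. *)

theory Defs
  imports "HOL-Analysis.Analysis" "HOL-Probability.Essential_Supremum"
begin

section \<open>Extremal problems for operators between seminormed spaces\<close>

text \<open>
  A seminormed space of functions is given by a carrier \<open>X\<close> together with an extended-real-valued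
  seminorm \<open>nX\<close>. Elements of the target space may be mere representatives of classes
  (as in \<open>L\<^sub>\<infinity>\<close>): two elements \<open>u\<close>, \<open>v\<close> with \<open>nY (u - v) = 0\<close> are identified, so linearity of an
  operator is required only up to this identification.
\<close>

definition linear_operator ::
  "('i \<Rightarrow> real) set \<Rightarrow> ('j \<Rightarrow> real) set \<Rightarrow> (('j \<Rightarrow> real) \<Rightarrow> ereal)
    \<Rightarrow> (('i \<Rightarrow> real) \<Rightarrow> ('j \<Rightarrow> real)) \<Rightarrow> bool" where
  "linear_operator X Y nY S \<longleftrightarrow>
     (\<forall>x\<in>X. S x \<in> Y) \<and>
     (\<forall>x\<in>X. \<forall>y\<in>X. \<forall>a b.
        nY (S (\<lambda>i. a * x i + b * y i) - (\<lambda>j. a * S x j + b * S y j)) = 0)"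

definition operator_norm ::
  "('i \<Rightarrow> real) set \<Rightarrow> (('i \<Rightarrow> real) \<Rightarrow> ereal) \<Rightarrow> (('j \<Rightarrow> real) \<Rightarrow> ereal)
    \<Rightarrow> (('i \<Rightarrow> real) \<Rightarrow> ('j \<Rightarrow> real)) \<Rightarrow> ereal" where
  "operator_norm X nX nY S = (SUP x\<in>{x\<in>X. nX x \<le> 1}. nY (S x))"

definition bounded_operators ::
  "('i \<Rightarrow> real) set \<Rightarrow> (('i \<Rightarrow> real) \<Rightarrow> ereal) \<Rightarrow> ('j \<Rightarrow> real) set \<Rightarrow> (('j \<Rightarrow> real) \<Rightarrow> ereal)
    \<Rightarrow> (('i \<Rightarrow> real) \<Rightarrow> ('j \<Rightarrow> real)) set" where
  "bounded_operators X nX Y nY =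
     {S. linear_operator X Y nY S \<and> operator_norm X nX nY S < \<infinity>}"

definition modulus_of_continuity ::
  "(('i \<Rightarrow> real) \<Rightarrow> ereal) \<Rightarrow> (('j \<Rightarrow> real) \<Rightarrow> ereal)
    \<Rightarrow> (('i \<Rightarrow> real) \<Rightarrow> ('j \<Rightarrow> real)) \<Rightarrow> ('i \<Rightarrow> real) set \<Rightarrow> real \<Rightarrow> ereal" where
  "modulus_of_continuity nX nY A M \<delta> = (SUP x\<in>{x\<in>M. nX x \<le> ereal \<delta>}. nY (A x))"

definition best_approximation ::
  "('i \<Rightarrow> real) set \<Rightarrow> (('i \<Rightarrow> real) \<Rightarrow> ereal) \<Rightarrow> ('j \<Rightarrow> real) set \<Rightarrow> (('j \<Rightarrow> real) \<Rightarrow> ereal)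
    \<Rightarrow> (('i \<Rightarrow> real) \<Rightarrow> ('j \<Rightarrow> real)) \<Rightarrow> ('i \<Rightarrow> real) set \<Rightarrow> real \<Rightarrow> ereal" where
  "best_approximation X nX Y nY A M N =
     (INF S\<in>{S \<in> bounded_operators X nX Y nY. operator_norm X nX nY S \<le> ereal N}.
        SUP x\<in>M. nY (A x - S x))"

definition optimal_recovery_error ::
  "('i \<Rightarrow> real) set \<Rightarrow> (('i \<Rightarrow> real) \<Rightarrow> ereal) \<Rightarrow> (('j \<Rightarrow> real) \<Rightarrow> ereal)
    \<Rightarrow> (('i \<Rightarrow> real) \<Rightarrow> ('j \<Rightarrow> real)) \<Rightarrow> ('i \<Rightarrow> real) set
    \<Rightarrow> (('i \<Rightarrow> real) \<Rightarrow> ('j \<Rightarrow> real)) set \<Rightarrow> real \<Rightarrow> ereal" where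
  "optimal_recovery_error X nX nY A M L \<delta> =
     (INF S\<in>L. SUP (x, \<eta>)\<in>{(x, \<eta>). x \<in> M \<and> \<eta> \<in> X \<and> nX (x - \<eta>) \<le> ereal \<delta>}.
        nY (A x - S \<eta>))"


section \<open>Cones and norms generated by convex bodies\<close>

text \<open>The library predicate \<^const>\<open>cone\<close> also demands closure under multiplication by \<open>0\<close>, which for
  a nonempty open set would leave only the whole space.\<close>

definition positive_cone :: "'a::real_vector set \<Rightarrow> bool" where
  "positive_cone C \<longleftrightarrow> (\<forall>x\<in>C. \<forall>t>0. t *\<^sub>R x \<in> C)"

definition body_norm :: "'a::real_vector set \<Rightarrow> 'a \<Rightarrow> real" where
  "body_norm K x = Inf {t. t > 0 \<and> x \<in> (*\<^sub>R) t ` K}"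

definition dual_body_norm :: "'a::real_inner set \<Rightarrow> 'a \<Rightarrow> real" where
  "dual_body_norm K z = Sup {x \<bullet> z | x. body_norm K x \<le> 1}"


section \<open>The space of essentially bounded functions and distributional derivatives\<close>

definition Linfty_norm :: "'a::euclidean_space set \<Rightarrow> ('a \<Rightarrow> real) \<Rightarrow> ereal" where
  "Linfty_norm C f = esssup (lebesgue_on C) (\<lambda>x. ereal \<bar>f x\<bar>)"

definition Linfty :: "'a::euclidean_space set \<Rightarrow> ('a \<Rightarrow> real) set" where
  "Linfty C = {f \<in> borel_measurable (lebesgue_on C). Linfty_norm C f < \<infinity>}"

primrec Ck :: "nat \<Rightarrow> ('a::euclidean_space \<Rightarrow> real) \<Rightarrow> bool" where
  "Ck 0 \<phi> \<longleftrightarrow> continuous_on UNIV \<phi>"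
| "Ck (Suc k) \<phi> \<longleftrightarrow> (\<forall>x. \<phi> differentiable (at x)) \<and>
     (\<forall>b\<in>Basis. Ck k (\<lambda>x. frechet_derivative \<phi> (at x) b))"

definition test_functions :: "'a::euclidean_space set \<Rightarrow> ('a \<Rightarrow> real) set" where
  "test_functions C =
     {\<phi>. (\<forall>k. Ck k \<phi>) \<and> compact (closure {x. \<phi> x \<noteq> 0}) \<and> closure {x. \<phi> x \<noteq> 0} \<subseteq> C}"

definition has_weak_partial ::
  "'a::euclidean_space set \<Rightarrow> 'a \<Rightarrow> ('a \<Rightarrow> real) \<Rightarrow> ('a \<Rightarrow> real) \<Rightarrow> bool" where
  "has_weak_partial C b f g \<longleftrightarrow>
     (\<forall>Q. compact Q \<and> Q \<subseteq> C \<longrightarrow> set_integrable lebesgue Q g) \<and>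
     (\<forall>\<phi>\<in>test_functions C.
        (LINT x|lebesgue_on C. f x * frechet_derivative \<phi> (at x) b)
          = - (LINT x|lebesgue_on C. g x * \<phi> x))"

definition weak_gradient :: "'a::euclidean_space set \<Rightarrow> ('a \<Rightarrow> real) \<Rightarrow> 'a \<Rightarrow> 'a" where
  "weak_gradient C f x = (\<Sum>b\<in>Basis. (SOME g. has_weak_partial C b f g) x *\<^sub>R b)"

definition W1infty :: "'a::euclidean_space set \<Rightarrow> ('a \<Rightarrow> real) set" where
  "W1infty C = {f \<in> Linfty C. \<forall>b\<in>Basis. \<exists>g\<in>Linfty C. has_weak_partial C b f g}"


section \<open>Charges\<close>

text \<open>A charge is a set function on the Lebesgue measurable subsets of \<open>C\<close>; it is extended by \<open>0\<close> to
  all other sets, so that distinct functions represent distinct charges.\<close>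

definition charges :: "'a::euclidean_space set \<Rightarrow> ('a set \<Rightarrow> real) set" where
  "charges C =
     {\<nu>. (\<forall>A. A \<notin> sets (lebesgue_on C) \<longrightarrow> \<nu> A = 0) \<and>
         (\<forall>F :: nat \<Rightarrow> 'a set. range F \<subseteq> sets (lebesgue_on C) \<and> disjoint_family F
            \<longrightarrow> (\<lambda>n. \<nu> (F n)) sums \<nu> (\<Union>n. F n)) \<and>
         (\<forall>A\<in>null_sets (lebesgue_on C). \<nu> A = 0)}"

definition charge_deriv :: "'a::euclidean_space set \<Rightarrow> ('a set \<Rightarrow> real) \<Rightarrow> 'a \<Rightarrow> real" where
  "charge_deriv C \<nu> =
     (SOME f. integrable (lebesgue_on C) f \<and>
        (\<forall>A\<in>sets (lebesgue_on C). \<nu> A = (LINT x:A|lebesgue_on C. f x)))"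

definition charge_norm_at ::
  "'a::euclidean_space set \<Rightarrow> 'a set \<Rightarrow> real \<Rightarrow> ('a set \<Rightarrow> real) \<Rightarrow> ereal" where
  "charge_norm_at K C h \<nu> =
     esssup (lebesgue_on C) (\<lambda>x. ereal \<bar>\<nu> ((+) x ` ((*\<^sub>R) h ` K \<inter> C))\<bar>)"

definition charge_norm ::
  "'a::euclidean_space set \<Rightarrow> 'a set \<Rightarrow> ('a set \<Rightarrow> real) \<Rightarrow> ereal" where
  "charge_norm K C \<nu> = (SUP h\<in>{0<..}. charge_norm_at K C h \<nu>)"

definition bounded_charges ::
  "'a::euclidean_space set \<Rightarrow> 'a set \<Rightarrow> ('a set \<Rightarrow> real) set" where
  "bounded_charges K C = {\<nu> \<in> charges C. charge_norm K C \<nu> < \<infinity>}"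

definition sobolev_charges ::
  "'a::euclidean_space set \<Rightarrow> 'a set \<Rightarrow> ('a set \<Rightarrow> real) set" where
  "sobolev_charges K C = {\<nu> \<in> bounded_charges K C. charge_deriv C \<nu> \<in> W1infty C}"

definition sobolev_charge_class ::
  "'a::euclidean_space set \<Rightarrow> 'a set \<Rightarrow> ('a set \<Rightarrow> real) set" where
  "sobolev_charge_class K C =
     {\<nu> \<in> sobolev_charges K C.
        Linfty_norm C (\<lambda>x. dual_body_norm K (weak_gradient C (charge_deriv C \<nu>) x)) \<le> 1}"

end

theory Submission
  imports Defs
begin

text \<open>
  Write \<open>G = K \<inter> C\<close>, \<open>V\<close> for the volume of \<open>G\<close> and \<open>p\<close> for the norm generated by \<open>K\<close>. A charge \<open>\<nu>\<close> has a
  density \<open>f\<close> (\<open>signed_Radon_Nikodym\<close>), and the natural way to guess \<open>f x\<close> from \<open>\<nu>\<close> is to take the mean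
  of \<open>\<nu>\<close> over \<open>x + hG\<close>, which lies in \<open>C\<close> because a convex cone is closed under addition.

  For \<open>\<nu>\<close> in the class, \<open>\<bar>f (x + v) - f x\<bar> \<le> p v\<close> for almost all \<open>x\<close> and \<open>v\<close> in \<open>C\<close>, so this mean differs
  from \<open>f x\<close> by at most the mean of \<open>p\<close> over \<open>hG\<close>, which is \<open>h d / (d + 1)\<close> (\<open>average_error\<close>,
  \<open>integral_hat\<close>). As an operator the mean has norm at most \<open>1 / (h\<^sup>d V)\<close>. Hence with norm bound \<open>N\<close>
  one may take \<open>h\<^sup>d = 1 / (N V)\<close>, and with data error \<open>\<delta>\<close> the total error is at most
  \<open>h d / (d + 1) + \<delta> / (h\<^sup>d V)\<close>, which equals \<open>h\<close> for \<open>h\<^sup>d\<^sup>+\<^sup>1 = (d + 1) \<delta> / V\<close>.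

  Both bounds are attained on the charge whose density is the hat \<open>max 0 (h - p)\<close> restricted to \<open>C\<close>. It
  belongs to the class (\<open>extremal_charge_in_class\<close>), its seminorm is at most its total mass
  \<open>h\<^sup>d\<^sup>+\<^sup>1 V / (d + 1)\<close> (\<open>extremal_charge_norm\<close>), and its density has essential supremum \<open>h\<close>. A recovery
  method that receives the zero charge as data for it returns zero, so it errs by \<open>h\<close>; an operator of
  norm \<open>N\<close> produces from it a function bounded by \<open>N h\<^sup>d\<^sup>+\<^sup>1 V / (d + 1)\<close>, so it errs by at least the
  difference to \<open>h\<close>.

  Two points need analysis. The first is the inequality \<open>\<bar>f (x + v) - f x\<bar> \<le> p v\<close>
  (\<open>translate_difference_le\<close>). For a nonnegative test function \<open>\<phi>\<close> and \<open>v \<in> C\<close>, the translates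
  \<open>\<phi> (x - s v)\<close> with \<open>s \<ge> 0\<close> are again test functions on \<open>C\<close>, and the integral of \<open>f\<close> against them has
  derivative in \<open>s\<close> equal to the integral of \<open>v \<bullet> \<nabla>f\<close>, which is at most \<open>p v\<close> times the integral of \<open>\<phi>\<close>.
  Integrating over \<open>0 \<le> s \<le> 1\<close> gives the inequality tested against \<open>\<phi>\<close>, and the fundamental lemma of the
  calculus of variations (\<open>AE_nonpos_if_test_integrals_nonpos\<close>) removes \<open>\<phi>\<close>.

  The second is that the hat has a weak gradient of dual norm at most \<open>1\<close>. Since
  \<open>max 0 (h - p) = max h p - p\<close> is a difference of convex functions, its one-sided directional
  derivatives exist everywhere (\<open>hat_slope_lim\<close>), and being limits of bounded difference quotients they
  are weak derivatives (\<open>hat_integration_by_parts\<close>). The weak gradient in the definition of the class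
  is an arbitrary choice of weak partial derivatives; the bound holds for every choice, again by the
  fundamental lemma, applied to countably many directions.
\<close>

section \<open>The Radon-Nikodym theorem for signed measures\<close>

locale signed_measure =
  fixes M :: "'a measure" and \<nu> :: "'a set \<Rightarrow> real"
  assumes sums: "\<And>F :: nat \<Rightarrow> 'a set. range F \<subseteq> sets M \<Longrightarrow> disjoint_family F
                   \<Longrightarrow> (\<lambda>n. \<nu> (F n)) sums \<nu> (\<Union>n. F n)"
begin

lemma empty: "\<nu> {} = 0"
proof -
  have "(\<lambda>n. \<nu> {}) sums \<nu> (\<Union>n::nat. {})"
    by (rule sums) (auto simp: disjoint_family_on_def)
  then have "summable (\<lambda>n::nat. \<nu> {})" by (simp add: sums_iff)
  then show ?thesis by (simp add: summable_const_iff)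
qed

lemma additive:
  assumes "A \<in> sets M" "B \<in> sets M" "A \<inter> B = {}"
  shows "\<nu> (A \<union> B) = \<nu> A + \<nu> B"
proof -
  have "(\<lambda>n. \<nu> (binaryset A B n)) sums \<nu> (\<Union>n. binaryset A B n)"
    using assms by (intro sums) (auto simp: range_binaryset_eq disjoint_family_on_def binaryset_def)
  moreover have "(\<lambda>n. \<nu> (binaryset A B n)) sums (\<nu> A + \<nu> B)"
    by (rule binaryset_sums[where f=\<nu>, OF empty])
  ultimately show ?thesis by (auto simp: UN_binaryset_eq dest: sums_unique2)
qed

lemma diff:
  assumes "A \<in> sets M" "B \<in> sets M" "B \<subseteq> A"
  shows "\<nu> (A - B) = \<nu> A - \<nu> B"
  using additive[of "A - B" B] assms by (simp add: Un_absorb2 Int_commute)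

text \<open>If \<open>\<nu>\<close> is unbounded on the subsets of \<open>E\<close>, then one can split off from \<open>E\<close> a set of charge at least \<open>1\<close> in
  absolute value such that \<open>\<nu>\<close> is still unbounded on the subsets of the remainder. The sets split off in
  this way are disjoint, and the series of their charges would have to converge.\<close>

lemma bounded_range: "\<exists>c. \<forall>A\<in>sets M. \<bar>\<nu> A\<bar> \<le> c"
proof (rule ccontr)
  assume nb: "\<not> ?thesis"
  define bad where "bad E \<longleftrightarrow> E \<in> sets M \<and> (\<forall>c. \<exists>B\<in>sets M. B \<subseteq> E \<and> c < \<bar>\<nu> B\<bar>)" for E
  have bad_space: "bad (space M)"
    using nb unfolding bad_def by (metis not_le sets.sets_into_space sets.top)
  have step: "\<exists>E'. bad E' \<and> E' \<subseteq> E \<and> 1 \<le> \<bar>\<nu> (E - E')\<bar>" if E: "bad E" for E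
  proof -
    obtain B where B: "B \<in> sets M" "B \<subseteq> E" "\<bar>\<nu> E\<bar> + 1 < \<bar>\<nu> B\<bar>"
      using E unfolding bad_def by blast
    have Em: "E \<in> sets M" using E by (simp add: bad_def)
    have D: "\<nu> (E - B) = \<nu> E - \<nu> B" using diff[OF Em B(1,2)] .
    have EEB: "E - (E - B) = B" using B(2) by blast
    show ?thesis
    proof (cases "bad B")
      case True
      have "1 \<le> \<bar>\<nu> (E - B)\<bar>" unfolding D using B(3) by linarith
      then show ?thesis using True B(2) by blast
    next
      case False
      then obtain c1 where c1: "\<And>A. A \<in> sets M \<Longrightarrow> A \<subseteq> B \<Longrightarrow> \<bar>\<nu> A\<bar> \<le> c1"
        using B(1) unfolding bad_def by (auto simp: not_less)
      \<comment> \<open>The part inside \<open>B\<close> contributes at most \<open>c1\<close>, so large charges in \<open>E\<close> come from \<open>E - B\<close>.\<close>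
      have "bad (E - B)" unfolding bad_def
      proof (intro conjI allI)
        show "E - B \<in> sets M" using Em B(1) by auto
        fix c
        obtain A where A: "A \<in> sets M" "A \<subseteq> E" "c + c1 < \<bar>\<nu> A\<bar>"
          using E unfolding bad_def by blast
        have "\<nu> A = \<nu> (A \<inter> B) + \<nu> (A - B)"
          using additive[of "A \<inter> B" "A - B"] A B by (simp add: Int_Diff_Un Int_Diff_disjoint)
        moreover have "\<bar>\<nu> (A \<inter> B)\<bar> \<le> c1" using A B by (intro c1) auto
        ultimately have "c < \<bar>\<nu> (A - B)\<bar>" using A(3) by linarith
        then show "\<exists>Ba\<in>sets M. Ba \<subseteq> E - B \<and> c < \<bar>\<nu> Ba\<bar>"
          using A B by (intro bexI[of _ "A - B"]) auto
      qed
      moreover have "1 \<le> \<bar>\<nu> (E - (E - B))\<bar>" unfolding EEB using B(3) by linarith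
      ultimately show ?thesis by blast
    qed
  qed
  obtain E where E: "\<And>n::nat. bad (E n) \<and> E (Suc n) \<subseteq> E n \<and> 1 \<le> \<bar>\<nu> (E n - E (Suc n))\<bar>"
  proof -
    have "\<exists>f. \<forall>n::nat. bad (f n) \<and> (f (Suc n) \<subseteq> f n \<and> 1 \<le> \<bar>\<nu> (f n - f (Suc n))\<bar>)"
      by (rule dependent_nat_choice) (use bad_space step in auto)
    then show thesis using that by blast
  qed
  have dec: "decseq E" using E by (intro decseq_SucI) auto
  define F where "F n = E n - E (Suc n)" for n
  have "disjoint_family F"
    unfolding disjoint_family_on_def
  proof (intro ballI impI)
    fix m n :: nat assume "m \<noteq> n"
    then consider "Suc m \<le> n" | "Suc n \<le> m" by linarith
    then show "F m \<inter> F n = {}"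
      by cases (use decseqD[OF dec] in \<open>auto simp: F_def\<close>)
  qed
  moreover have "range F \<subseteq> sets M"
    using E by (auto simp: F_def bad_def)
  ultimately have "summable (\<lambda>n. \<nu> (F n))" using sums by (auto simp: sums_iff)
  then have "(\<lambda>n. \<nu> (F n)) \<longlonglongrightarrow> 0" by (rule summable_LIMSEQ_zero)
  then have "eventually (\<lambda>n. \<bar>\<nu> (F n)\<bar> < 1) sequentially"
    by (auto dest!: tendstoD[where e=1] simp: dist_real_def)
  then show False using E unfolding F_def by (auto simp: eventually_sequentially not_less[symmetric])
qed

text \<open>The positive part in the Jordan decomposition. Coercion to \<^typ>\<open>ennreal\<close> turns negative charges into
  \<open>0\<close>, the charge of the empty set, so it does not change the supremum.\<close>

definition upper_variation :: "'a set \<Rightarrow> ennreal" where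
  "upper_variation A = (SUP B\<in>{B\<in>sets M. B \<subseteq> A}. ennreal (\<nu> B))"

lemma upper_variation_le:
  assumes "\<And>A. A \<in> sets M \<Longrightarrow> \<bar>\<nu> A\<bar> \<le> c"
  shows "upper_variation A \<le> ennreal c"
  unfolding upper_variation_def
  by (intro SUP_least ennreal_leI) (use assms in \<open>auto dest: abs_le_D1\<close>)

lemma upper_variation_superadditive:
  assumes "A \<inter> B = {}"
  shows "upper_variation A + upper_variation B \<le> upper_variation (A \<union> B)"
proof -
  have ex: "\<exists>D'\<in>sets M. D' \<subseteq> D \<and> ennreal (\<nu> D) = ennreal (\<nu> D') \<and> 0 \<le> \<nu> D'"
    if D: "D \<in> sets M" for D
  proof (cases "0 \<le> \<nu> D")
    case False
    then show ?thesis using empty by (intro bexI[of _ "{}"]) (auto simp: ennreal_neg)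
  qed (use D in auto)
  have 1: "ennreal (\<nu> D1) + ennreal (\<nu> D2) \<le> upper_variation (A \<union> B)"
    if D: "D1 \<in> sets M" "D1 \<subseteq> A" "D2 \<in> sets M" "D2 \<subseteq> B" for D1 D2
  proof -
    obtain D1' where 1: "D1' \<in> sets M" "D1' \<subseteq> D1" "ennreal (\<nu> D1) = ennreal (\<nu> D1')" "0 \<le> \<nu> D1'"
      using ex[OF D(1)] by blast
    obtain D2' where 2: "D2' \<in> sets M" "D2' \<subseteq> D2" "ennreal (\<nu> D2) = ennreal (\<nu> D2')" "0 \<le> \<nu> D2'"
      using ex[OF D(3)] by blast
    have "D1' \<inter> D2' = {}" using 1(2) 2(2) D(2,4) assms by blast
    then have "\<nu> (D1' \<union> D2') = \<nu> D1' + \<nu> D2'" using additive 1(1) 2(1) by blast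
    then have "ennreal (\<nu> D1) + ennreal (\<nu> D2) = ennreal (\<nu> (D1' \<union> D2'))"
      using 1(3,4) 2(3,4) by (simp add: ennreal_plus)
    also have "\<dots> \<le> upper_variation (A \<union> B)"
      unfolding upper_variation_def using 1 2 D by (intro SUP_upper) auto
    finally show ?thesis .
  qed
  have 2: "ennreal (\<nu> D1) + upper_variation B \<le> upper_variation (A \<union> B)"
    if D: "D1 \<in> sets M" "D1 \<subseteq> A" for D1
  proof -
    have "ennreal (\<nu> D1) + upper_variation B
        = (SUP D2\<in>{D\<in>sets M. D \<subseteq> B}. ennreal (\<nu> D1) + ennreal (\<nu> D2))"
      unfolding upper_variation_def by (rule ennreal_SUP_add_right) (auto intro: exI[of _ "{}"])
    also have "\<dots> \<le> upper_variation (A \<union> B)" using 1 D by (intro SUP_least) auto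
    finally show ?thesis .
  qed
  have "upper_variation A + upper_variation B
      = (SUP D\<in>{D\<in>sets M. D \<subseteq> A}. ennreal (\<nu> D) + upper_variation B)"
    unfolding upper_variation_def by (rule ennreal_SUP_add_left[symmetric]) (auto intro: exI[of _ "{}"])
  also have "\<dots> \<le> upper_variation (A \<union> B)" using 2 by (intro SUP_least) auto
  finally show ?thesis .
qed

lemma upper_variation_mono: "A \<subseteq> B \<Longrightarrow> upper_variation A \<le> upper_variation B"
  unfolding upper_variation_def by (intro SUP_subset_mono) auto

text \<open>One inequality is superadditivity for finite unions; for the other, a subset of the union is cut
  along the disjoint family.\<close>

lemma countably_additive_upper_variation: "countably_additive (sets M) upper_variation"
proof (rule countably_additiveI)
  fix F :: "nat \<Rightarrow> 'a set"
  assume F: "range F \<subseteq> sets M" "disjoint_family F" "(\<Union>n. F n) \<in> sets M"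
  show "(\<Sum>n. upper_variation (F n)) = upper_variation (\<Union>n. F n)"
  proof (rule antisym)
    have fin: "(\<Sum>n<k. upper_variation (F n)) \<le> upper_variation (\<Union>n<k. F n)" for k
    proof (induction k)
      case (Suc k)
      have "F n \<inter> F k = {}" if "n < k" for n
        using F(2) that by (simp add: disjoint_family_on_def)
      then have "(\<Union>n<k. F n) \<inter> F k = {}" by blast
      then have "upper_variation (\<Union>n<k. F n) + upper_variation (F k)
            \<le> upper_variation ((\<Union>n<k. F n) \<union> F k)"
        by (rule upper_variation_superadditive)
      moreover have "(\<Union>n<k. F n) \<union> F k = (\<Union>n<Suc k. F n)"
        by (simp add: lessThan_Suc Un_commute)
      ultimately have "upper_variation (\<Union>n<k. F n) + upper_variation (F k)
            \<le> upper_variation (\<Union>n<Suc k. F n)" by simp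
      from order_trans[OF add_right_mono[OF Suc.IH] this] show ?case by simp
    qed (simp add: upper_variation_def empty)
    show "(\<Sum>n. upper_variation (F n)) \<le> upper_variation (\<Union>n. F n)"
      unfolding suminf_eq_SUP
      by (intro SUP_least order_trans[OF fin] upper_variation_mono) auto
  next
    show "upper_variation (\<Union>n. F n) \<le> (\<Sum>n. upper_variation (F n))"
      unfolding upper_variation_def[of "\<Union>n. F n"]
    proof (rule SUP_least, clarify)
      fix B assume B: "B \<in> sets M" "B \<subseteq> (\<Union>n. F n)"
      have s: "(\<lambda>n. \<nu> (B \<inter> F n)) sums \<nu> (\<Union>n. B \<inter> F n)"
        using F B by (intro sums) (auto simp: disjoint_family_on_def)
      have BB: "(\<Union>n. B \<inter> F n) = B" using B by blast
      have le: "(\<Sum>n<k. ennreal (\<nu> (B \<inter> F n))) \<le> (\<Sum>n. upper_variation (F n))" for k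
      proof -
        have "(\<Sum>n<k. ennreal (\<nu> (B \<inter> F n))) \<le> (\<Sum>n<k. upper_variation (F n))"
          unfolding upper_variation_def using F B by (intro sum_mono SUP_upper) auto
        also have "\<dots> \<le> (\<Sum>n. upper_variation (F n))" by (rule sum_le_suminf) auto
        finally show ?thesis .
      qed
      have "ennreal (\<Sum>n<k. \<nu> (B \<inter> F n)) \<le> (\<Sum>n. upper_variation (F n))" for k
      proof (rule order_trans[OF _ le[of k]])
        have "ennreal (\<Sum>n<k. \<nu> (B \<inter> F n)) \<le> ennreal (\<Sum>n<k. max 0 (\<nu> (B \<inter> F n)))"
          by (intro ennreal_leI sum_mono) auto
        also have "\<dots> = (\<Sum>n<k. ennreal (\<nu> (B \<inter> F n)))"
          by (subst sum_ennreal[symmetric]) (auto simp: ennreal_max_0)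
        finally show "ennreal (\<Sum>n<k. \<nu> (B \<inter> F n)) \<le> (\<Sum>n<k. ennreal (\<nu> (B \<inter> F n)))" .
      qed
      moreover have "(\<lambda>k. ennreal (\<Sum>n<k. \<nu> (B \<inter> F n))) \<longlonglongrightarrow> ennreal (\<nu> B)"
        using s unfolding sums_def BB by (rule tendsto_ennrealI)
      ultimately show "ennreal (\<nu> B) \<le> (\<Sum>n. upper_variation (F n))"
        by (intro LIMSEQ_le_const2) auto
    qed
  qed
qed

lemma upper_variation_density:
  assumes "sigma_finite_measure M" and null: "\<And>A. A \<in> null_sets M \<Longrightarrow> \<nu> A = 0"
  obtains f where "integrable M f" and
    "\<And>A. A \<in> sets M \<Longrightarrow> upper_variation A = ennreal (LINT x:A|M. f x)" and
    "\<And>A. A \<in> sets M \<Longrightarrow> 0 \<le> (LINT x:A|M. f x)"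
proof -
  interpret M: sigma_finite_measure M by fact
  obtain c where c: "\<And>A. A \<in> sets M \<Longrightarrow> \<bar>\<nu> A\<bar> \<le> c" using bounded_range by blast
  define N where "N = measure_of (space M) (sets M) upper_variation"
  have "upper_variation {} = 0"
    unfolding upper_variation_def by (rule antisym, rule SUP_least) (auto simp: empty)
  then have em: "emeasure N A = upper_variation A" if "A \<in> sets M" for A
    unfolding N_def using that countably_additive_upper_variation
    by (intro emeasure_measure_of_sigma sets.sigma_algebra_axioms) (auto simp: positive_def)
  have sN [simp]: "sets N = sets M" "space N = space M" by (auto simp: N_def)
  have "absolutely_continuous M N"
    unfolding absolutely_continuous_def
  proof
    fix A assume A: "A \<in> null_sets M"
    then have AM: "A \<in> sets M" by auto
    have "upper_variation A \<le> 0"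
      unfolding upper_variation_def
      using null null_sets_subset[OF A] by (intro SUP_least) auto
    then show "A \<in> null_sets N" using AM em by (intro null_setsI) (auto simp: le_zero_eq)
  qed
  then obtain g where g: "g \<in> borel_measurable M" "density M g = N"
    using M.Radon_Nikodym[of N] by auto
  have int: "(\<integral>\<^sup>+x\<in>A. g x \<partial>M) = upper_variation A" if "A \<in> sets M" for A
    using that g em by (metis emeasure_density)
  have fin: "(\<integral>\<^sup>+x. g x \<partial>M) < \<infinity>"
  proof -
    have "(\<integral>\<^sup>+x. g x \<partial>M) = (\<integral>\<^sup>+x\<in>space M. g x \<partial>M)"
      by (intro nn_integral_cong) auto
    also have "\<dots> \<le> ennreal c" using int[of "space M"] upper_variation_le[OF c] by auto
    finally show ?thesis by (auto simp: less_top[symmetric] top_unique)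
  qed
  then have AE: "AE x in M. g x \<noteq> \<infinity>"
    using g(1) by (intro nn_integral_PInf_AE) auto
  define f where "f x = enn2real (g x)" for x
  have fg: "AE x in M. g x = ennreal (f x)"
    using AE by eventually_elim (auto simp: f_def less_top)
  have fm [measurable]: "f \<in> borel_measurable M" unfolding f_def using g(1) by measurable
  have "(\<integral>\<^sup>+x. ennreal (f x) \<partial>M) = (\<integral>\<^sup>+x. g x \<partial>M)"
    using fg by (intro nn_integral_cong_AE) auto
  then have fi: "integrable M f" using fin by (intro integrableI_nonneg) (auto simp: f_def)
  show thesis
  proof
    show "integrable M f" by fact
    fix A assume A: "A \<in> sets M"
    show "0 \<le> (LINT x:A|M. f x)"
      unfolding set_lebesgue_integral_def by (intro integral_nonneg_AE) (auto simp: f_def)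
    have "upper_variation A = (\<integral>\<^sup>+x. ennreal (indicator A x * f x) \<partial>M)"
      unfolding int[OF A, symmetric]
      using fg by (intro nn_integral_cong_AE) (auto elim!: eventually_mono simp: indicator_def)
    also have "\<dots> = ennreal (LINT x:A|M. f x)"
      unfolding set_lebesgue_integral_def real_scaleR_def
      using integrable_mult_indicator[OF A fi]
      by (intro nn_integral_eq_integral) (auto simp: f_def)
    finally show "upper_variation A = ennreal (LINT x:A|M. f x)" .
  qed
qed

end

text \<open>The density is the difference of the densities of the upper variations of \<open>\<nu>\<close> and \<open>- \<nu>\<close>. Passing
  from \<open>B\<close> to \<open>A - B\<close> shows that these two suprema over subsets of \<open>A\<close> differ by \<open>\<nu> A\<close>; finiteness of the
  first makes the subtraction legitimate.\<close>

lemma signed_Radon_Nikodym: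
  assumes "signed_measure M \<nu>" and sf: "sigma_finite_measure M"
    and null: "\<And>A. A \<in> null_sets M \<Longrightarrow> \<nu> A = 0"
  obtains f where "integrable M f" and "\<And>A. A \<in> sets M \<Longrightarrow> \<nu> A = (LINT x:A|M. f x)"
proof -
  interpret P: signed_measure M \<nu> by fact
  interpret N: signed_measure M "\<lambda>A. - \<nu> A"
    by unfold_locales (auto intro: sums_minus P.sums)
  obtain f where f: "integrable M f"
    "\<And>A. A \<in> sets M \<Longrightarrow> P.upper_variation A = ennreal (LINT x:A|M. f x)"
    "\<And>A. A \<in> sets M \<Longrightarrow> 0 \<le> (LINT x:A|M. f x)"
    using P.upper_variation_density[OF sf null] by blast
  obtain g where g: "integrable M g"
    "\<And>A. A \<in> sets M \<Longrightarrow> N.upper_variation A = ennreal (LINT x:A|M. g x)"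
    "\<And>A. A \<in> sets M \<Longrightarrow> 0 \<le> (LINT x:A|M. g x)"
    using N.upper_variation_density[OF sf] null by auto
  have f': "\<nu> B \<le> (LINT x:A|M. f x)" if "A \<in> sets M" "B \<in> sets M" "B \<subseteq> A" for A B
  proof -
    have "ennreal (\<nu> B) \<le> ennreal (LINT x:A|M. f x)"
      unfolding f(2)[OF that(1), symmetric] P.upper_variation_def using that by (intro SUP_upper) auto
    then show ?thesis using f(3)[OF that(1)] by (simp add: ennreal_le_iff)
  qed
  have g': "- \<nu> B \<le> (LINT x:A|M. g x)" if "A \<in> sets M" "B \<in> sets M" "B \<subseteq> A" for A B
  proof -
    have "ennreal (- \<nu> B) \<le> ennreal (LINT x:A|M. g x)"
      unfolding g(2)[OF that(1), symmetric] N.upper_variation_def using that by (intro SUP_upper) auto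
    then show ?thesis using g(3)[OF that(1)] by (simp add: ennreal_le_iff)
  qed
  have eq: "\<nu> A = (LINT x:A|M. f x) - (LINT x:A|M. g x)" if A: "A \<in> sets M" for A
  proof (rule antisym)
    have "(LINT x:A|M. f x) \<le> \<nu> A + (LINT x:A|M. g x)"
    proof -
      have nn: "0 \<le> \<nu> A + (LINT x:A|M. g x)" using g'[OF A A] by simp
      have "ennreal (LINT x:A|M. f x) \<le> ennreal (\<nu> A + (LINT x:A|M. g x))"
        unfolding f(2)[OF A, symmetric] P.upper_variation_def
      proof (intro SUP_least ennreal_leI, clarify)
        fix B assume B: "B \<in> sets M" "B \<subseteq> A"
        have "\<nu> B - \<nu> A = - \<nu> (A - B)" using P.diff[OF A B] by simp
        also have "\<dots> \<le> (LINT x:A|M. g x)" using A B by (intro g') auto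
        finally show "\<nu> B \<le> \<nu> A + (LINT x:A|M. g x)" by simp
      qed
      then show ?thesis using nn by (simp add: ennreal_le_iff)
    qed
    then show "(LINT x:A|M. f x) - (LINT x:A|M. g x) \<le> \<nu> A" by simp
    have "(LINT x:A|M. g x) \<le> (LINT x:A|M. f x) - \<nu> A"
    proof -
      have nn: "0 \<le> (LINT x:A|M. f x) - \<nu> A" using f'[OF A A] by simp
      have "ennreal (LINT x:A|M. g x) \<le> ennreal ((LINT x:A|M. f x) - \<nu> A)"
        unfolding g(2)[OF A, symmetric] N.upper_variation_def
      proof (intro SUP_least ennreal_leI, clarify)
        fix B assume B: "B \<in> sets M" "B \<subseteq> A"
        have "\<nu> A - \<nu> B = \<nu> (A - B)" using P.diff[OF A B] by simp
        also have "\<dots> \<le> (LINT x:A|M. f x)" using A B by (intro f') auto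
        finally show "- \<nu> B \<le> (LINT x:A|M. f x) - \<nu> A" by simp
      qed
      then show ?thesis using nn by (simp add: ennreal_le_iff)
    qed
    then show "\<nu> A \<le> (LINT x:A|M. f x) - (LINT x:A|M. g x)" by simp
  qed
  show thesis
  proof
    show "integrable M (\<lambda>x. f x - g x)" using f(1) g(1) by auto
    fix A assume A: "A \<in> sets M"
    show "\<nu> A = (LINT x:A|M. f x - g x)"
      unfolding eq[OF A] using integrable_mult_indicator[OF A f(1)] integrable_mult_indicator[OF A g(1)]
      by (intro set_integral_diff(2)[symmetric]) (auto simp: set_integrable_def)
  qed
qed

section \<open>The norm generated by a convex body, and cones\<close>

locale symmetric_body =
  fixes K :: "'a::euclidean_space set"
  assumes open_K: "open K" and bounded_K: "bounded K" and convex_K: "convex K"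
    and symmetric_K: "\<And>x. x \<in> K \<Longrightarrow> - x \<in> K" and zero_in_K: "0 \<in> K"
begin

lemma scaled_mem_iff: "t > 0 \<Longrightarrow> x \<in> (*\<^sub>R) t ` K \<longleftrightarrow> (1 / t) *\<^sub>R x \<in> K"
  by (auto simp: image_iff intro!: bexI[of _ "(1 / t) *\<^sub>R x"])

lemma shrink_mem: "x \<in> K \<Longrightarrow> 0 \<le> c \<Longrightarrow> c \<le> 1 \<Longrightarrow> c *\<^sub>R x \<in> K"
  using convexD_alt[OF convex_K zero_in_K, of x c] by simp

lemma inner_radius: obtains r where "r > 0" "\<And>x. norm x < r \<Longrightarrow> x \<in> K"
proof -
  obtain r where "r > 0" "ball 0 r \<subseteq> K" using open_contains_ball[of K] open_K zero_in_K by blast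
  then show thesis by (intro that[of r]) auto
qed

lemma outer_radius: obtains R where "R > 0" "\<And>x. x \<in> K \<Longrightarrow> norm x \<le> R"
  using bounded_K bounded_pos by blast

lemma body_norm_set_bdd: "bdd_below {t. t > 0 \<and> x \<in> (*\<^sub>R) t ` K}"
  by (rule bdd_belowI[of _ 0]) auto

lemma body_norm_set_nonempty: "{t. t > 0 \<and> x \<in> (*\<^sub>R) t ` K} \<noteq> {}"
proof -
  obtain r where r: "r > 0" "\<And>x. norm x < r \<Longrightarrow> x \<in> K" using inner_radius by blast
  define t where "t = (norm x + 1) / r"
  have t: "t > 0" using r(1) by (simp add: t_def add_nonneg_pos)
  have "norm ((1 / t) *\<^sub>R x) = r * (norm x / (norm x + 1))"
    using t r(1) by (simp add: t_def)
  also have "\<dots> < r * 1" using r(1) by (intro mult_strict_left_mono) (auto simp: divide_simps add_nonneg_pos)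
  finally have "(1 / t) *\<^sub>R x \<in> K" using r(2) by simp
  then show ?thesis using t by (auto simp: scaled_mem_iff)
qed

lemma body_norm_nonneg: "0 \<le> body_norm K x"
  unfolding body_norm_def using body_norm_set_nonempty by (intro cInf_greatest) auto

text \<open>Openness of \<open>K\<close> makes the dilates of \<open>K\<close> the open balls of the norm. The algebraic properties of the
  norm are read off from this equivalence, by comparing the numbers above both sides.\<close>

lemma body_norm_less_iff:
  assumes "t > 0"
  shows "body_norm K x < t \<longleftrightarrow> (1 / t) *\<^sub>R x \<in> K"
proof
  assume "body_norm K x < t"
  then obtain s where s: "s > 0" "s < t" "(1 / s) *\<^sub>R x \<in> K"
    unfolding body_norm_def using cInf_lessD[OF body_norm_set_nonempty, of x t] scaled_mem_iff
    by blast
  have "(s / t) *\<^sub>R ((1 / s) *\<^sub>R x) \<in> K" using s by (intro shrink_mem[OF s(3)]) auto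
  then show "(1 / t) *\<^sub>R x \<in> K" using s by simp
next
  assume x: "(1 / t) *\<^sub>R x \<in> K"
  have "((\<lambda>s. (1 / s) *\<^sub>R x) \<longlongrightarrow> (1 / t) *\<^sub>R x) (at_left t)"
    using assms by (intro tendsto_intros) auto
  then have "eventually (\<lambda>s. (1 / s) *\<^sub>R x \<in> K) (at_left t)"
    using open_K x by (rule topological_tendstoD)
  moreover have "eventually (\<lambda>s. s \<in> {0<..<t}) (at_left t)"
    using assms by (rule eventually_at_left_real)
  ultimately have "eventually (\<lambda>s. (1 / s) *\<^sub>R x \<in> K \<and> s \<in> {0<..<t}) (at_left t)"
    by (rule eventually_conj)
  then obtain s where s: "(1 / s) *\<^sub>R x \<in> K" "0 < s" "s < t"
    using eventually_happens trivial_limit_at_left_real by fastforce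
  have "body_norm K x \<le> s"
    unfolding body_norm_def using s by (intro cInf_lower body_norm_set_bdd) (auto simp: scaled_mem_iff)
  then show "body_norm K x < t" using s by simp
qed

lemma eq_if_same_upper_bounds:
  assumes "0 \<le> a" "0 \<le> b" "\<And>t::real. 0 < t \<Longrightarrow> a < t \<longleftrightarrow> b < t"
  shows "a = b"
  using assms by (meson dual_order.strict_trans2 linorder_cases linorder_not_less order_less_irrefl)

lemma body_norm_scale_pos:
  assumes "c > 0" shows "body_norm K (c *\<^sub>R x) = c * body_norm K x"
proof (rule eq_if_same_upper_bounds)
  fix t :: real assume t: "0 < t"
  have "body_norm K (c *\<^sub>R x) < t \<longleftrightarrow> body_norm K x < t / c"
    using t assms by (subst (1 2) body_norm_less_iff) auto
  then show "body_norm K (c *\<^sub>R x) < t \<longleftrightarrow> c * body_norm K x < t"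
    using assms by (simp add: pos_less_divide_eq mult.commute)
qed (use assms in \<open>auto simp: body_norm_nonneg\<close>)

lemma body_norm_minus: "body_norm K (- x) = body_norm K x"
proof (rule eq_if_same_upper_bounds)
  fix t :: real assume t: "0 < t"
  show "body_norm K (- x) < t \<longleftrightarrow> body_norm K x < t"
    using t symmetric_K[of "(1 / t) *\<^sub>R x"] symmetric_K[of "- ((1 / t) *\<^sub>R x)"]
    by (auto simp: body_norm_less_iff)
qed (auto simp: body_norm_nonneg)

lemma body_norm_zero [simp]: "body_norm K 0 = 0"
  using zero_in_K by (intro eq_if_same_upper_bounds) (auto simp: body_norm_nonneg body_norm_less_iff)

lemma body_norm_triangle: "body_norm K (x + y) \<le> body_norm K x + body_norm K y"
proof (rule field_le_epsilon)
  fix e :: real assume e: "0 < e"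
  define a b where "a = body_norm K x + e / 2" and "b = body_norm K y + e / 2"
  have ab: "a > 0" "b > 0" using e body_norm_nonneg[of x] body_norm_nonneg[of y] by (auto simp: a_def b_def)
  have x: "(1 / a) *\<^sub>R x \<in> K" using ab e by (subst body_norm_less_iff[symmetric]) (auto simp: a_def)
  have y: "(1 / b) *\<^sub>R y \<in> K" using ab e by (subst body_norm_less_iff[symmetric]) (auto simp: b_def)
  have "(a / (a + b)) *\<^sub>R ((1 / a) *\<^sub>R x) + (b / (a + b)) *\<^sub>R ((1 / b) *\<^sub>R y) \<in> K"
    using ab by (intro convexD[OF convex_K x y]) (auto simp: add_divide_distrib[symmetric])
  then have "(1 / (a + b)) *\<^sub>R (x + y) \<in> K" using ab by (simp add: scaleR_add_right)
  then have "body_norm K (x + y) < a + b" using ab by (subst body_norm_less_iff) auto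
  then show "body_norm K (x + y) \<le> body_norm K x + body_norm K y + e" by (simp add: a_def b_def)
qed

lemma body_norm_upper: obtains L where "L > 0" "\<And>x. body_norm K x \<le> L * norm x"
proof -
  obtain r where r: "r > 0" "\<And>x. norm x < r \<Longrightarrow> x \<in> K" using inner_radius by blast
  have "body_norm K x \<le> (1 / r) * norm x" for x
  proof (rule field_le_epsilon)
    fix e :: real assume e: "0 < e"
    let ?t = "(1 / r) * norm x + e"
    have t: "?t > 0" using r(1) e by (simp add: add_nonneg_pos)
    have "norm x < r * ?t" using r(1) e by (simp add: field_simps)
    then have "norm ((1 / ?t) *\<^sub>R x) < r" using t by (simp add: pos_divide_less_eq)
    then show "body_norm K x \<le> ?t" using r(2) t by (intro less_imp_le) (subst body_norm_less_iff, auto)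
  qed
  then show thesis using that[of "1 / r"] r(1) by auto
qed

lemma body_norm_lower: obtains R where "R > 0" "\<And>x. norm x \<le> R * body_norm K x"
proof -
  obtain R where R: "R > 0" "\<And>x. x \<in> K \<Longrightarrow> norm x \<le> R" using outer_radius by blast
  have "norm x \<le> R * body_norm K x" for x
  proof (rule field_le_epsilon)
    fix e :: real assume e: "0 < e"
    let ?t = "body_norm K x + e / R"
    have t: "?t > 0" using R(1) e body_norm_nonneg[of x] by (simp add: add_nonneg_pos)
    have "(1 / ?t) *\<^sub>R x \<in> K" using t R(1) e by (subst body_norm_less_iff[symmetric]) auto
    from R(2)[OF this] have "norm x \<le> R * ?t" using t by (simp add: pos_divide_le_eq)
    then show "norm x \<le> R * body_norm K x + e" using R(1) by (simp add: distrib_left)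
  qed
  then show thesis using that[of R] R(1) by auto
qed

lemma body_norm_diff_le: "\<bar>body_norm K x - body_norm K y\<bar> \<le> body_norm K (x - y)"
  using body_norm_triangle[of "x - y" y] body_norm_triangle[of "y - x" x] body_norm_minus[of "x - y"]
  by auto

lemma continuous_on_body_norm: "continuous_on UNIV (body_norm K)"
proof -
  obtain L where L: "L > 0" "\<And>x. body_norm K x \<le> L * norm x" using body_norm_upper by blast
  have "L-lipschitz_on UNIV (body_norm K)"
    using L body_norm_diff_le order_trans by (intro lipschitz_onI) (fastforce simp: dist_norm)+
  then show ?thesis by (rule lipschitz_on_continuous_on)
qed

lemma body_norm_measurable [measurable]: "body_norm K \<in> borel_measurable borel"
  using continuous_on_body_norm by (rule borel_measurable_continuous_onI)

lemma dual_set_bdd: "bdd_above {x \<bullet> z | x. body_norm K x \<le> 1}"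
proof -
  obtain R where R: "R > 0" "\<And>x. norm x \<le> R * body_norm K x" using body_norm_lower by blast
  have "x \<bullet> z \<le> R * norm z" if "body_norm K x \<le> 1" for x
  proof -
    have "norm x \<le> R * 1" using R that by (meson mult_left_mono less_imp_le order_trans)
    then show ?thesis
      using norm_cauchy_schwarz[of x z] mult_right_mono[of "norm x" R "norm z"] by simp
  qed
  then show ?thesis by (auto simp: bdd_above_def)
qed

lemma inner_le_dual: "body_norm K x \<le> 1 \<Longrightarrow> x \<bullet> z \<le> dual_body_norm K z"
  unfolding dual_body_norm_def using dual_set_bdd by (intro cSup_upper) auto

lemma dual_body_norm_le:
  assumes "\<And>x. x \<bullet> z \<le> c * body_norm K x" "0 \<le> c"
  shows "dual_body_norm K z \<le> c"
proof -
  have "x \<bullet> z \<le> c" if "body_norm K x \<le> 1" for x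
    using assms(1)[of x] mult_left_mono[OF that assms(2)] by simp
  moreover have "body_norm K 0 \<le> 1" by simp
  ultimately show ?thesis unfolding dual_body_norm_def by (intro cSup_least) blast+
qed

lemma dual_body_norm_nonneg: "0 \<le> dual_body_norm K z"
  using inner_le_dual[of 0 z] by simp

lemma inner_le_body_norm:
  assumes "dual_body_norm K z \<le> 1" shows "v \<bullet> z \<le> body_norm K v"
proof (cases "v = 0")
  case False
  obtain R where R: "R > 0" "\<And>x. norm x \<le> R * body_norm K x" using body_norm_lower by blast
  have p: "body_norm K v > 0" using R(1) R(2)[of v] False body_norm_nonneg[of v]
    by (metis less_eq_real_def mult_zero_right norm_le_zero_iff)
  have "((1 / body_norm K v) *\<^sub>R v) \<bullet> z \<le> 1"
    using p by (intro order_trans[OF inner_le_dual assms]) (simp add: body_norm_scale_pos)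
  then show ?thesis using p by (simp add: field_simps)
qed simp

lemma continuous_on_dual_body_norm: "continuous_on UNIV (dual_body_norm K)"
proof -
  obtain R where R: "R > 0" "\<And>x. norm x \<le> R * body_norm K x" using body_norm_lower by blast
  have le: "dual_body_norm K y \<le> dual_body_norm K z + R * norm (y - z)" for y z
  proof -
    have "x \<bullet> y \<le> dual_body_norm K z + R * norm (y - z)" if x: "body_norm K x \<le> 1" for x
    proof -
      have "norm x \<le> R * 1" using R x by (meson mult_left_mono less_imp_le order_trans)
      then have "x \<bullet> (y - z) \<le> R * norm (y - z)"
        using norm_cauchy_schwarz[of x "y - z"] mult_right_mono[of "norm x" R "norm (y - z)"] by simp
      then show ?thesis using inner_le_dual[OF x, of z] by (simp add: inner_diff_right)
    qed
    moreover have "body_norm K 0 \<le> 1" by simp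
    ultimately show ?thesis unfolding dual_body_norm_def[of K y] by (intro cSup_least) blast+
  qed
  have "R-lipschitz_on UNIV (dual_body_norm K)"
  proof (rule lipschitz_onI)
    fix x y show "dist (dual_body_norm K x) (dual_body_norm K y) \<le> R * dist x y"
      using le[of x y] le[of y x] by (auto simp: dist_norm norm_minus_commute abs_le_iff)
  qed (use R in auto)
  then show ?thesis by (rule lipschitz_on_continuous_on)
qed

lemma dual_body_norm_measurable [measurable]: "dual_body_norm K \<in> borel_measurable borel"
  using continuous_on_dual_body_norm by (rule borel_measurable_continuous_onI)

text \<open>Reduces a bound that is known outside a null set depending on the direction to countably many
  directions.\<close>

lemma dual_body_norm_le_1_dense:
  assumes "closure D = UNIV" "\<And>v. v \<in> D \<Longrightarrow> v \<bullet> z \<le> body_norm K v"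
  shows "dual_body_norm K z \<le> 1"
proof (rule dual_body_norm_le)
  have "closed {v. v \<bullet> z \<le> body_norm K v}"
    by (intro closed_Collect_le continuous_on_body_norm continuous_intros)
  then have "closure D \<subseteq> {v. v \<bullet> z \<le> body_norm K v}"
    using assms(2) by (intro closure_minimal) auto
  then show "x \<bullet> z \<le> 1 * body_norm K x" for x using assms(1) by auto
qed simp

end

locale body_and_cone = symmetric_body K for K :: "'a::euclidean_space set" +
  fixes C :: "'a set"
  assumes C_nonempty: "C \<noteq> {}" and open_C: "open C" and convex_C: "convex C"
    and cone_C: "positive_cone C"
begin

lemma cone_scale: "x \<in> C \<Longrightarrow> t > 0 \<Longrightarrow> t *\<^sub>R x \<in> C"
  using cone_C by (auto simp: positive_cone_def)

lemma cone_add: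
  assumes "x \<in> C" "y \<in> C" shows "x + y \<in> C"
proof -
  have "(1/2) *\<^sub>R x + (1/2) *\<^sub>R y \<in> C" by (intro convexD[OF convex_C assms]) auto
  from cone_scale[OF this, of 2] show ?thesis by (simp add: scaleR_add_right)
qed

lemma cone_add_scaled: "x \<in> C \<Longrightarrow> y \<in> C \<Longrightarrow> 0 \<le> t \<Longrightarrow> x + t *\<^sub>R y \<in> C"
  by (cases "t = 0") (auto intro!: cone_add cone_scale)

definition piece :: "real \<Rightarrow> 'a set" where "piece h = (*\<^sub>R) h ` K \<inter> C"

lemma piece_mem: "h > 0 \<Longrightarrow> v \<in> piece h \<longleftrightarrow> v \<in> C \<and> body_norm K v < h"
  by (auto simp: piece_def scaled_mem_iff body_norm_less_iff)

lemma open_piece: "h > 0 \<Longrightarrow> open (piece h)"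
  unfolding piece_def using open_K open_C by (intro open_Int open_scaling) auto

lemma bounded_piece: "bounded (piece h)"
  unfolding piece_def by (intro bounded_Int disjI1 bounded_scaling bounded_K)

lemma piece_measurable [measurable]: "h > 0 \<Longrightarrow> piece h \<in> sets borel"
  using open_piece by auto

lemma piece_eq_scaled:
  assumes h: "h > 0" shows "piece h = (*\<^sub>R) h ` (K \<inter> C)"
proof
  show "piece h \<subseteq> (*\<^sub>R) h ` (K \<inter> C)"
  proof
    fix x assume x: "x \<in> piece h"
    then have "(1 / h) *\<^sub>R x \<in> K \<inter> C" using h by (simp add: piece_def scaled_mem_iff cone_scale)
    moreover have "x = h *\<^sub>R ((1 / h) *\<^sub>R x)" using h by simp
    ultimately show "x \<in> (*\<^sub>R) h ` (K \<inter> C)" by (rule rev_image_eqI)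
  qed
  show "(*\<^sub>R) h ` (K \<inter> C) \<subseteq> piece h" using h by (auto simp: piece_def cone_scale)
qed

definition base_volume :: real where "base_volume = measure lebesgue (K \<inter> C)"

lemma piece_nonempty: assumes "h > 0" shows "piece h \<noteq> {}"
proof -
  obtain x where x: "x \<in> C" using C_nonempty by blast
  define t where "t = h / (2 * (body_norm K x + 1))"
  have p: "0 < body_norm K x + 1" using body_norm_nonneg[of x] by linarith
  then have t: "t > 0" using assms by (simp add: t_def)
  have "t * body_norm K x < h"
    using p assms body_norm_nonneg[of x] by (simp add: t_def field_simps add_strict_increasing)
  then have "t *\<^sub>R x \<in> piece h" using t x assms by (auto simp: piece_mem cone_scale body_norm_scale_pos)
  then show ?thesis by blast
qed

lemma emeasure_piece_finite: "emeasure lborel (piece h) < \<infinity>"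
  using emeasure_bounded_finite[OF bounded_piece] by auto

lemma measure_piece: "h > 0 \<Longrightarrow> measure lborel (piece h) = h ^ DIM('a) * base_volume"
  using measure_lebesgue_affine[of h 0 "K \<inter> C"] open_piece[of h]
  by (simp add: piece_eq_scaled base_volume_def)

lemma base_volume_pos: "base_volume > 0"
proof -
  have "base_volume = measure lborel (piece 1)" using measure_piece[of 1] by simp
  moreover have "emeasure lborel (piece 1) \<noteq> 0"
    using open_piece[of 1] piece_nonempty[of 1] open_not_negligible[of "piece 1"]
    by (auto simp: negligible_iff_emeasure0)
  ultimately show ?thesis
    using emeasure_piece_finite[of 1]
    by (simp add: measure_def enn2real_positive_iff zero_less_iff_neq_zero less_top)
qed

text \<open>Layer cake: \<open>h - p v\<close> is the length of the set of levels \<open>s < h\<close> with \<open>v \<in> sK\<close>, and the set of \<open>v \<in> C\<close> of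
  level \<open>s\<close> has volume \<open>s\<^sup>d\<close> times that of \<open>K \<inter> C\<close>.\<close>

lemma integral_hat:
  assumes h: "h > 0"
  shows "(\<integral>v. indicator (piece h) v * (h - body_norm K v) \<partial>lborel) = h ^ (DIM('a) + 1) * base_volume / (DIM('a) + 1)"
    and "integrable lborel (\<lambda>v. indicator (piece h) v * (h - body_norm K v))"
proof -
  let ?f = "\<lambda>v. indicator (piece h) v * (h - body_norm K v)"
  have nn: "0 \<le> ?f v" for v using h by (auto simp: indicator_def piece_mem)
  have [measurable]: "piece h \<in> sets borel" using h by measurable
  have [measurable]: "C \<in> sets borel" using open_C by auto
  have meas [measurable]: "?f \<in> borel_measurable borel" by measurable
  have "(\<integral>\<^sup>+v. ennreal (?f v) \<partial>lborel)
      = (\<integral>\<^sup>+v. (\<integral>\<^sup>+s. indicator {w. w \<in> C} v * indicator {s. 0 < s \<and> s < h \<and> body_norm K v < s} s \<partial>lborel) \<partial>lborel)"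
  proof (intro nn_integral_cong)
    fix v
    have "{s. 0 < s \<and> s < h \<and> body_norm K v < s} = {body_norm K v<..<h}"
      using body_norm_nonneg[of v] by auto
    then have "(\<integral>\<^sup>+s. indicator {w. w \<in> C} v * indicator {s. 0 < s \<and> s < h \<and> body_norm K v < s} s \<partial>lborel)
        = indicator C v * emeasure lborel {body_norm K v<..<h}"
      by (simp add: nn_integral_cmult)
    also have "\<dots> = ennreal (?f v)"
      using h by (auto simp: indicator_def piece_mem)
    finally show "ennreal (?f v) = (\<integral>\<^sup>+s. indicator {w. w \<in> C} v * indicator {s. 0 < s \<and> s < h \<and> body_norm K v < s} s \<partial>lborel)" ..
  qed
  also have "\<dots> = (\<integral>\<^sup>+v. (\<integral>\<^sup>+s. indicator {(v, s). v \<in> C \<and> 0 < s \<and> s < h \<and> body_norm K v < s} (v, s) \<partial>lborel) \<partial>lborel)"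
    by (intro nn_integral_cong) (auto simp: indicator_def)
  also have "\<dots> = (\<integral>\<^sup>+s. (\<integral>\<^sup>+v. indicator {(v, s). v \<in> C \<and> 0 < s \<and> s < h \<and> body_norm K v < s} (v, s) \<partial>lborel) \<partial>lborel)"
    by (rule lborel_pair.Fubini'[symmetric]) measurable
  also have "\<dots> = (\<integral>\<^sup>+s. ennreal (base_volume * s ^ DIM('a)) * indicator {0..h} s \<partial>lborel)"
  proof (intro nn_integral_cong_AE)
    have "AE s in lborel. s \<noteq> 0 \<and> s \<noteq> h" using AE_lborel_singleton[of 0] AE_lborel_singleton[of h] by eventually_elim auto
    then show "AE s in lborel. (\<integral>\<^sup>+v. indicator {(v, s). v \<in> C \<and> 0 < s \<and> s < h \<and> body_norm K v < s} (v, s) \<partial>lborel)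
        = ennreal (base_volume * s ^ DIM('a)) * indicator {0..h} s"
    proof eventually_elim
      case (elim s)
      show ?case
      proof (cases "0 < s \<and> s < h")
        case True
        then have "(\<integral>\<^sup>+v. indicator {(v, s). v \<in> C \<and> 0 < s \<and> s < h \<and> body_norm K v < s} (v, s) \<partial>lborel)
            = (\<integral>\<^sup>+v. indicator (piece s) v \<partial>lborel)"
          by (intro nn_integral_cong) (auto simp: indicator_def piece_mem)
        also have "\<dots> = emeasure lborel (piece s)" using True open_piece[of s] by simp
        also have "\<dots> = ennreal (base_volume * s ^ DIM('a))"
          using True measure_piece[of s] emeasure_piece_finite[of s]
          by (simp add: emeasure_eq_ennreal_measure mult.commute)
        finally show ?thesis using True by simp
      next
        case False
        then show ?thesis using elim by (auto simp: indicator_def)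
      qed
    qed
  qed
  also have "\<dots> = ennreal (base_volume * h ^ (DIM('a) + 1) / (DIM('a) + 1) - base_volume * 0 ^ (DIM('a) + 1) / (DIM('a) + 1))"
  proof (rule nn_integral_FTC_Icc)
    fix s :: real
    have "((\<lambda>s. base_volume * s ^ Suc DIM('a) / real (Suc DIM('a))) has_real_derivative base_volume * s ^ DIM('a)) (at s)"
      by (auto intro!: derivative_eq_intros simp del: power_Suc of_nat_Suc)
    then show "((\<lambda>s. base_volume * s ^ (DIM('a) + 1) / (DIM('a) + 1)) has_real_derivative base_volume * s ^ DIM('a)) (at s)"
      by (simp add: add.commute)
  qed (use base_volume_pos h in auto)
  finally have nn_int: "(\<integral>\<^sup>+v. ennreal (?f v) \<partial>lborel) = ennreal (h ^ (DIM('a) + 1) * base_volume / (DIM('a) + 1))"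
    by (simp add: mult.commute)
  have ge0: "0 \<le> h ^ (DIM('a) + 1) * base_volume / (DIM('a) + 1)" using base_volume_pos h by simp
  show "integrable lborel ?f"
    using nn nn_int by (intro integrableI_nonneg) auto
  show "(\<integral>v. ?f v \<partial>lborel) = h ^ (DIM('a) + 1) * base_volume / (DIM('a) + 1)"
    using nn ge0 nn_int by (subst integral_eq_nn_integral) auto
qed

end

section \<open>Test functions and the fundamental lemma of the calculus of variations\<close>

definition smooth :: "('a::euclidean_space \<Rightarrow> real) \<Rightarrow> bool" where
  "smooth \<phi> \<longleftrightarrow> (\<forall>k. Ck k \<phi>)"

lemma Ck_Suc_D: "Ck (Suc k) f \<Longrightarrow> Ck k f"
proof (induction k arbitrary: f)
  case 0
  then show ?case
    by (auto simp: continuous_on_eq_continuous_at intro: differentiable_imp_continuous_within)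
next
  case (Suc k)
  then show ?case by (metis Ck.simps(2))
qed

lemma Ck_SucI:
  assumes "\<And>x. (f has_derivative f' x) (at x)" "\<And>b. b \<in> Basis \<Longrightarrow> Ck k (\<lambda>x. f' x b)"
  shows "Ck (Suc k) f"
proof -
  have "frechet_derivative f (at x) = f' x" for x
    using frechet_derivative_at[OF assms(1)] by simp
  then show ?thesis using assms by (auto simp: differentiable_def)
qed

lemma Ck_SucD_has_derivative:
  "Ck (Suc k) f \<Longrightarrow> (f has_derivative frechet_derivative f (at x)) (at x)"
  using frechet_derivative_works by auto

lemma Ck_const: "Ck k (\<lambda>x. c)"
  by (induction k arbitrary: c) auto

lemma Ck_add: "Ck k f \<Longrightarrow> Ck k g \<Longrightarrow> Ck k (\<lambda>x. f x + g x)"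
proof (induction k arbitrary: f g)
  case 0
  then show ?case by (auto intro: continuous_intros)
next
  case (Suc k)
  show ?case
    by (rule Ck_SucI[OF has_derivative_add[OF Suc.prems[THEN Ck_SucD_has_derivative]]])
       (use Suc in auto)
qed

lemma Ck_mult: "Ck k f \<Longrightarrow> Ck k g \<Longrightarrow> Ck k (\<lambda>x. f x * g x)"
proof (induction k arbitrary: f g)
  case 0
  then show ?case by (auto intro: continuous_intros)
next
  case (Suc k)
  show ?case
    by (rule Ck_SucI[OF has_derivative_mult[OF Suc.prems[THEN Ck_SucD_has_derivative]]])
       (use Suc Ck_Suc_D[OF Suc.prems(1)] Ck_Suc_D[OF Suc.prems(2)] in \<open>auto intro!: Ck_add Suc.IH\<close>)
qed

lemma Ck_sum: "(\<And>i. i \<in> I \<Longrightarrow> Ck k (f i)) \<Longrightarrow> Ck k (\<lambda>x. \<Sum>i\<in>I. f i x)"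
  by (induction I rule: infinite_finite_induct) (auto intro: Ck_const Ck_add)

lemma Ck_prod: "(\<And>i. i \<in> I \<Longrightarrow> Ck k (f i)) \<Longrightarrow> Ck k (\<lambda>x. \<Prod>i\<in>I. f i x)"
  by (induction I rule: infinite_finite_induct) (auto intro: Ck_const Ck_mult)

lemma Ck_exp: "Ck k g \<Longrightarrow> Ck k (\<lambda>x. exp (g x))"
proof (induction k arbitrary: g)
  case 0
  then show ?case by (auto intro: continuous_intros)
next
  case (Suc k)
  have "((\<lambda>x. exp (g x)) has_derivative (\<lambda>b. exp (g x) * frechet_derivative g (at x) b)) (at x)" for x
    using has_derivative_exp[OF Ck_SucD_has_derivative[OF Suc.prems], of x]
    by (simp add: mult.commute)
  then show ?case
    by (rule Ck_SucI) (use Suc Ck_Suc_D[OF Suc.prems] in \<open>auto intro!: Ck_mult\<close>)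
qed

lemma Ck_translate: "Ck k f \<Longrightarrow> Ck k (\<lambda>x. f (x + v))"
proof (induction k arbitrary: f)
  case 0
  then show ?case by (auto intro!: continuous_on_compose2[of UNIV f] continuous_intros)
next
  case (Suc k)
  have "((\<lambda>x. f (x + v)) has_derivative frechet_derivative f (at (x + v))) (at x)" for x
  proof -
    have "((\<lambda>x. x + v) has_derivative (\<lambda>h. h)) (at x)" by (auto intro!: derivative_eq_intros)
    from has_derivative_compose[OF this Ck_SucD_has_derivative[OF Suc.prems]] show ?thesis .
  qed
  then show ?case by (rule Ck_SucI) (use Suc in auto)
qed

text \<open>The functions \<open>t\<^sup>-\<^sup>n exp (-1/t)\<close>, extended by \<open>0\<close>: up to linear combinations the family is closed under
  differentiation, so all of them are smooth by one induction.\<close>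

definition flat :: "nat \<Rightarrow> real \<Rightarrow> real" where
  "flat n t = (if t > 0 then (1 / t) ^ n * exp (- (1 / t)) else 0)"

lemma flat_tendsto_0: "(flat n \<longlongrightarrow> 0) (at 0)"
proof -
  have lim: "((\<lambda>t. t ^ n / exp t) \<longlongrightarrow> (0::real)) at_top" by (rule tendsto_power_div_exp_0)
  have "((\<lambda>t. (1 / t) ^ n / exp (1 / t)) \<longlongrightarrow> (0::real)) (at_right 0)"
    using filterlim_compose[OF lim filterlim_inverse_at_top_right] by (simp add: inverse_eq_divide)
  then have "(flat n \<longlongrightarrow> 0) (at_right 0)"
    by (rule Lim_transform_eventually)
       (auto simp: flat_def exp_minus field_simps eventually_at_filter)
  moreover have "(flat n \<longlongrightarrow> 0) (at_left 0)"
    by (rule tendsto_eventually) (auto simp: flat_def eventually_at_filter)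
  ultimately show ?thesis by (simp add: filterlim_split_at)
qed

lemma flat_has_derivative:
  "(flat n has_real_derivative (flat (n + 2) t - real n * flat (n + 1) t)) (at t)"
proof (rule linorder_cases[of t 0])
  assume t: "t < 0"
  have "((\<lambda>_. 0) has_real_derivative 0) (at t)" by simp
  then have "(flat n has_real_derivative 0) (at t)"
    by (rule has_field_derivative_transform_within_open[of _ _ _ "{..<0}"]) (use t in \<open>auto simp: flat_def\<close>)
  then show ?thesis using t by (simp add: flat_def)
next
  assume t: "t > 0"
  have "((\<lambda>t. (1 / t) ^ n * exp (- (1 / t))) has_real_derivative
          (flat (n + 2) t - real n * flat (n + 1) t)) (at t)"
  proof -
    have 1: "((\<lambda>t. 1 / t) has_real_derivative (- ((1 / t) ^ 2))) (at t)"
      using t by (auto intro!: derivative_eq_intros simp: power2_eq_square)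
    have 2: "((\<lambda>s. s ^ n * exp (- s)) has_real_derivative
        (real n * s ^ (n - 1) * exp (- s) - s ^ n * exp (- s))) (at s)" for s :: real
      by (auto intro!: derivative_eq_intros)
    have "(real n * s ^ (n - 1) * exp (- s) - s ^ n * exp (- s)) * (- (s ^ 2))
        = s ^ (n + 2) * exp (- s) - real n * (s ^ (n + 1) * exp (- s))" for s :: real
      by (cases n) (simp_all add: algebra_simps power2_eq_square)
    from DERIV_chain2[OF 2 1, unfolded this] show ?thesis using t by (simp add: flat_def)
  qed
  then show ?thesis
    by (rule has_field_derivative_transform_within_open[of _ _ _ "{0<..}"]) (use t in \<open>auto simp: flat_def\<close>)
next
  assume t: "t = 0"
  have "(\<lambda>h. (flat n (0 + h) - flat n 0) / h) = flat (Suc n)"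
    by (auto simp: flat_def fun_eq_iff)
  then have "(flat n has_real_derivative 0) (at 0)"
    using flat_tendsto_0[of "Suc n"] by (simp add: DERIV_def)
  then show ?thesis using t by (simp add: flat_def)
qed

lemma Ck_flat: "Ck k (\<lambda>x. flat n (x \<bullet> u + a))"
proof (induction k arbitrary: n)
  case 0
  have "continuous_on UNIV (flat n)"
    using DERIV_isCont[OF flat_has_derivative] by (simp add: continuous_on_eq_continuous_at)
  then show ?case by (auto intro!: continuous_on_compose2[of UNIV "flat n"] continuous_intros)
next
  case (Suc k)
  have "((\<lambda>x. flat n (x \<bullet> u + a)) has_derivative
      (\<lambda>h. (flat (n + 2) (x \<bullet> u + a) + (- real n) * flat (n + 1) (x \<bullet> u + a)) * (h \<bullet> u))) (at x)" for x
  proof -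
    have "((\<lambda>x. x \<bullet> u + a) has_derivative (\<lambda>h. h \<bullet> u)) (at x)" by (auto intro!: derivative_eq_intros)
    from has_derivative_compose[OF this flat_has_derivative[unfolded has_field_derivative_def]]
    show ?thesis by simp
  qed
  then show ?case
    by (rule Ck_SucI) (intro Ck_mult Ck_add Ck_const Suc.IH)
qed

text \<open>The factors are functions of affine forms \<open>x \<bullet> u + a\<close>, the shape for which smoothness is known.\<close>

definition bump :: "'a::euclidean_space \<Rightarrow> 'a \<Rightarrow> 'a \<Rightarrow> real" where
  "bump a b x = (\<Prod>i\<in>Basis. flat 0 (x \<bullet> i + - (a \<bullet> i)) * flat 0 (x \<bullet> (- i) + b \<bullet> i))"

lemma flat_nonneg: "0 \<le> flat n t"
  by (simp add: flat_def)

lemma flat_0_eq_0_iff: "flat 0 t = 0 \<longleftrightarrow> t \<le> 0"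
  by (simp add: flat_def)

lemma bump_nonneg: "0 \<le> bump a b x"
  unfolding bump_def by (intro prod_nonneg ballI mult_nonneg_nonneg flat_nonneg)

lemma bump_pos_iff: "0 < bump a b x \<longleftrightarrow> x \<in> box a b"
proof -
  have "0 < bump a b x \<longleftrightarrow> bump a b x \<noteq> 0"
    using bump_nonneg[of a b x] by linarith
  also have "\<dots> \<longleftrightarrow> (\<forall>i\<in>Basis. \<not> x \<bullet> i + - (a \<bullet> i) \<le> 0 \<and> \<not> x \<bullet> (- i) + b \<bullet> i \<le> 0)"
    unfolding bump_def prod_zero_iff[OF finite_Basis] mult_eq_0_iff flat_0_eq_0_iff by blast
  also have "\<dots> \<longleftrightarrow> x \<in> box a b"
    unfolding mem_box by (intro ball_cong refl) (simp add: not_le)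
  finally show ?thesis .
qed

lemma smooth_bump: "smooth (bump a b)"
  unfolding smooth_def bump_def by (intro allI Ck_prod Ck_mult Ck_flat)

lemma smooth_continuous: "smooth \<phi> \<Longrightarrow> continuous_on UNIV \<phi>"
  unfolding smooth_def using Ck.simps(1) by blast

lemma smooth_has_derivative: "smooth \<phi> \<Longrightarrow> (\<phi> has_derivative frechet_derivative \<phi> (at x)) (at x)"
  unfolding smooth_def using Ck_SucD_has_derivative by blast

lemma frechet_derivative_expand:
  assumes "smooth \<phi>"
  shows "frechet_derivative \<phi> (at x) v = (\<Sum>b\<in>Basis. (v \<bullet> b) * frechet_derivative \<phi> (at x) b)"
proof -
  interpret linear "frechet_derivative \<phi> (at x)"
    using smooth_has_derivative[OF assms] by (rule has_derivative_linear)
  have "frechet_derivative \<phi> (at x) v = frechet_derivative \<phi> (at x) (\<Sum>b\<in>Basis. (v \<bullet> b) *\<^sub>R b)"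
    by (simp add: euclidean_representation)
  then show ?thesis by (simp add: sum scale)
qed

lemma smooth_partial_continuous:
  assumes "smooth \<phi>" shows "continuous_on UNIV (\<lambda>x. frechet_derivative \<phi> (at x) v)"
proof -
  have "Ck 1 \<phi>" using assms by (auto simp: smooth_def)
  then have "b \<in> Basis \<Longrightarrow> continuous_on UNIV (\<lambda>x. frechet_derivative \<phi> (at x) b)" for b by simp
  then show ?thesis
    unfolding frechet_derivative_expand[OF assms, of _ v] by (auto intro!: continuous_intros)
qed

lemma frechet_derivative_zero_outside:
  assumes "closed S" "\<And>x. x \<notin> S \<Longrightarrow> \<phi> x = 0" "x \<notin> S"
  shows "frechet_derivative \<phi> (at x) = (\<lambda>_. 0)"
proof -
  have "open (- S)" using assms(1) by blast
  moreover have "((\<lambda>_. 0) has_derivative (\<lambda>_. 0)) (at x)" by simp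
  ultimately have "(\<phi> has_derivative (\<lambda>_. 0)) (at x)"
    using assms(2,3) by (auto intro: has_derivative_transform_within_open[of "\<lambda>_. 0"])
  then show ?thesis using frechet_derivative_at by metis
qed

lemma test_functionsI:
  assumes "smooth \<phi>" "compact Q" "Q \<subseteq> C" "\<And>x. x \<notin> Q \<Longrightarrow> \<phi> x = 0"
  shows "\<phi> \<in> test_functions C"
proof -
  have "closure {x. \<phi> x \<noteq> 0} \<subseteq> Q"
    using assms by (intro closure_minimal) (auto intro: compact_imp_closed)
  moreover from this have "compact (closure {x. \<phi> x \<noteq> 0})"
    using assms(2) compact_closure bounded_subset compact_imp_bounded closure_subset by (metis compact_eq_bounded_closed closed_closure)
  ultimately show ?thesis using assms by (auto simp: test_functions_def smooth_def)
qed

lemma test_functionsE: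
  assumes "\<phi> \<in> test_functions C"
  obtains Q where "smooth \<phi>" "compact Q" "Q \<subseteq> C" "\<And>x. x \<notin> Q \<Longrightarrow> \<phi> x = 0"
  using assms closure_subset[of "{x. \<phi> x \<noteq> 0}"] unfolding test_functions_def smooth_def by blast

definition locally_integrable_on :: "'a::euclidean_space set \<Rightarrow> ('a \<Rightarrow> real) \<Rightarrow> bool" where
  "locally_integrable_on C u \<longleftrightarrow> (\<forall>Q. compact Q \<and> Q \<subseteq> C \<longrightarrow> set_integrable lebesgue Q u)"

lemma integrable_imp_locally_integrable:
  "integrable lebesgue f \<Longrightarrow> locally_integrable_on C f"
  unfolding locally_integrable_on_def set_integrable_def
  by (auto intro!: integrable_mult_indicator simp del: real_scaleR_def dest: lmeasurable_compact fmeasurableD)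

lemma bounded_measurable_locally_integrable:
  fixes g :: "'a::euclidean_space \<Rightarrow> real"
  assumes [measurable]: "g \<in> borel_measurable borel" and "\<And>x. \<bar>g x\<bar> \<le> B"
  shows "locally_integrable_on S g"
  unfolding locally_integrable_on_def set_integrable_def
proof (intro allI impI)
  fix Q :: "'a set" assume Q: "compact Q \<and> Q \<subseteq> S"
  then have Qm: "Q \<in> lmeasurable" by (intro lmeasurable_compact) auto
  then have i: "integrable lebesgue (\<lambda>x. B * indicator Q x)" by (auto simp: fmeasurable_def)
  have [measurable]: "Q \<in> sets lebesgue" using Qm by auto
  have "g \<in> borel_measurable lebesgue" using assms(1) by (simp add: measurable_completion)
  then have gm: "(\<lambda>x. indicator Q x *\<^sub>R g x) \<in> borel_measurable lebesgue" by measurable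
  have "norm (indicator Q x *\<^sub>R g x) \<le> norm (B * indicator Q x)" for x
    using assms(2)[of x] by (auto simp: indicator_def)
  then show "integrable lebesgue (\<lambda>x. indicator Q x *\<^sub>R g x)"
    by (intro Bochner_Integration.integrable_bound[OF i gm] AE_I2)
qed

text \<open>Every passage to the limit below is of this kind: uniformly bounded functions supported in one
  compact subset of \<open>C\<close>, integrated against a locally integrable function.\<close>

lemma dominated_convergence_against_locally_integrable:
  fixes \<phi> :: "'a::euclidean_space \<Rightarrow> real"
  assumes u: "locally_integrable_on C u" and Q: "compact Q" "Q \<subseteq> C"
    and meas: "\<And>n. \<psi> n \<in> borel_measurable borel"
    and lim: "\<And>x. (\<lambda>n. \<psi> n x) \<longlonglongrightarrow> \<phi> x" and bound: "\<And>n x. \<bar>\<psi> n x\<bar> \<le> B"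
    and supp: "\<And>n x. x \<notin> Q \<Longrightarrow> \<psi> n x = 0"
  shows "(\<lambda>n. LINT x|lebesgue. u x * \<psi> n x) \<longlonglongrightarrow> (LINT x|lebesgue. u x * \<phi> x)"
    and "integrable lebesgue (\<lambda>x. u x * \<phi> x)" and "\<And>n. integrable lebesgue (\<lambda>x. u x * \<psi> n x)"
proof -
  have i: "integrable lebesgue (\<lambda>x. indicator Q x * u x)"
    using u Q by (auto simp: locally_integrable_on_def set_integrable_def)
  then have [measurable]: "(\<lambda>x. indicator Q x * u x) \<in> borel_measurable lebesgue" by auto
  have phi0: "\<phi> x = 0" if "x \<notin> Q" for x
    using lim[of x] supp[OF that] by (simp add: LIMSEQ_const_iff)
  have [measurable]: "\<psi> n \<in> borel_measurable lebesgue" for n using meas[of n] by (simp add: measurable_completion)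
  have [measurable]: "\<phi> \<in> borel_measurable lebesgue"
    using lim by (rule borel_measurable_LIMSEQ_real) measurable
  have eqn: "u x * \<psi> n x = (indicator Q x * u x) * \<psi> n x" for n x
    using supp by (auto simp: indicator_def)
  have eq: "u x * \<phi> x = (indicator Q x * u x) * \<phi> x" for x
    using phi0 by (auto simp: indicator_def)
  have dom: "integrable lebesgue (\<lambda>x. B * \<bar>indicator Q x * u x\<bar>)" using i by auto
  have bd: "norm (indicator Q x * u x * \<psi> n x) \<le> B * \<bar>indicator Q x * u x\<bar>" for n x
    using mult_left_mono[OF bound[where n=n and x=x], of "\<bar>indicator Q x * u x\<bar>"] by (simp add: abs_mult mult.commute)
  have l: "(\<lambda>n. indicator Q x * u x * \<psi> n x) \<longlonglongrightarrow> indicator Q x * u x * \<phi> x" for x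
    by (intro tendsto_mult_left lim)
  show "(\<lambda>n. LINT x|lebesgue. u x * \<psi> n x) \<longlonglongrightarrow> (LINT x|lebesgue. u x * \<phi> x)"
    unfolding eqn eq by (rule integral_dominated_convergence[OF _ _ dom]) (use bd l in auto)
  show "integrable lebesgue (\<lambda>x. u x * \<phi> x)"
  proof -
    have "\<bar>\<phi> x\<bar> \<le> B" for x
      using LIMSEQ_le_const2[OF tendsto_rabs[OF lim[of x]]] bound by blast
    then have "norm (indicator Q x * u x * \<phi> x) \<le> B * \<bar>indicator Q x * u x\<bar>" for x
      using mult_left_mono[of "\<bar>\<phi> x\<bar>" B "\<bar>indicator Q x * u x\<bar>"] by (simp add: abs_mult mult.commute)
    then show ?thesis
      unfolding eq by (intro Bochner_Integration.integrable_bound[OF dom]) (auto intro!: AE_I2 intro: order_trans[OF _ abs_ge_self])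
  qed
  show "\<And>n. integrable lebesgue (\<lambda>x. u x * \<psi> n x)"
    unfolding eqn by (rule Bochner_Integration.integrable_bound[OF dom]) (measurable, intro AE_I2 order_trans[OF bd], simp)
qed

lemma continuous_compact_support_bounded:
  fixes \<phi> :: "'a::euclidean_space \<Rightarrow> real"
  assumes "continuous_on UNIV \<phi>" "compact Q" "\<And>x. x \<notin> Q \<Longrightarrow> \<phi> x = 0"
  obtains B where "B \<ge> 0" "\<And>x. \<bar>\<phi> x\<bar> \<le> B"
proof -
  have "compact (\<phi> ` Q)" using assms continuous_on_subset by (blast intro: compact_continuous_image)
  then obtain B where B: "\<And>x. x \<in> Q \<Longrightarrow> \<bar>\<phi> x\<bar> \<le> B" "B > 0"
    using compact_imp_bounded bounded_pos by (metis (no_types, lifting) image_eqI real_norm_def)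
  have "\<bar>\<phi> x\<bar> \<le> B" for x using B assms(3)[of x] by (cases "x \<in> Q") auto
  then show thesis using that[of B] B(2) by auto
qed

lemma integrable_against_test:
  assumes u: "locally_integrable_on C u" and \<phi>: "continuous_on UNIV \<phi>" "compact Q" "Q \<subseteq> C" "\<And>x. x \<notin> Q \<Longrightarrow> \<phi> x = 0"
  shows "integrable lebesgue (\<lambda>x. u x * \<phi> x)"
proof -
  obtain B where B: "B \<ge> 0" "\<And>x. \<bar>\<phi> x\<bar> \<le> B"
    using continuous_compact_support_bounded[OF \<phi>(1,2,4)] by blast
  show ?thesis
    by (rule dominated_convergence_against_locally_integrable(2)[OF u \<phi>(2,3), of "\<lambda>_. \<phi>" \<phi> B])
       (use \<phi> B in \<open>auto intro: borel_measurable_continuous_onI\<close>)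
qed

lemma integrable_against_test_function:
  assumes "locally_integrable_on C u" "\<phi> \<in> test_functions C"
  shows "integrable lebesgue (\<lambda>x. u x * \<phi> x)"
proof -
  obtain S where S: "smooth \<phi>" "compact S" "S \<subseteq> C" "\<And>x. x \<notin> S \<Longrightarrow> \<phi> x = 0"
    using test_functionsE[OF assms(2)] by blast
  show ?thesis by (rule integrable_against_test[OF assms(1) smooth_continuous[OF S(1)] S(2,3,4)])
qed

lemma open_as_union_of_inner_boxes:
  fixes U :: "'a::euclidean_space set"
  assumes "open U"
  obtains a b :: "nat \<Rightarrow> 'a" where "U = (\<Union>n. box (a n) (b n))" "\<And>n. cbox (a n) (b n) \<subseteq> U"
proof (cases "U = {}")
  case True
  have "cbox One 0 = ({} :: 'a set)" "box One 0 = ({} :: 'a set)"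
    using nonempty_Basis by (auto simp: box_eq_empty ex_in_conv)
  then show ?thesis using True by (intro that[of "\<lambda>_. One" "\<lambda>_. 0"]) auto
next
  case False
  define \<F> where "\<F> = {box a b | a b. cbox a b \<subseteq> U}"
  obtain \<F>' where F': "\<F>' \<subseteq> \<F>" "countable \<F>'" "\<Union>\<F>' = \<Union>\<F>"
    using Lindelof[of \<F>] unfolding \<F>_def by (auto simp: open_box)
  have "\<Union>\<F> = U"
  proof
    show "\<Union>\<F> \<subseteq> U" using box_subset_cbox unfolding \<F>_def by blast
    show "U \<subseteq> \<Union>\<F>"
    proof
      fix x assume "x \<in> U"
      then obtain a b where "cbox a b \<subseteq> U" "x \<in> box a b" using open_contains_cbox[OF assms] by blast
      then show "x \<in> \<Union>\<F>" unfolding \<F>_def by blast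
    qed
  qed
  then have U: "\<Union>\<F>' = U" using F' by simp
  then have ne: "\<F>' \<noteq> {}" using False by auto
  have "\<forall>n. \<exists>a b. from_nat_into \<F>' n = box a b \<and> cbox a b \<subseteq> U"
    using from_nat_into[OF ne] F'(1) unfolding \<F>_def by blast
  then obtain a b where ab: "\<And>n. from_nat_into \<F>' n = box (a n) (b n)" "\<And>n. cbox (a n) (b n) \<subseteq> U"
    by metis
  have "U = (\<Union>n. from_nat_into \<F>' n)"
    using range_from_nat_into[OF ne F'(2)] U by simp
  then show ?thesis using ab by (intro that[of a b]) auto
qed

text \<open>If \<open>\<sigma>\<close> is the sum of the bump functions of the boxes, then \<open>1 - exp (- j \<sigma>)\<close> are test functions that
  converge to the indicator function of the union as \<open>j\<close> grows.\<close>

lemma integral_nonpos_on_box_union: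
  fixes C :: "'a::euclidean_space set" and a b :: "nat \<Rightarrow> 'a"
  assumes u: "locally_integrable_on C u"
    and test: "\<And>\<phi>. \<phi> \<in> test_functions C \<Longrightarrow> (\<And>x. 0 \<le> \<phi> x) \<Longrightarrow> (LINT x|lebesgue. u x * \<phi> x) \<le> 0"
    and sub: "\<And>n. cbox (a n) (b n) \<subseteq> C"
  shows "(LINT x|lebesgue. u x * indicator (\<Union>n<k. box (a n) (b n)) x) \<le> 0"
proof -
  define \<sigma> where "\<sigma> x = (\<Sum>n<k. bump (a n) (b n) x)" for x
  define \<psi> where "\<psi> j x = 1 + (-1) * exp (- real j * \<sigma> x)" for j x
  define Q where "Q = (\<Union>n<k. cbox (a n) (b n))"
  define W where "W = (\<Union>n<k. box (a n) (b n))"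
  have Q: "compact Q" "Q \<subseteq> C" using sub by (auto simp: Q_def intro!: compact_UN)
  have \<sigma>0: "0 \<le> \<sigma> x" for x by (auto simp: \<sigma>_def intro!: sum_nonneg bump_nonneg)
  have \<sigma>pos: "0 < \<sigma> x" if "x \<in> W" for x
    using that bump_pos_iff by (auto simp: \<sigma>_def W_def intro!: sum_pos2 bump_nonneg)
  have \<sigma>zero: "\<sigma> x = 0" if "x \<notin> W" for x
    unfolding \<sigma>_def
  proof (intro sum.neutral ballI)
    fix n assume "n \<in> {..<k}"
    then have "x \<notin> box (a n) (b n)" using that by (auto simp: W_def)
    then show "bump (a n) (b n) x = 0" using bump_pos_iff[of "a n" "b n" x] bump_nonneg[of "a n" "b n" x] by simp
  qed
  have WQ: "W \<subseteq> Q" using box_subset_cbox by (fastforce simp: W_def Q_def)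
  have sm: "smooth (\<psi> j)" for j
    using smooth_bump unfolding smooth_def \<psi>_def \<sigma>_def
    by (intro allI Ck_add Ck_mult Ck_const Ck_exp Ck_sum) auto
  have supp: "\<psi> j x = 0" if "x \<notin> Q" for j x
    using that \<sigma>zero[of x] WQ by (auto simp: \<psi>_def)
  have le: "0 \<le> \<psi> j x \<and> \<psi> j x \<le> 1" for j x using \<sigma>0[of x] by (auto simp: \<psi>_def)
  have lim: "(\<lambda>j. \<psi> j x) \<longlonglongrightarrow> indicator W x" for x
  proof (cases "x \<in> W")
    case True
    have "filterlim (\<lambda>j. real j * \<sigma> x) at_top sequentially"
      using filterlim_tendsto_pos_mult_at_top[OF tendsto_const \<sigma>pos[OF True] filterlim_real_sequentially]
      by (simp add: mult.commute)
    then have "(\<lambda>j. exp (- (real j * \<sigma> x))) \<longlonglongrightarrow> 0"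
      by (intro filterlim_compose[OF exp_at_bot] filterlim_compose[OF filterlim_uminus_at_bot_at_top])
    then have "(\<lambda>j. 1 + (-1) * exp (- (real j * \<sigma> x))) \<longlonglongrightarrow> 1 + (-1) * 0" by (intro tendsto_intros)
    then show ?thesis using True by (simp add: \<psi>_def)
  next
    case False
    then show ?thesis using \<sigma>zero[OF False] by (simp add: \<psi>_def)
  qed
  have "(\<lambda>j. LINT x|lebesgue. u x * \<psi> j x) \<longlonglongrightarrow> (LINT x|lebesgue. u x * indicator W x)"
    by (rule dominated_convergence_against_locally_integrable(1)[OF u Q, where B=1])
       (use lim le supp smooth_continuous[OF sm] in \<open>auto intro: borel_measurable_continuous_onI\<close>)
  moreover have "(LINT x|lebesgue. u x * \<psi> j x) \<le> 0" for j
    using le by (intro test test_functionsI[OF sm Q supp]) auto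
  ultimately show ?thesis unfolding W_def by (intro LIMSEQ_le_const2) auto
qed

lemma integral_nonpos_on_open:
  fixes C :: "'a::euclidean_space set"
  assumes u: "locally_integrable_on C u"
    and test: "\<And>\<phi>. \<phi> \<in> test_functions C \<Longrightarrow> (\<And>x. 0 \<le> \<phi> x) \<Longrightarrow> (LINT x|lebesgue. u x * \<phi> x) \<le> 0"
    and U: "open U" "U \<subseteq> Q" "compact Q" "Q \<subseteq> C"
  shows "(LINT x|lebesgue. u x * indicator U x) \<le> 0"
proof -
  obtain a b :: "nat \<Rightarrow> 'a" where ab: "U = (\<Union>n. box (a n) (b n))" "\<And>n. cbox (a n) (b n) \<subseteq> U"
    using open_as_union_of_inner_boxes[OF U(1)] by blast
  define W where "W k = (\<Union>n<k. box (a n) (b n))" for k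
  have lim: "(\<lambda>k. indicator (W k) x :: real) \<longlonglongrightarrow> indicator U x" for x
  proof -
    have "incseq W" unfolding incseq_def W_def by (intro allI impI UN_mono) auto
    moreover have "(\<Union>k. W k) = U" unfolding ab(1) W_def by blast
    ultimately show ?thesis using LIMSEQ_indicator_incseq[of W x] by simp
  qed
  have [simp]: "W k \<in> sets borel" for k by (auto simp: W_def)
  have "(\<lambda>k. LINT x|lebesgue. u x * indicator (W k) x) \<longlonglongrightarrow> (LINT x|lebesgue. u x * indicator U x)"
  proof (rule dominated_convergence_against_locally_integrable(1)[OF u U(3,4) _ lim, where B=1])
    fix k x assume "x \<notin> Q"
    then have "x \<notin> W k" using U(2) ab(1) by (auto simp: W_def)
    then show "indicator (W k) x = (0::real)" by simp
  next
    show "\<And>k. indicator (W k) \<in> borel_measurable borel" by (rule borel_measurable_indicator) simp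
  qed (auto split: split_indicator)
  moreover have "(LINT x|lebesgue. u x * indicator (W k) x) \<le> 0" for k
    unfolding W_def using ab(2) U by (intro integral_nonpos_on_box_union[OF u test]) auto
  ultimately show ?thesis by (intro LIMSEQ_le_const2) auto
qed

text \<open>The one-sided fundamental lemma of the calculus of variations. The integrals of \<open>u\<close> are nonpositive
  over finite unions of boxes, hence over open sets, hence over intersections of sequences of open
  sets, hence over all measurable sets, which differ from the latter by null sets; the set where
  \<open>u > 0\<close> is one of them.\<close>

lemma AE_nonpos_if_test_integrals_nonpos:
  fixes C :: "'a::euclidean_space set"
  assumes C: "open C" and u: "locally_integrable_on C u"
    and test: "\<And>\<phi>. \<phi> \<in> test_functions C \<Longrightarrow> (\<And>x. 0 \<le> \<phi> x) \<Longrightarrow> (LINT x|lebesgue. u x * \<phi> x) \<le> 0"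
  shows "AE x in lebesgue. x \<in> C \<longrightarrow> u x \<le> 0"
proof -
  obtain a b :: "nat \<Rightarrow> 'a" where ab: "C = (\<Union>n. box (a n) (b n))" "\<And>n. cbox (a n) (b n) \<subseteq> C"
    using open_as_union_of_inner_boxes[OF C] by blast
  have "AE x in lebesgue. x \<in> box (a n) (b n) \<longrightarrow> u x \<le> 0" for n
  proof -
    define V Q where "V = box (a n) (b n)" and "Q = cbox (a n) (b n)"
    have Q: "compact Q" "Q \<subseteq> C" "V \<subseteq> Q" "open V"
      unfolding V_def Q_def using ab(2) by (simp_all add: box_subset_cbox open_box)
    have i: "integrable lebesgue (\<lambda>x. indicator Q x * u x)"
      using u Q by (auto simp: locally_integrable_on_def set_integrable_def)
    then have m: "(\<lambda>x. indicator Q x * u x) \<in> borel_measurable lebesgue" by auto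
    \<comment> \<open>Multiplying by the indicator of \<open>Q\<close> makes the condition measurable; on \<open>V\<close> it means \<open>u x > 0\<close>.\<close>
    define S where "S = {x. indicator Q x * u x > 0} \<inter> V"
    have S: "S \<in> sets lebesgue" 
    proof -
      have "{x \<in> space lebesgue. indicator Q x * u x > 0} \<in> sets lebesgue" using m by measurable
      then show ?thesis using Q(4) unfolding S_def by auto
    qed
    obtain T G where G: "gdelta G" "T \<in> null_sets lebesgue" "S \<union> T = G"
      using lebesgue_set_almost_gdelta[OF S] by metis
    from G(1) obtain F :: "nat \<Rightarrow> 'a set" where F: "\<And>n. open (F n)" "G = (\<Inter>n. F n)"
      by cases blast
    define U where "U k = V \<inter> (\<Inter>n\<le>k. F n)" for k
    have lim: "(\<lambda>k. indicator (U k) x :: real) \<longlonglongrightarrow> indicator (V \<inter> G) x" for x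
    proof -
      have "decseq U" unfolding decseq_def U_def by (intro allI impI Int_mono INT_anti_mono) auto
      moreover have "(\<Inter>k. U k) = V \<inter> G" unfolding F(2) U_def by auto
      ultimately show ?thesis using LIMSEQ_indicator_decseq[of U x] by simp
    qed
    have Uo: "open (U k)" for k using F(1) Q(4) unfolding U_def by (intro open_Int open_INT) auto
    have "(\<lambda>k. LINT x|lebesgue. u x * indicator (U k) x) \<longlonglongrightarrow> (LINT x|lebesgue. u x * indicator (V \<inter> G) x)"
    proof (rule dominated_convergence_against_locally_integrable(1)[OF u Q(1,2) _ lim, where B=1])
      fix k x assume "x \<notin> Q"
      then have "x \<notin> U k" using Q(3) by (auto simp: U_def)
      then show "indicator (U k) x = (0::real)" by simp
    next
      show "\<And>k. indicator (U k) \<in> borel_measurable borel" using Uo by (intro borel_measurable_indicator) simp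
    qed (auto split: split_indicator)
    moreover have "(LINT x|lebesgue. u x * indicator (U k) x) \<le> 0" for k
      using Uo Q by (intro integral_nonpos_on_open[OF u test _ _ Q(1,2)]) (auto simp: U_def)
    ultimately have le: "(LINT x|lebesgue. u x * indicator (V \<inter> G) x) \<le> 0" by (intro LIMSEQ_le_const2) auto
    have AET: "AE x in lebesgue. x \<notin> T" using G(2) by (rule AE_not_in)
    have i2: "integrable lebesgue (\<lambda>x. indicator S x * (indicator Q x * u x))"
      using integrable_mult_indicator[OF S i] by simp
    have "(LINT x|lebesgue. u x * indicator (V \<inter> G) x) = (LINT x|lebesgue. indicator S x * (indicator Q x * u x))"
    proof (rule integral_cong_AE)
      have "(\<lambda>x. indicator (V \<inter> G) x * (indicator Q x * u x)) \<in> borel_measurable lebesgue"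
        using F Q(4) by (intro borel_measurable_times[OF borel_measurable_indicator m]) auto
      moreover have "(\<lambda>x. indicator (V \<inter> G) x * (indicator Q x * u x)) = (\<lambda>x. u x * indicator (V \<inter> G) x)"
        using Q(3) by (auto simp: fun_eq_iff indicator_def)
      ultimately show "(\<lambda>x. u x * indicator (V \<inter> G) x) \<in> borel_measurable lebesgue" by simp
      show "AE x in lebesgue. u x * indicator (V \<inter> G) x = indicator S x * (indicator Q x * u x)"
        using AET by eventually_elim (use G(3) Q(3) in \<open>auto simp: indicator_def S_def\<close>)
    qed (use i2 in auto)
    moreover have "0 \<le> (LINT x|lebesgue. indicator S x * (indicator Q x * u x))"
      by (intro integral_nonneg_AE) (auto simp: S_def indicator_def)
    ultimately have "(LINT x|lebesgue. indicator S x * (indicator Q x * u x)) = 0"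
      using le by simp
    then have "AE x in lebesgue. indicator S x * (indicator Q x * u x) = 0"
      by (subst (asm) integral_nonneg_eq_0_iff_AE[OF i2]) (auto simp: S_def indicator_def)
    then have "AE x in lebesgue. x \<in> V \<longrightarrow> u x \<le> 0"
      by eventually_elim (use Q(3) in \<open>auto simp: S_def indicator_def split: if_splits\<close>)
    then show ?thesis by (simp add: V_def)
  qed
  then have "AE x in lebesgue. \<forall>n. x \<in> box (a n) (b n) \<longrightarrow> u x \<le> 0"
    unfolding AE_all_countable by blast
  then show ?thesis by eventually_elim (auto simp: ab(1))
qed

text \<open>Derivatives of test functions become limits of differences of translates, and translations can be
  moved from one factor of an integral to the other.\<close>

lemma difference_quotient_tendsto:
  fixes C :: "'a::euclidean_space set"
  assumes C: "open C" and u: "locally_integrable_on C u" and \<phi>: "\<phi> \<in> test_functions C"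
  shows "((\<lambda>t. LINT x|lebesgue. u x * ((\<phi> (x + t *\<^sub>R v) - \<phi> x) / t))
            \<longlongrightarrow> (LINT x|lebesgue. u x * frechet_derivative \<phi> (at x) v)) (at 0)"
proof -
  obtain S where S: "smooth \<phi>" "compact S" "S \<subseteq> C" "\<And>x. x \<notin> S \<Longrightarrow> \<phi> x = 0"
    using test_functionsE[OF \<phi>] by blast
  obtain r where r: "r > 0" "(\<Union>x\<in>S. cball x r) \<subseteq> C"
    using compact_subset_open_imp_cball_epsilon_subset[OF S(2) C S(3)] by blast
  define Q where "Q = (\<Union>x\<in>S. cball x r)"
  have "Q = (\<Union>x\<in>S. \<Union>y\<in>cball 0 r. {x + y})"
    by (force simp: Q_def dist_norm norm_minus_commute intro!: bexI[of _ "_ - _"])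
  then have Q: "compact Q" "Q \<subseteq> C"
    using compact_sums'[OF S(2) compact_cball[of 0 r]] r(2) by (auto simp: Q_def)
  have SQ: "S \<subseteq> Q" using r(1) by (force simp: Q_def)
  define e where "e = r / (norm v + 1)"
  have e: "e > 0" using r(1) by (simp add: e_def add_nonneg_pos)
  have ev: "\<bar>t\<bar> * norm v \<le> r" if "\<bar>t\<bar> < e" for t
  proof -
    have "\<bar>t\<bar> * norm v \<le> e * (norm v + 1)" using that by (intro mult_mono) auto
    also have "\<dots> = r" by (simp add: e_def add_nonneg_eq_0_iff)
    finally show ?thesis .
  qed
  have d: "((\<lambda>s. \<phi> (x + s *\<^sub>R v)) has_real_derivative frechet_derivative \<phi> (at (x + s *\<^sub>R v)) v) (at s)" for x s
  proof -
    have "((\<lambda>s. x + s *\<^sub>R v) has_derivative (\<lambda>h. h *\<^sub>R v)) (at s)" by (auto intro!: derivative_eq_intros)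
    from has_derivative_compose[OF this smooth_has_derivative[OF S(1)]]
    have "((\<lambda>s. \<phi> (x + s *\<^sub>R v)) has_derivative (\<lambda>h. frechet_derivative \<phi> (at (x + s *\<^sub>R v)) (h *\<^sub>R v))) (at s)" .
    moreover have "frechet_derivative \<phi> (at (x + s *\<^sub>R v)) (h *\<^sub>R v) = h * frechet_derivative \<phi> (at (x + s *\<^sub>R v)) v" for h
      using linear_scale[OF has_derivative_linear[OF smooth_has_derivative[OF S(1)]]] by simp
    ultimately show ?thesis by (simp add: has_field_derivative_def mult.commute[of _ "frechet_derivative _ _ _"])
  qed
  have zero: "frechet_derivative \<phi> (at x) v = 0" if "x \<notin> S" for x
    using frechet_derivative_zero_outside[OF compact_imp_closed[OF S(2)] S(4) that] by simp
  obtain B where B: "B \<ge> 0" "\<And>x. \<bar>frechet_derivative \<phi> (at x) v\<bar> \<le> B"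
    using continuous_compact_support_bounded[OF smooth_partial_continuous[OF S(1)] S(2) zero] by blast
  have quot: "\<bar>(\<phi> (x + t *\<^sub>R v) - \<phi> x) / t\<bar> \<le> B" for x t
  proof -
    have "norm (\<phi> (x + t *\<^sub>R v) - \<phi> (x + 0 *\<^sub>R v)) \<le> B * norm (t - 0)"
      by (rule field_differentiable_bound[where S=UNIV and f="\<lambda>s. \<phi> (x + s *\<^sub>R v)"]) (use d B in auto)
    then show ?thesis using B(1) by (cases "t = 0") (auto simp: field_simps)
  qed
  have supp: "(\<phi> (x + t *\<^sub>R v) - \<phi> x) / t = 0" if "x \<notin> Q" "\<bar>t\<bar> < e" for x t
  proof -
    have "x + t *\<^sub>R v \<notin> S"
    proof
      assume "x + t *\<^sub>R v \<in> S"
      moreover have "dist (x + t *\<^sub>R v) x \<le> r" using ev[OF that(2)] by (simp add: dist_norm)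
      ultimately show False using that(1) by (auto simp: Q_def)
    qed
    then show ?thesis using S(4) that SQ by auto
  qed
  \<comment> \<open>Restricting to steps below \<open>e\<close> keeps all translated supports inside the compact set \<open>Q\<close>.\<close>
  have at: "at (0::real) = at 0 within {-e<..<e}" using e by (intro at_within_open[symmetric]) auto
  show ?thesis
    unfolding at tendsto_at_iff_sequentially comp_def
  proof (intro allI impI)
    fix t :: "nat \<Rightarrow> real"
    assume t: "\<forall>i. t i \<in> {-e<..<e} - {0}" "t \<longlonglongrightarrow> 0"
    have te: "\<bar>t i\<bar> < e" for i using t(1)[rule_format, of i] by (auto simp: abs_less_iff)
    have "filterlim t (at 0) sequentially" using t by (auto simp: filterlim_at)
    moreover have "((\<lambda>t. (\<phi> (x + t *\<^sub>R v) - \<phi> x) / t) \<longlongrightarrow> frechet_derivative \<phi> (at x) v) (at 0)" for x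
      using d[of x 0] by (simp add: DERIV_def)
    ultimately have lim: "(\<lambda>i. (\<phi> (x + t i *\<^sub>R v) - \<phi> x) / t i) \<longlonglongrightarrow> frechet_derivative \<phi> (at x) v" for x
      using filterlim_compose by blast
    show "(\<lambda>i. LINT x|lebesgue. u x * ((\<phi> (x + t i *\<^sub>R v) - \<phi> x) / t i))
        \<longlonglongrightarrow> (LINT x|lebesgue. u x * frechet_derivative \<phi> (at x) v)"
    proof (rule dominated_convergence_against_locally_integrable(1)[OF u Q, where B=B])
      show "(\<lambda>x. (\<phi> (x + t i *\<^sub>R v) - \<phi> x) / t i) \<in> borel_measurable borel" for i
        using t(1) by (intro borel_measurable_continuous_onI continuous_intros
            continuous_on_compose2[OF smooth_continuous[OF S(1)]] smooth_continuous[OF S(1)]) auto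
    qed (use lim quot supp te in auto)
  qed
qed

section \<open>Charges, their densities and weak gradients\<close>

lemma AE_lebesgue_on_iff:
  fixes C :: "'a::euclidean_space set"
  assumes "open C"
  shows "(AE x in lebesgue_on C. P x) \<longleftrightarrow> (AE x in lebesgue. x \<in> C \<longrightarrow> P x)"
  using assms by (intro AE_restrict_space_iff) auto

text \<open>The essential supremum of a nonmeasurable function is infinite by convention, so a finite bound
  includes measurability.\<close>

lemma Linfty_norm_le_iff:
  fixes C :: "'a::euclidean_space set"
  shows "Linfty_norm C f \<le> ereal c \<longleftrightarrow>
    (\<lambda>x. \<bar>f x\<bar>) \<in> borel_measurable (lebesgue_on C) \<and> (AE x in lebesgue_on C. \<bar>f x\<bar> \<le> c)"
proof
  assume le: "Linfty_norm C f \<le> ereal c"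
  then have m: "(\<lambda>x. ereal \<bar>f x\<bar>) \<in> borel_measurable (lebesgue_on C)"
    unfolding Linfty_norm_def by (metis esssup_non_measurable ereal_top infinity_ereal_def PInfty_neq_ereal(1) top_ereal_def ereal_infty_less_eq(1))
  have "AE x in lebesgue_on C. ereal \<bar>f x\<bar> \<le> ereal c"
    using esssup_AE[of "\<lambda>x. ereal \<bar>f x\<bar>" "lebesgue_on C"]
  proof eventually_elim
    case (elim x)
    then show ?case using le unfolding Linfty_norm_def by (rule order_trans)
  qed
  then show "(\<lambda>x. \<bar>f x\<bar>) \<in> borel_measurable (lebesgue_on C) \<and> (AE x in lebesgue_on C. \<bar>f x\<bar> \<le> c)"
    using m by (simp add: borel_measurable_ereal_iff)
qed (auto simp: Linfty_norm_def intro!: esssup_I)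

text \<open>Over a null set the essential supremum would be \<open>-\<infinity>\<close>; a nonempty open set is not null.\<close>

lemma Linfty_norm_le_imp_nonneg:
  fixes C :: "'a::euclidean_space set"
  assumes "open C" "C \<noteq> {}" "Linfty_norm C f \<le> ereal c" shows "0 \<le> c"
proof -
  have ae: "AE x in lebesgue. x \<in> C \<longrightarrow> \<bar>f x\<bar> \<le> c"
    using assms(1,3) by (simp add: Linfty_norm_le_iff AE_lebesgue_on_iff)
  show ?thesis
  proof (rule ccontr)
    assume "\<not> 0 \<le> c"
    then have "AE x in lebesgue. x \<notin> C" using ae by (auto elim!: eventually_mono)
    then have "C \<in> null_sets lebesgue" using assms(1) by (subst (asm) AE_iff_null_sets[symmetric]) auto
    then show False using open_not_negligible[OF assms(1,2)] by (simp add: negligible_iff_null_sets)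
  qed
qed

text \<open>A Borel function on the whole space that vanishes outside \<open>C\<close>: unlike a Lebesgue measurable function on
  \<open>C\<close>, it can be translated and composed with addition without losing joint measurability.\<close>

definition is_charge_density :: "'a::euclidean_space set \<Rightarrow> ('a set \<Rightarrow> real) \<Rightarrow> ('a \<Rightarrow> real) \<Rightarrow> bool" where
  "is_charge_density C \<nu> f \<longleftrightarrow> f \<in> borel_measurable borel \<and> integrable lborel f \<and>
     (\<forall>x. x \<notin> C \<longrightarrow> f x = 0) \<and>
     (\<forall>A\<in>sets (lebesgue_on C). \<nu> A = (LINT x|lebesgue. indicator A x * f x))"

lemma sigma_finite_lebesgue: "sigma_finite_measure (lebesgue :: 'a::euclidean_space measure)"
proof
  obtain A :: "'a set set" where A: "countable A" "A \<subseteq> sets lborel" "\<Union>A = space lborel"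
    "\<forall>a\<in>A. emeasure lborel a \<noteq> \<infinity>"
    using lborel.sigma_finite_countable by blast
  moreover have "emeasure lebesgue a = emeasure lborel a" if "a \<in> A" for a
    using A(2) that by (simp add: subset_iff)
  moreover have "A \<subseteq> sets lebesgue" using A(2) by auto
  ultimately show "\<exists>A. countable A \<and> A \<subseteq> sets lebesgue \<and> \<Union>A = space (lebesgue :: 'a measure)
      \<and> (\<forall>a\<in>A. emeasure lebesgue a \<noteq> \<infinity>)"
    by (intro exI[of _ A]) auto
qed

lemma charge_has_density:
  fixes C :: "'a::euclidean_space set"
  assumes C: "open C" and \<nu>: "\<nu> \<in> charges C"
  obtains f where "is_charge_density C \<nu> f"
proof -
  have Cm: "C \<inter> space lebesgue \<in> sets lebesgue" using C by auto
  have "signed_measure (lebesgue_on C) \<nu>"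
    using \<nu> by unfold_locales (auto simp: charges_def)
  moreover have "sigma_finite_measure (lebesgue_on C)"
    using Cm by (intro sigma_finite_measure_restrict_space sigma_finite_lebesgue) auto
  moreover have "\<And>A. A \<in> null_sets (lebesgue_on C) \<Longrightarrow> \<nu> A = 0" using \<nu> by (simp add: charges_def)
  ultimately obtain g where g: "integrable (lebesgue_on C) g"
    "\<And>A. A \<in> sets (lebesgue_on C) \<Longrightarrow> \<nu> A = (LINT x:A|lebesgue_on C. g x)"
    using signed_Radon_Nikodym by blast
  define g1 where "g1 x = indicator C x * g x" for x
  have g1: "integrable lebesgue g1"
    using g(1) unfolding integrable_restrict_space[OF Cm] by (simp add: g1_def[abs_def])
  then obtain g2 where g2: "g2 \<in> borel_measurable lborel" "AE x in lborel. g1 x = g2 x"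
    using completion_ex_borel_measurable_real by blast
  define f where "f x = indicator C x * g2 x" for x
  have fm: "f \<in> borel_measurable borel" unfolding f_def[abs_def] using g2(1) C by simp
  have ae: "AE x in lebesgue. g1 x = f x"
    using AE_completion[OF g2(2)] by eventually_elim (auto simp: f_def g1_def indicator_def)
  have fml: "f \<in> borel_measurable lebesgue" using fm by (simp add: measurable_completion)
  have "integrable lebesgue f" using integrable_cong_AE_imp[OF g1 fml] ae by (simp add: eq_commute)
  then have fi: "integrable lborel f" using fm by (simp add: integrable_completion)
  have "\<nu> A = (LINT x|lebesgue. indicator A x * f x)" if A: "A \<in> sets (lebesgue_on C)" for A
  proof -
    have A': "A \<in> sets lebesgue" "A \<subseteq> C" using A Cm by (auto simp: sets_restrict_space_iff)
    have "\<nu> A = (LINT x|lebesgue. indicator C x *\<^sub>R (indicator A x *\<^sub>R g x))"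
      unfolding g(2)[OF A] set_lebesgue_integral_def by (rule integral_restrict_space[OF Cm])
    also have "\<dots> = (LINT x|lebesgue. indicator A x * g1 x)"
      by (intro Bochner_Integration.integral_cong) (auto simp: g1_def)
    also have "\<dots> = (LINT x|lebesgue. indicator A x * f x)"
      using A' g1 fml ae by (intro integral_cong_AE) (auto elim!: eventually_mono)
    finally show ?thesis .
  qed
  then have "is_charge_density C \<nu> f" using fm fi by (auto simp: is_charge_density_def f_def)
  then show thesis by (rule that)
qed

lemma charge_density_integral:
  fixes C :: "'a::euclidean_space set"
  assumes C: "open C" and f: "is_charge_density C \<nu> f" and A: "A \<in> sets (lebesgue_on C)"
  shows "\<nu> A = (LINT x:A|lebesgue_on C. f x)"
proof -
  have Cm: "C \<inter> space lebesgue \<in> sets lebesgue" using C by auto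
  have A': "A \<in> sets lebesgue" "A \<subseteq> C" using A Cm by (auto simp: sets_restrict_space_iff)
  have "(LINT x:A|lebesgue_on C. f x) = (LINT x|lebesgue. indicator C x *\<^sub>R (indicator A x *\<^sub>R f x))"
    unfolding set_lebesgue_integral_def by (rule integral_restrict_space[OF Cm])
  also have "\<dots> = (LINT x|lebesgue. indicator A x * f x)"
    using A' by (intro Bochner_Integration.integral_cong) (auto simp: indicator_def)
  finally show ?thesis using f A by (simp add: is_charge_density_def)
qed

lemma density_integrable_on:
  fixes C :: "'a::euclidean_space set"
  assumes C: "open C" and f: "is_charge_density C \<nu> f"
  shows "integrable lebesgue f" "integrable (lebesgue_on C) f"
proof -
  have Cm: "C \<inter> space lebesgue \<in> sets lebesgue" using C by auto
  show i: "integrable lebesgue f" using f by (simp add: is_charge_density_def integrable_completion)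
  show "integrable (lebesgue_on C) f"
    unfolding integrable_restrict_space[OF Cm] using Cm by (intro integrable_mult_indicator i) auto
qed

lemma charge_deriv_eq_density:
  fixes C :: "'a::euclidean_space set"
  assumes C: "open C" and f: "is_charge_density C \<nu> f"
  shows "integrable (lebesgue_on C) (charge_deriv C \<nu>)"
    and "AE x in lebesgue_on C. charge_deriv C \<nu> x = f x"
proof -
  let ?P = "\<lambda>f. integrable (lebesgue_on C) f \<and> (\<forall>A\<in>sets (lebesgue_on C). \<nu> A = (LINT x:A|lebesgue_on C. f x))"
  have Pf: "?P f" using density_integrable_on[OF C f] charge_density_integral[OF C f] by simp
  have P: "?P (charge_deriv C \<nu>)" unfolding charge_deriv_def by (rule someI[of ?P, OF Pf])
  then show "integrable (lebesgue_on C) (charge_deriv C \<nu>)" by simp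
  show "AE x in lebesgue_on C. charge_deriv C \<nu> x = f x"
    using P Pf by (intro density_unique_real) auto
qed

definition charge_of_density :: "'a::euclidean_space set \<Rightarrow> ('a \<Rightarrow> real) \<Rightarrow> 'a set \<Rightarrow> real" where
  "charge_of_density C f A = (if A \<in> sets (lebesgue_on C) then LINT x|lebesgue. indicator A x * f x else 0)"

lemma charge_of_density:
  fixes C :: "'a::euclidean_space set"
  assumes C: "open C" and f: "f \<in> borel_measurable borel" "integrable lborel f" "\<And>x. x \<notin> C \<Longrightarrow> f x = 0"
  shows "charge_of_density C f \<in> charges C" "is_charge_density C (charge_of_density C f) f"
proof -
  have Cm: "C \<inter> space lebesgue \<in> sets lebesgue" using C by auto
  have fl: "integrable lebesgue f" using f by (simp add: integrable_completion)
  have sub: "A \<in> sets lebesgue" if "A \<in> sets (lebesgue_on C)" for A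
    using that Cm by (auto simp: sets_restrict_space_iff)
  show "is_charge_density C (charge_of_density C f) f"
    using f by (auto simp: is_charge_density_def charge_of_density_def)
  have "(\<lambda>n. charge_of_density C f (F n)) sums charge_of_density C f (\<Union>n. F n)"
    if F: "range F \<subseteq> sets (lebesgue_on C)" "disjoint_family F" for F :: "nat \<Rightarrow> 'a set"
  proof -
    have U: "(\<Union>n. F n) \<in> sets (lebesgue_on C)" using F(1) by auto
    have Fm [measurable]: "F n \<in> sets lebesgue" for n using F(1) sub by auto
    have Um [measurable]: "(\<Union>n. F n) \<in> sets lebesgue" using sub[OF U] .
    have s: "(\<lambda>n. indicator (F n) x :: real) sums indicator (\<Union>n. F n) x" for x
      using F(2) by (intro indicator_sums) (auto simp: disjoint_family_on_def)
    have le: "0 \<le> (\<Sum>n<k. indicator (F n) x :: real) \<and> (\<Sum>n<k. indicator (F n) x :: real) \<le> 1" for k x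
    proof -
      have "(\<Sum>n<k. indicator (F n) x :: real) \<le> (\<Sum>n. indicator (F n) x)"
        using s[of x] by (intro sum_le_suminf) (auto simp: sums_iff)
      also have "\<dots> = indicator (\<Union>n. F n) x" using s[of x] by (simp add: sums_iff)
      also have "\<dots> \<le> 1" by (simp add: indicator_def)
      finally show ?thesis by (simp add: sum_nonneg)
    qed
    have "(\<lambda>k. LINT x|lebesgue. (\<Sum>n<k. indicator (F n) x) * f x)
        \<longlonglongrightarrow> (LINT x|lebesgue. indicator (\<Union>n. F n) x * f x)"
    proof (rule integral_dominated_convergence[where w="\<lambda>x. \<bar>f x\<bar>"])
      show "AE x in lebesgue. (\<lambda>k. (\<Sum>n<k. indicator (F n) x) * f x) \<longlonglongrightarrow> indicator (\<Union>n. F n) x * f x"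
        using s unfolding sums_def by (intro AE_I2 tendsto_mult_right) auto
      show "AE x in lebesgue. norm ((\<Sum>n<k. indicator (F n) x) * f x) \<le> \<bar>f x\<bar>" for k
        using le[where k=k] by (intro AE_I2) (auto simp: abs_mult intro!: mult_left_le_one_le)
    qed (use fl in \<open>auto intro: integrable_abs\<close>)
    moreover have "(LINT x|lebesgue. (\<Sum>n<k. indicator (F n) x) * f x) = (\<Sum>n<k. LINT x|lebesgue. indicator (F n) x * f x)" for k
      unfolding sum_distrib_right
      using integrable_mult_indicator[OF Fm fl] by (intro Bochner_Integration.integral_sum) simp
    ultimately have "(\<lambda>k. \<Sum>n<k. LINT x|lebesgue. indicator (F n) x * f x)
        \<longlonglongrightarrow> (LINT x|lebesgue. indicator (\<Union>n. F n) x * f x)" by simp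
    moreover have "charge_of_density C f (F n) = (LINT x|lebesgue. indicator (F n) x * f x)" for n
      using F(1) by (auto simp: charge_of_density_def)
    ultimately show ?thesis using U by (simp add: sums_def charge_of_density_def)
  qed
  moreover have "charge_of_density C f A = 0" if A: "A \<in> null_sets (lebesgue_on C)" for A
  proof -
    have "A \<in> null_sets lebesgue" using A Cm by (auto simp: null_sets_restrict_space)
    then have "AE x in lebesgue. x \<notin> A" by (rule AE_not_in)
    then have "(LINT x|lebesgue. indicator A x * f x) = 0"
      by (intro integral_eq_zero_AE) (auto elim!: eventually_mono)
    then show ?thesis by (simp add: charge_of_density_def)
  qed
  ultimately show "charge_of_density C f \<in> charges C"
    by (auto simp: charges_def charge_of_density_def)
qed

lemma lborel_integral_translate:
  fixes f :: "'a::euclidean_space \<Rightarrow> real"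
  assumes [measurable]: "f \<in> borel_measurable borel"
  shows "(LINT x|lborel. f (a + x)) = (LINT x|lborel. f x)"
proof -
  have "(LINT x|lborel. f x) = (LINT x|distr lborel borel ((+) a). f x)" by (simp add: lborel_distr_plus)
  also have "\<dots> = (LINT x|lborel. f (a + x))" by (rule integral_distr) measurable
  finally show ?thesis ..
qed

lemma lborel_integrable_translate:
  fixes f :: "'a::euclidean_space \<Rightarrow> real"
  assumes [measurable]: "f \<in> borel_measurable borel" and "integrable lborel f"
  shows "integrable lborel (\<lambda>x. f (a + x))"
proof -
  have "integrable (distr lborel borel ((+) a)) f" using assms(2) by (simp add: lborel_distr_plus)
  then show ?thesis by (subst (asm) integrable_distr_eq) measurable
qed

lemma integral_lebesgue_on_test:
  fixes C :: "'a::euclidean_space set" and u :: "'a \<Rightarrow> real"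
  assumes "open C" "\<And>x. x \<notin> C \<Longrightarrow> \<phi> x = 0"
  shows "(LINT x|lebesgue_on C. u x * \<phi> x) = (LINT x|lebesgue. u x * \<phi> x)"
proof -
  have "C \<inter> space lebesgue \<in> sets lebesgue" using assms by auto
  from integral_restrict_space[OF this, of "\<lambda>x. u x * \<phi> x"]
  have "(LINT x|lebesgue_on C. u x * \<phi> x) = (LINT x|lebesgue. indicator C x *\<^sub>R (u x * \<phi> x))" .
  also have "\<dots> = (LINT x|lebesgue. u x * \<phi> x)"
    using assms(2) by (intro Bochner_Integration.integral_cong) (auto simp: indicator_def)
  finally show ?thesis .
qed

lemma test_function_vanishes_outside:
  assumes "\<phi> \<in> test_functions C" "x \<notin> C"
  shows "\<phi> x = 0" "frechet_derivative \<phi> (at x) = (\<lambda>_. 0)"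
proof -
  obtain S where S: "smooth \<phi>" "compact S" "S \<subseteq> C" "\<And>x. x \<notin> S \<Longrightarrow> \<phi> x = 0"
    using test_functionsE[OF assms(1)] by blast
  show "\<phi> x = 0" using S assms(2) by blast
  show "frechet_derivative \<phi> (at x) = (\<lambda>_. 0)"
    using S(3) assms(2) by (intro frechet_derivative_zero_outside[OF compact_imp_closed[OF S(2)] S(4)]) auto
qed

text \<open>All directions are tested at once. The integrals run over the whole space, because test functions
  and their derivatives vanish outside \<open>C\<close>.\<close>

definition weak_gradient_of :: "'a::euclidean_space set \<Rightarrow> ('a \<Rightarrow> real) \<Rightarrow> ('a \<Rightarrow> 'a) \<Rightarrow> bool" where
  "weak_gradient_of C f w \<longleftrightarrow>
     (\<forall>v. locally_integrable_on C (\<lambda>x. v \<bullet> w x)) \<and>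
     (\<forall>\<phi>\<in>test_functions C. \<forall>v.
        (LINT x|lebesgue. f x * frechet_derivative \<phi> (at x) v) = - (LINT x|lebesgue. (v \<bullet> w x) * \<phi> x))"

lemma weak_gradient_of_uminus:
  "weak_gradient_of C f w \<Longrightarrow> weak_gradient_of C (\<lambda>x. - f x) (\<lambda>x. - w x)"
  by (auto simp: weak_gradient_of_def locally_integrable_on_def set_integrable_def)

text \<open>Whatever weak partial derivatives are chosen in \<^const>\<open>weak_gradient\<close>, they form a weak gradient, and
  the density \<open>f\<close> may replace \<open>D\<close> because the two agree almost everywhere.\<close>

lemma weak_gradient_of_W1infty:
  fixes C :: "'a::euclidean_space set"
  assumes C: "open C" and D: "D \<in> W1infty C" "D \<in> borel_measurable (lebesgue_on C)"
    and ae: "AE x in lebesgue_on C. D x = f x" and f: "integrable lebesgue f"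
  shows "weak_gradient_of C f (weak_gradient C D)"
proof -
  have Cm: "C \<inter> space lebesgue \<in> sets lebesgue" using C by auto
  define g where "g b = (SOME g. has_weak_partial C b D g)" for b
  have wp: "has_weak_partial C b D (g b)" if "b \<in> Basis" for b
    unfolding g_def using D that by (intro someI_ex[of "has_weak_partial C b D"]) (auto simp: W1infty_def)
  have w: "v \<bullet> weak_gradient C D x = (\<Sum>b\<in>Basis. (v \<bullet> b) * g b x)" for v x
    by (simp add: weak_gradient_def g_def inner_sum_right inner_commute mult.commute)
  have gl: "locally_integrable_on C (g b)" if "b \<in> Basis" for b
    using wp[OF that] by (simp add: has_weak_partial_def locally_integrable_on_def)
  have fl: "locally_integrable_on C f" using f by (rule integrable_imp_locally_integrable)
  show ?thesis unfolding weak_gradient_of_def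
  proof (intro conjI ballI allI)
    fix v
    show "locally_integrable_on C (\<lambda>x. v \<bullet> weak_gradient C D x)"
      unfolding w locally_integrable_on_def set_integrable_def
    proof (intro allI impI)
      fix Q assume Q: "compact Q \<and> Q \<subseteq> C"
      have "integrable lebesgue (\<lambda>x. \<Sum>b\<in>Basis. (v \<bullet> b) * (indicator Q x * g b x))"
        using gl Q by (intro Bochner_Integration.integrable_sum integrable_mult_right)
          (auto simp: locally_integrable_on_def set_integrable_def)
      then show "integrable lebesgue (\<lambda>x. indicat_real Q x *\<^sub>R (\<Sum>b\<in>Basis. v \<bullet> b * g b x))"
        by (simp add: sum_distrib_left mult_ac)
    qed
  next
    fix \<phi> v assume \<phi>: "\<phi> \<in> test_functions C"
    obtain S where S: "smooth \<phi>" "compact S" "S \<subseteq> C" "\<And>x. x \<notin> S \<Longrightarrow> \<phi> x = 0"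
      using test_functionsE[OF \<phi>] by blast
    have S': "frechet_derivative \<phi> (at x) b = 0" if "x \<notin> S" for x b
      using frechet_derivative_zero_outside[OF compact_imp_closed[OF S(2)] S(4) that] by simp
    note lin = frechet_derivative_expand[OF S(1), of _ v]
    have part: "(LINT x|lebesgue. f x * frechet_derivative \<phi> (at x) b) = - (LINT x|lebesgue. g b x * \<phi> x)"
      if b: "b \<in> Basis" for b
    proof -
      have m: "(\<lambda>x. frechet_derivative \<phi> (at x) b) \<in> borel_measurable (lebesgue_on C)"
        using borel_measurable_continuous_onI[OF smooth_partial_continuous[OF S(1), of b]]
        by (intro measurable_restrict_space1 measurable_completion) auto
      have fm: "f \<in> borel_measurable (lebesgue_on C)" using f by (intro measurable_restrict_space1) auto
      have "(LINT x|lebesgue. f x * frechet_derivative \<phi> (at x) b)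
          = (LINT x|lebesgue_on C. f x * frechet_derivative \<phi> (at x) b)"
        using test_function_vanishes_outside(2)[OF \<phi>] by (intro integral_lebesgue_on_test[symmetric] C) simp
      also have "\<dots> = (LINT x|lebesgue_on C. D x * frechet_derivative \<phi> (at x) b)"
        using ae m fm D(2) by (intro integral_cong_AE) (auto elim!: eventually_mono)
      also have "\<dots> = - (LINT x|lebesgue_on C. g b x * \<phi> x)"
        using wp[OF b] \<phi> by (simp add: has_weak_partial_def)
      also have "\<dots> = - (LINT x|lebesgue. g b x * \<phi> x)"
        using test_function_vanishes_outside(1)[OF \<phi>] by (simp add: integral_lebesgue_on_test[OF C])
      finally show ?thesis .
    qed
    have i1: "integrable lebesgue (\<lambda>x. f x * frechet_derivative \<phi> (at x) b)" for b
      by (rule integrable_against_test[OF fl smooth_partial_continuous[OF S(1)] S(2,3) S'])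
    have i2: "integrable lebesgue (\<lambda>x. g b x * \<phi> x)" if "b \<in> Basis" for b
      by (rule integrable_against_test_function[OF gl[OF that] \<phi>])
    have "(LINT x|lebesgue. f x * frechet_derivative \<phi> (at x) v)
        = (LINT x|lebesgue. (\<Sum>b\<in>Basis. (v \<bullet> b) * (f x * frechet_derivative \<phi> (at x) b)))"
      by (simp add: lin sum_distrib_left mult_ac)
    also have "\<dots> = (\<Sum>b\<in>Basis. (v \<bullet> b) * (LINT x|lebesgue. f x * frechet_derivative \<phi> (at x) b))"
      using i1 by (subst Bochner_Integration.integral_sum) auto
    also have "\<dots> = - (\<Sum>b\<in>Basis. (v \<bullet> b) * (LINT x|lebesgue. g b x * \<phi> x))"
      by (simp add: part sum_negf)
    also have "(\<Sum>b\<in>Basis. (v \<bullet> b) * (LINT x|lebesgue. g b x * \<phi> x))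
        = (LINT x|lebesgue. (\<Sum>b\<in>Basis. (v \<bullet> b) * (g b x * \<phi> x)))"
      using i2 by (subst Bochner_Integration.integral_sum) auto
    also have "\<dots> = (LINT x|lebesgue. (v \<bullet> weak_gradient C D x) * \<phi> x)"
      by (simp add: w sum_distrib_right mult.assoc)
    finally show "(LINT x|lebesgue. f x * frechet_derivative \<phi> (at x) v)
        = - (LINT x|lebesgue. (v \<bullet> weak_gradient C D x) * \<phi> x)" .
  qed
qed

lemma test_function_translate:
  assumes \<phi>: "\<phi> \<in> test_functions C" and v: "\<And>x. x \<in> C \<Longrightarrow> x + v \<in> C"
  shows "(\<lambda>x. \<phi> (x - v)) \<in> test_functions C"
proof -
  obtain S where S: "smooth \<phi>" "compact S" "S \<subseteq> C" "\<And>x. x \<notin> S \<Longrightarrow> \<phi> x = 0"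
    using test_functionsE[OF \<phi>] by blast
  show ?thesis
  proof (rule test_functionsI)
    show "smooth (\<lambda>x. \<phi> (x - v))"
      using S(1) Ck_translate[of _ \<phi> "- v"] by (simp add: smooth_def)
    show "compact ((\<lambda>x. x + v) ` S)" using S(2) by (intro compact_continuous_image continuous_intros)
    show "(\<lambda>x. x + v) ` S \<subseteq> C" using S(3) v by auto
    show "\<phi> (x - v) = 0" if "x \<notin> (\<lambda>x. x + v) ` S" for x
    proof (rule S(4))
      show "x - v \<notin> S" using that by (auto simp: image_iff dest: bspec[where x="x - v"])
    qed
  qed
qed

text \<open>With \<open>F s\<close> the integral of \<open>f x * \<phi> (x - s v)\<close>, the derivative of \<open>F\<close> is the integral of \<open>v \<bullet> w\<close> against the
  translated test function, so the mean value theorem bounds \<open>F 1 - F 0\<close> by \<open>p\<close> times the integral of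
  \<open>\<phi>\<close>. The condition on \<open>v\<close> keeps the translated test functions inside \<open>C\<close>.\<close>

lemma translate_difference_le:
  fixes C :: "'a::euclidean_space set"
  assumes C: "open C" and f: "f \<in> borel_measurable borel" "integrable lborel f"
    and w: "weak_gradient_of C f w"
    and v: "\<And>x s. x \<in> C \<Longrightarrow> 0 \<le> s \<Longrightarrow> x + s *\<^sub>R v \<in> C"
    and le: "AE x in lebesgue. x \<in> C \<longrightarrow> v \<bullet> w x \<le> p"
  shows "AE x in lebesgue. x \<in> C \<longrightarrow> f (v + x) - f x \<le> p"
proof -
  have fi: "integrable lebesgue f" using f by (simp add: integrable_completion)
  have fvb [measurable]: "(\<lambda>x. f (v + x)) \<in> borel_measurable borel" using f(1) by measurable
  have fv: "integrable lebesgue (\<lambda>x. f (v + x))"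
    using lborel_integrable_translate[OF f, of v] fvb by (simp add: integrable_completion)
  have loc1: "locally_integrable_on C (\<lambda>x. p)"
    by (rule bounded_measurable_locally_integrable[where B="\<bar>p\<bar>"]) auto
  have "locally_integrable_on C (\<lambda>x. (f (v + x) - f x) - p)"
    using integrable_imp_locally_integrable[OF Bochner_Integration.integrable_diff[OF fv fi], of C] loc1
    unfolding locally_integrable_on_def by (auto intro!: set_integral_diff)
  then have "AE x in lebesgue. x \<in> C \<longrightarrow> (f (v + x) - f x) - p \<le> 0"
  proof (rule AE_nonpos_if_test_integrals_nonpos[OF C])
    fix \<phi> assume \<phi>: "\<phi> \<in> test_functions C" and \<phi>0: "\<And>x. 0 \<le> \<phi> x"
    obtain S where S: "smooth \<phi>" "compact S" "S \<subseteq> C" "\<And>x. x \<notin> S \<Longrightarrow> \<phi> x = 0"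
      using test_functionsE[OF \<phi>] by blast
    have \<phi>m [measurable]: "\<phi> \<in> borel_measurable borel"
      using smooth_continuous[OF S(1)] by (rule borel_measurable_continuous_onI)
    define I where "I = (LINT x|lebesgue. \<phi> x)"
    define \<phi>s where "\<phi>s s x = \<phi> (x - s *\<^sub>R v)" for s x
    define F where "F s = (LINT x|lebesgue. f x * \<phi>s s x)" for s
    have \<phi>s: "\<phi>s s \<in> test_functions C" if "0 \<le> s" for s
      unfolding \<phi>s_def[abs_def] using v that by (intro test_function_translate[OF \<phi>]) auto
    note int_test = integrable_against_test_function
    have fl: "locally_integrable_on C f" using fi by (rule integrable_imp_locally_integrable)
    have \<phi>sI: "(LINT x|lebesgue. \<phi>s s x) = I" for s
    proof -
      have [measurable]: "\<phi>s s \<in> borel_measurable borel" unfolding \<phi>s_def[abs_def] by measurable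
      have "(LINT x|lborel. \<phi> (- (s *\<^sub>R v) + x)) = (LINT x|lborel. \<phi> x)" by (rule lborel_integral_translate) measurable
      then show ?thesis by (simp add: I_def \<phi>s_def integral_completion)
    qed
    have Fi: "integrable lebesgue (\<lambda>x. f x * \<psi> (x - t *\<^sub>R v))" if \<psi>: "\<psi> \<in> test_functions C" for \<psi> t
    proof -
      obtain S where S: "smooth \<psi>" "compact S" "S \<subseteq> C" "\<And>x. x \<notin> S \<Longrightarrow> \<psi> x = 0"
        using test_functionsE[OF \<psi>] by blast
      show ?thesis
      proof (rule integrable_against_test[where C=UNIV and Q="(\<lambda>x. x + t *\<^sub>R v) ` S"])
        show "locally_integrable_on UNIV f" using fi by (rule integrable_imp_locally_integrable)
        show "continuous_on UNIV (\<lambda>x. \<psi> (x - t *\<^sub>R v))"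
          by (intro continuous_on_compose2[OF smooth_continuous[OF S(1)]] continuous_intros) auto
        show "compact ((\<lambda>x. x + t *\<^sub>R v) ` S)" using S(2) by (intro compact_continuous_image continuous_intros)
        show "\<psi> (x - t *\<^sub>R v) = 0" if "x \<notin> (\<lambda>x. x + t *\<^sub>R v) ` S" for x
        proof (rule S(4))
          show "x - t *\<^sub>R v \<notin> S" using that by (auto simp: image_iff dest: bspec[where x="x - t *\<^sub>R v"])
        qed
      qed simp
    qed
    have der: "\<exists>F'. (F has_real_derivative F') (at s) \<and> F' \<le> p * I" if s: "0 \<le> s" for s
    proof (intro exI conjI)
      let ?F' = "LINT x|lebesgue. (v \<bullet> w x) * \<phi>s s x"
      have "((\<lambda>t. LINT x|lebesgue. f x * ((\<phi>s s (x + t *\<^sub>R (- v)) - \<phi>s s x) / t))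
            \<longlongrightarrow> (LINT x|lebesgue. f x * frechet_derivative (\<phi>s s) (at x) (- v))) (at 0)"
        by (rule difference_quotient_tendsto[OF C fl \<phi>s[OF s]])
      moreover have "(LINT x|lebesgue. f x * frechet_derivative (\<phi>s s) (at x) (- v)) = ?F'"
        using w \<phi>s[OF s] unfolding weak_gradient_of_def by simp
      moreover have "(LINT x|lebesgue. f x * ((\<phi>s s (x + t *\<^sub>R (- v)) - \<phi>s s x) / t)) = (F (s + t) - F s) / t" for t
      proof -
        have eq: "\<phi>s s (x + t *\<^sub>R (- v)) = \<phi>s (s + t) x" for x
          by (simp add: \<phi>s_def algebra_simps)
        have i: "integrable lebesgue (\<lambda>x. f x * \<phi>s r x)" for r unfolding \<phi>s_def by (rule Fi[OF \<phi>])
        have "(F (s + t) - F s) = (LINT x|lebesgue. f x * \<phi>s (s + t) x - f x * \<phi>s s x)"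
          unfolding F_def by (rule Bochner_Integration.integral_diff[symmetric]) (rule i)+
        then show ?thesis unfolding eq times_divide_eq_right right_diff_distrib by simp
      qed
      ultimately have "((\<lambda>t. (F (s + t) - F s) / t) \<longlongrightarrow> ?F') (at 0)" by (simp only:)
      then show "(F has_real_derivative ?F') (at s)" by (simp add: DERIV_def)
      have "?F' \<le> (LINT x|lebesgue. p * \<phi>s s x)"
      proof (rule integral_mono_AE)
        show "integrable lebesgue (\<lambda>x. v \<bullet> w x * \<phi>s s x)"
          using w by (intro int_test[OF _ \<phi>s[OF s]]) (simp add: weak_gradient_of_def)
        show "integrable lebesgue (\<lambda>x. p * \<phi>s s x)" by (rule int_test[OF loc1 \<phi>s[OF s]])
        show "AE x in lebesgue. v \<bullet> w x * \<phi>s s x \<le> p * \<phi>s s x"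
          using le
        proof eventually_elim
          case (elim x)
          have "0 \<le> \<phi>s s x" using \<phi>0 by (simp add: \<phi>s_def)
          then show ?case
            using elim test_function_vanishes_outside(1)[OF \<phi>s[OF s], of x]
            by (cases "x \<in> C") (auto intro: mult_right_mono)
        qed
      qed
      also have "\<dots> = p * I" by (simp add: \<phi>sI)
      finally show "?F' \<le> p * I" .
    qed
    have "F 1 - F 0 \<le> p * I"
    proof -
      obtain F' where F': "\<And>s. 0 \<le> s \<Longrightarrow> (F has_real_derivative F' s) (at s)" "\<And>s. 0 \<le> s \<Longrightarrow> F' s \<le> p * I"
        using der by metis
      obtain z where "0 < z" "z < 1" "F 1 - F 0 = (1 - 0) * F' z"
        using MVT2[of 0 1 F F'] F'(1) by auto
      then show ?thesis using F'(2)[of z] by simp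
    qed
    moreover have "F 1 = (LINT x|lebesgue. f (v + x) * \<phi> x)"
    proof -
      have fm [measurable]: "f \<in> borel_measurable borel" by fact
      have "F 1 = (LINT x|lborel. f x * \<phi> (x - v))"
        unfolding F_def \<phi>s_def by (subst integral_completion) simp_all
      also have "\<dots> = (LINT x|lborel. f (v + x) * \<phi> ((v + x) - v))"
        by (subst lborel_integral_translate[of "\<lambda>x. f x * \<phi> (x - v)" v]) measurable
      also have "\<dots> = (LINT x|lebesgue. f (v + x) * \<phi> x)"
        by (subst integral_completion) simp_all
      finally show ?thesis .
    qed
    moreover have "F 0 = (LINT x|lebesgue. f x * \<phi> x)" by (simp add: F_def \<phi>s_def)
    moreover have "(LINT x|lebesgue. ((f (v + x) - f x) - p) * \<phi> x)
       = (LINT x|lebesgue. f (v + x) * \<phi> x) - (LINT x|lebesgue. f x * \<phi> x) - p * I"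
    proof -
      have i: "integrable lebesgue (\<lambda>x. f (v + x) * \<phi> x)" "integrable lebesgue (\<lambda>x. f x * \<phi> x)" "integrable lebesgue (\<lambda>x. p * \<phi> x)"
        using int_test[OF integrable_imp_locally_integrable[OF fv] \<phi>] int_test[OF fl \<phi>] int_test[OF loc1 \<phi>]
        by auto
      have "(LINT x|lebesgue. ((f (v + x) - f x) - p) * \<phi> x)
         = (LINT x|lebesgue. f (v + x) * \<phi> x - f x * \<phi> x - p * \<phi> x)"
        by (simp add: left_diff_distrib)
      also have "\<dots> = (LINT x|lebesgue. f (v + x) * \<phi> x) - (LINT x|lebesgue. f x * \<phi> x) - (LINT x|lebesgue. p * \<phi> x)"
        using i by simp
      finally show ?thesis by (simp add: I_def)
    qed
    ultimately show "(LINT x|lebesgue. ((f (v + x) - f x) - p) * \<phi> x) \<le> 0" by simp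
  qed
  then show ?thesis by eventually_elim simp
qed

section \<open>Averages over translated pieces and the extremal charge\<close>

text \<open>\<open>C\<close> is exhausted by a sequence of compact sets.\<close>

lemma locally_integrable_imp_measurable:
  fixes C :: "'a::euclidean_space set"
  assumes C: "open C" and u: "locally_integrable_on C u"
  shows "u \<in> borel_measurable (lebesgue_on C)"
proof -
  have Cm: "C \<inter> space lebesgue \<in> sets lebesgue" using C by auto
  obtain a b :: "nat \<Rightarrow> 'a" where ab: "C = (\<Union>n. box (a n) (b n))" "\<And>n. cbox (a n) (b n) \<subseteq> C"
    using open_as_union_of_inner_boxes[OF C] by blast
  define Q where "Q k = (\<Union>n<k. cbox (a n) (b n))" for k
  have Q: "compact (Q k)" "Q k \<subseteq> C" for k using ab(2) by (auto simp: Q_def intro!: compact_UN)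
  have "incseq Q" unfolding incseq_def Q_def by (intro allI impI UN_mono) auto
  moreover have "(\<Union>k. Q k) = C"
  proof
    show "(\<Union>k. Q k) \<subseteq> C" using Q by blast
    have "box (a n) (b n) \<subseteq> Q (Suc n)" for n
      using box_subset_cbox by (force simp: Q_def lessThan_Suc)
    then show "C \<subseteq> (\<Union>k. Q k)" unfolding ab(1) by blast
  qed
  ultimately have lim: "(\<lambda>k. indicator (Q k) x :: real) \<longlonglongrightarrow> indicator C x" for x
    using LIMSEQ_indicator_incseq[of Q x] by simp
  have "(\<lambda>x. indicator C x * u x) \<in> borel_measurable lebesgue"
  proof (rule borel_measurable_LIMSEQ_real)
    show "(\<lambda>k. indicator (Q k) x * u x) \<longlonglongrightarrow> indicator C x * u x" for x
      by (intro tendsto_mult_right lim)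
    show "(\<lambda>x. indicator (Q k) x * u x) \<in> borel_measurable lebesgue" for k
      using u Q[of k] by (auto simp: locally_integrable_on_def set_integrable_def dest: borel_measurable_integrable)
  qed
  then show ?thesis unfolding borel_measurable_restrict_space_iff[OF Cm] by simp
qed

text \<open>For a convex function the slopes decrease with the step length, and a Lipschitz bound keeps them
  bounded, so they converge at every point.\<close>

lemma directional_limit_exists:
  fixes q :: "'a::real_vector \<Rightarrow> real"
  assumes convex: "\<And>x y t. 0 \<le> t \<Longrightarrow> t \<le> 1 \<Longrightarrow> q ((1 - t) *\<^sub>R x + t *\<^sub>R y) \<le> (1 - t) * q x + t * q y"
    and bound: "\<And>t. 0 < t \<Longrightarrow> \<bar>q (x + t *\<^sub>R v) - q x\<bar> \<le> t * L"
  shows "convergent (\<lambda>n. (q (x + (1 / real (Suc n)) *\<^sub>R v) - q x) * real (Suc n))"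
proof -
  have mono: "(q (x + s *\<^sub>R v) - q x) / s \<le> (q (x + t *\<^sub>R v) - q x) / t" if "0 < s" "s \<le> t" for s t
  proof -
    have "(1 - s / t) *\<^sub>R x + (s / t) *\<^sub>R (x + t *\<^sub>R v) = x + s *\<^sub>R v"
      using that by (simp add: algebra_simps)
    then have "q (x + s *\<^sub>R v) \<le> (1 - s / t) * q x + (s / t) * q (x + t *\<^sub>R v)"
      using convex[of "s / t" x "x + t *\<^sub>R v"] that by simp
    then have "q (x + s *\<^sub>R v) - q x \<le> s * ((q (x + t *\<^sub>R v) - q x) / t)"
      by (simp add: algebra_simps diff_divide_distrib)
    then show ?thesis using that by (simp add: pos_divide_le_eq mult.commute)
  qed
  let ?X = "\<lambda>n. (q (x + (1 / real (Suc n)) *\<^sub>R v) - q x) * real (Suc n)"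
  have "decseq ?X"
  proof (rule decseq_SucI)
    fix n
    show "?X (Suc n) \<le> ?X n"
      using mono[of "1 / real (Suc (Suc n))" "1 / real (Suc n)"] by (simp add: frac_le)
  qed
  moreover have "Bseq ?X"
  proof (rule BseqI'[of _ L])
    fix n
    have "\<bar>q (x + (1 / real (Suc n)) *\<^sub>R v) - q x\<bar> * real (Suc n) \<le> ((1 / real (Suc n)) * L) * real (Suc n)"
      by (intro mult_right_mono bound) auto
    then show "norm (?X n) \<le> L" by (simp add: abs_mult del: of_nat_Suc)
  qed
  ultimately show ?thesis by (intro Bseq_monoseq_convergent) (auto simp: monoseq_iff)
qed

context body_and_cone
begin

lemma translated_piece: 
  assumes "x \<in> C" "h > 0" shows "(+) x ` piece h \<in> sets (lebesgue_on C)" "(+) x ` piece h \<in> sets borel"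
proof -
  have o: "open ((+) x ` piece h)" using open_piece[OF assms(2)] by (rule open_translation)
  moreover have "(+) x ` piece h \<subseteq> C" using assms by (auto simp: piece_mem cone_add)
  ultimately show "(+) x ` piece h \<in> sets (lebesgue_on C)"
    using open_C by (subst sets_restrict_space_iff) auto
  show "(+) x ` piece h \<in> sets borel" using o by auto
qed

lemma charge_of_translated_piece:
  assumes f: "is_charge_density C \<nu> f" and x: "x \<in> C" and h: "h > 0"
  shows "\<nu> ((+) x ` piece h) = (LINT v|lborel. indicator (piece h) v * f (x + v))"
proof -
  have [measurable]: "f \<in> borel_measurable borel" using f by (simp add: is_charge_density_def)
  note tm [measurable] = translated_piece(2)[OF x h]
  have "\<nu> ((+) x ` piece h) = (LINT y|lebesgue. indicator ((+) x ` piece h) y * f y)"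
    using f translated_piece(1)[OF x h] by (simp add: is_charge_density_def)
  also have "\<dots> = (LINT y|lborel. indicator ((+) x ` piece h) y * f y)"
    by (intro integral_completion) simp
  also have "\<dots> = (LINT v|lborel. indicator ((+) x ` piece h) (x + v) * f (x + v))"
    by (subst lborel_integral_translate[of "\<lambda>y. indicator ((+) x ` piece h) y * f y" x]) simp_all
  also have "\<dots> = (LINT v|lborel. indicator (piece h) v * f (x + v))"
    by (intro Bochner_Integration.integral_cong) (auto simp: indicator_def)
  finally show ?thesis .
qed

lemma charge_of_translated_piece_measurable:
  assumes \<nu>: "\<nu> \<in> charges C" and h: "h > 0"
  shows "(\<lambda>x. \<nu> ((+) x ` piece h)) \<in> borel_measurable (lebesgue_on C)"
proof -
  obtain f where f: "is_charge_density C \<nu> f" using charge_has_density[OF open_C \<nu>] .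
  have [measurable]: "f \<in> borel_measurable borel" using f by (simp add: is_charge_density_def)
  have [measurable]: "piece h \<in> sets borel" using h by measurable
  have "(\<lambda>x. LINT v|lborel. indicator (piece h) v * f (x + v)) \<in> borel_measurable borel" by measurable
  then have "(\<lambda>x. LINT v|lborel. indicator (piece h) v * f (x + v)) \<in> borel_measurable (lebesgue_on C)"
    by (intro measurable_restrict_space1 measurable_completion) simp
  moreover have "(\<lambda>x. \<nu> ((+) x ` piece h)) \<in> borel_measurable (lebesgue_on C) \<longleftrightarrow>
      (\<lambda>x. LINT v|lborel. indicator (piece h) v * f (x + v)) \<in> borel_measurable (lebesgue_on C)"
    using charge_of_translated_piece[OF f _ h] by (intro measurable_cong) simp
  ultimately show ?thesis by simp
qed

lemma charge_norm_le_iff: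
  "charge_norm K C \<nu> \<le> ereal c \<longleftrightarrow> (\<forall>h>0. Linfty_norm C (\<lambda>x. \<nu> ((+) x ` piece h)) \<le> ereal c)"
  by (auto simp: charge_norm_def charge_norm_at_def Linfty_norm_def piece_def SUP_le_iff)

lemma charge_norm_le_AE:
  assumes "charge_norm K C \<nu> \<le> ereal c" "h > 0"
  shows "AE x in lebesgue_on C. \<bar>\<nu> ((+) x ` piece h)\<bar> \<le> c"
  using assms by (auto simp: charge_norm_le_iff Linfty_norm_le_iff)

text \<open>The mean of the density over \<open>x + hG\<close>, with \<open>G = K \<inter> C\<close>, computed from the charge alone.\<close>

definition average :: "real \<Rightarrow> ('a set \<Rightarrow> real) \<Rightarrow> 'a \<Rightarrow> real" where
  "average h \<nu> x = \<nu> ((+) x ` piece h) / (h ^ DIM('a) * base_volume)"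

text \<open>For each fixed \<open>v\<close> the difference of \<open>f\<close> at \<open>x + v\<close> and \<open>x\<close> is controlled for almost all \<open>x\<close>; Fubini turns this
  into control for almost all \<open>v\<close> at almost every fixed \<open>x\<close>, where one can integrate over \<open>v\<close> in
  \<open>hG\<close>.\<close>

lemma average_error:
  assumes \<nu>: "\<nu> \<in> sobolev_charge_class K C" and h: "h > 0"
  shows "AE x in lebesgue_on C. \<bar>charge_deriv C \<nu> x - average h \<nu> x\<bar> \<le> h * DIM('a) / (DIM('a) + 1)"
proof -
  have ch: "\<nu> \<in> charges C" and W: "charge_deriv C \<nu> \<in> W1infty C"
    and gr: "Linfty_norm C (\<lambda>x. dual_body_norm K (weak_gradient C (charge_deriv C \<nu>) x)) \<le> 1"
    using \<nu> by (auto simp: sobolev_charge_class_def sobolev_charges_def bounded_charges_def)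
  obtain f where f: "is_charge_density C \<nu> f" using charge_has_density[OF open_C ch] .
  have fb [measurable]: "f \<in> borel_measurable borel" and fi: "integrable lborel f"
    using f by (auto simp: is_charge_density_def)
  define w where "w = weak_gradient C (charge_deriv C \<nu>)"
  note D = charge_deriv_eq_density[OF open_C f]
  have wg: "weak_gradient_of C f w"
    unfolding w_def using D density_integrable_on[OF open_C f] W
    by (intro weak_gradient_of_W1infty open_C) auto
  have ae1: "AE x in lebesgue. x \<in> C \<longrightarrow> dual_body_norm K (w x) \<le> 1"
  proof -
    have "AE x in lebesgue_on C. \<bar>dual_body_norm K (w x)\<bar> \<le> 1"
      using gr unfolding w_def one_ereal_def Linfty_norm_le_iff by simp
    then show ?thesis unfolding AE_lebesgue_on_iff[OF open_C] by (auto elim!: eventually_mono)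
  qed
  have shift: "AE x in lborel. x \<in> C \<longrightarrow> \<bar>f (v + x) - f x\<bar> \<le> body_norm K v" if v: "v \<in> C" for v
  proof -
    have "AE x in lebesgue. x \<in> C \<longrightarrow> f (v + x) - f x \<le> body_norm K v"
    proof (rule translate_difference_le[OF open_C fb fi wg])
      show "AE x in lebesgue. x \<in> C \<longrightarrow> v \<bullet> w x \<le> body_norm K v"
        using ae1 by eventually_elim (auto intro: inner_le_body_norm)
    qed (use v in \<open>auto intro: cone_add_scaled\<close>)
    moreover have "AE x in lebesgue. x \<in> C \<longrightarrow> - f (v + x) - (- f x) \<le> body_norm K v"
    proof (rule translate_difference_le[OF open_C _ _ weak_gradient_of_uminus[OF wg]])
      show "AE x in lebesgue. x \<in> C \<longrightarrow> v \<bullet> - w x \<le> body_norm K v"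
        using ae1
      proof eventually_elim
        case (elim x)
        then show ?case using inner_le_body_norm[of "w x" "- v"] by (auto simp: body_norm_minus)
      qed
    qed (use v fb fi in \<open>auto intro: cone_add_scaled\<close>)
    ultimately have "AE x in lebesgue. x \<in> C \<longrightarrow> \<bar>f (v + x) - f x\<bar> \<le> body_norm K v"
      by eventually_elim auto
    then show ?thesis by (simp add: AE_completion_iff)
  qed
  have [measurable]: "C \<in> sets borel" using open_C by auto
  have "AE v in lborel. AE x in lborel. v \<in> C \<longrightarrow> x \<in> C \<longrightarrow> \<bar>f (v + x) - f x\<bar> \<le> body_norm K v"
  proof (rule AE_I2)
    fix v
    show "AE x in lborel. v \<in> C \<longrightarrow> x \<in> C \<longrightarrow> \<bar>f (v + x) - f x\<bar> \<le> body_norm K v"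
      by (cases "v \<in> C") (use shift[of v] in auto)
  qed
  then have swap: "AE x in lborel. AE v in lborel. v \<in> C \<longrightarrow> x \<in> C \<longrightarrow> \<bar>f (v + x) - f x\<bar> \<le> body_norm K v"
    by (subst (asm) lborel_pair.AE_commute) measurable
  have [measurable]: "piece h \<in> sets borel" using h by measurable
  have "AE x in lborel. x \<in> C \<longrightarrow> \<bar>f x - average h \<nu> x\<bar> \<le> h * DIM('a) / (DIM('a) + 1)"
    using swap
  proof (eventually_elim, intro impI)
    fix x assume "AE v in lborel. v \<in> C \<longrightarrow> x \<in> C \<longrightarrow> \<bar>f (v + x) - f x\<bar> \<le> body_norm K v" and x: "x \<in> C"
    then have ae: "AE v in lborel. v \<in> C \<longrightarrow> \<bar>f (x + v) - f x\<bar> \<le> body_norm K v" by (simp add: add.commute)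
    let ?V = "h ^ DIM('a) * base_volume"
    have V: "?V > 0" using h base_volume_pos by simp
    let ?i = "\<lambda>v. indicator (piece h) v :: real"
    have int1: "integrable lborel ?i"
      using emeasure_piece_finite[of h] by (intro integrable_real_indicator) auto
    have I1: "(LINT v|lborel. ?i v) = ?V" using measure_piece[OF h] by simp
    have int2: "integrable lborel (\<lambda>v. ?i v * f (x + v))"
      using integrable_mult_indicator[OF _ lborel_integrable_translate[OF fb fi, of x], of "piece h"] by simp
    have int3: "integrable lborel (\<lambda>v. ?i v * f x)" using int1 by simp
    have int4: "integrable lborel (\<lambda>v. ?i v * h - ?i v * (h - body_norm K v))"
      using int1 integral_hat(2)[OF h] by (intro Bochner_Integration.integrable_diff) auto
    have "\<bar>\<nu> ((+) x ` piece h) - ?V * f x\<bar> = \<bar>LINT v|lborel. ?i v * f (x + v) - ?i v * f x\<bar>"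
      using int2 int3 I1 by (simp add: charge_of_translated_piece[OF f x h])
    also have "\<dots> \<le> (LINT v|lborel. \<bar>?i v * f (x + v) - ?i v * f x\<bar>)" by (rule integral_abs_bound)
    also have "\<dots> \<le> (LINT v|lborel. ?i v * h - ?i v * (h - body_norm K v))"
    proof (rule integral_mono_AE)
      show "AE v in lborel. \<bar>?i v * f (x + v) - ?i v * f x\<bar> \<le> ?i v * h - ?i v * (h - body_norm K v)"
        using ae by eventually_elim (auto simp: indicator_def piece_mem h)
    qed (use int2 int3 int4 in auto)
    also have "\<dots> = ?V * h - h ^ (DIM('a) + 1) * base_volume / (DIM('a) + 1)"
      using int1 I1 integral_hat[OF h] by simp
    also have "\<dots> = ?V * (h * DIM('a) / (DIM('a) + 1))"
      by (simp add: field_simps)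
    finally have "\<bar>\<nu> ((+) x ` piece h) - ?V * f x\<bar> / ?V \<le> h * DIM('a) / (DIM('a) + 1)"
      using V by (simp add: pos_divide_le_eq mult.commute)
    moreover have "\<bar>\<nu> ((+) x ` piece h) - ?V * f x\<bar> / ?V = \<bar>(\<nu> ((+) x ` piece h) - ?V * f x) / ?V\<bar>"
      using V by (simp add: abs_divide)
    moreover have "(\<nu> ((+) x ` piece h) - ?V * f x) / ?V = average h \<nu> x - f x"
      using h base_volume_pos by (simp add: average_def diff_divide_distrib)
    ultimately show "\<bar>f x - average h \<nu> x\<bar> \<le> h * DIM('a) / (DIM('a) + 1)"
      by (simp add: abs_minus_commute)
  qed
  then have "AE x in lebesgue_on C. \<bar>f x - average h \<nu> x\<bar> \<le> h * DIM('a) / (DIM('a) + 1)"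
    unfolding AE_lebesgue_on_iff[OF open_C] by (rule AE_completion)
  with D(2) show ?thesis by eventually_elim simp
qed

definition hat :: "real \<Rightarrow> 'a \<Rightarrow> real" where "hat h x = max 0 (h - body_norm K x)"

lemma hat_bounds: "h > 0 \<Longrightarrow> 0 \<le> hat h x \<and> hat h x \<le> h"
  using body_norm_nonneg[of x] by (auto simp: hat_def)

lemma hat_diff_le: "\<bar>hat h x - hat h y\<bar> \<le> body_norm K (x - y)"
  using body_norm_diff_le[of x y] by (auto simp: hat_def max_def abs_if split: if_splits)

lemma continuous_on_hat: "continuous_on UNIV (hat h)"
  unfolding hat_def by (intro continuous_intros continuous_on_body_norm)

lemma hat_measurable [measurable]: "hat h \<in> borel_measurable borel"
  using continuous_on_hat by (rule borel_measurable_continuous_onI)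

text \<open>The one-sided directional derivative of the hat in direction \<open>v\<close>.\<close>

definition hat_slope :: "real \<Rightarrow> 'a \<Rightarrow> 'a \<Rightarrow> real" where
  "hat_slope h v x = lim (\<lambda>n. (hat h (x + (1 / real (Suc n)) *\<^sub>R v) - hat h x) * real (Suc n))"

lemma body_norm_convex:
  "0 \<le> t \<Longrightarrow> t \<le> 1 \<Longrightarrow> body_norm K ((1 - t) *\<^sub>R x + t *\<^sub>R y) \<le> (1 - t) * body_norm K x + t * body_norm K y"
  using body_norm_triangle[of "(1 - t) *\<^sub>R x" "t *\<^sub>R y"] body_norm_scale_pos[of t y] body_norm_scale_pos[of "1 - t" x]
  by (cases "t = 0"; cases "t = 1") auto

lemma hat_quotient_bound:
  "\<bar>(hat h (x + (1 / real (Suc n)) *\<^sub>R v) - hat h x) * real (Suc n)\<bar> \<le> body_norm K v"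
proof -
  have "\<bar>hat h (x + (1 / real (Suc n)) *\<^sub>R v) - hat h x\<bar> * real (Suc n)
      \<le> body_norm K ((1 / real (Suc n)) *\<^sub>R v) * real (Suc n)"
    using hat_diff_le[of h "x + (1 / real (Suc n)) *\<^sub>R v" x] by (intro mult_right_mono) auto
  also have "\<dots> = body_norm K v" by (subst body_norm_scale_pos) (auto simp del: of_nat_Suc)
  finally show ?thesis by (simp add: abs_mult)
qed

text \<open>The hat is the difference of the convex functions \<open>max h p\<close> and \<open>p\<close>, whose slopes converge.\<close>

lemma hat_slope_lim:
  "(\<lambda>n. (hat h (x + (1 / real (Suc n)) *\<^sub>R v) - hat h x) * real (Suc n)) \<longlonglongrightarrow> hat_slope h v x"
proof -
  let ?p = "body_norm K" and ?q = "\<lambda>x. max h (body_norm K x)"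
  have bp: "\<bar>?p (x + t *\<^sub>R v) - ?p x\<bar> \<le> t * ?p v" if "0 < t" for t
    using body_norm_diff_le[of "x + t *\<^sub>R v" x] that by (simp add: body_norm_scale_pos)
  have bq: "\<bar>?q (x + t *\<^sub>R v) - ?q x\<bar> \<le> t * ?p v" if "0 < t" for t
    using bp[OF that] by (auto simp: max_def abs_if split: if_splits)
  have cq: "?q ((1 - t) *\<^sub>R y + t *\<^sub>R z) \<le> (1 - t) * ?q y + t * ?q z" if t: "0 \<le> t" "t \<le> 1" for t y z
  proof (rule max.boundedI)
    have "(1 - t) * h + t * h \<le> (1 - t) * ?q y + t * ?q z"
      using t by (intro add_mono mult_left_mono) auto
    then show "h \<le> (1 - t) * ?q y + t * ?q z" by (simp add: algebra_simps)
    have "(1 - t) * ?p y + t * ?p z \<le> (1 - t) * ?q y + t * ?q z"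
      using t by (intro add_mono mult_left_mono) auto
    then show "?p ((1 - t) *\<^sub>R y + t *\<^sub>R z) \<le> (1 - t) * ?q y + t * ?q z"
      using body_norm_convex[OF t, of y z] by linarith
  qed
  \<comment> \<open>The slopes of \<open>?q\<close> and of \<open>?p\<close> converge separately.\<close>
  have "convergent (\<lambda>n. (?q (x + (1 / real (Suc n)) *\<^sub>R v) - ?q x) * real (Suc n)
      - (?p (x + (1 / real (Suc n)) *\<^sub>R v) - ?p x) * real (Suc n))"
    using directional_limit_exists[of ?q, OF cq bq] directional_limit_exists[of ?p, OF body_norm_convex bp]
    by (intro convergent_diff)
  moreover have "(\<lambda>n. (?q (x + (1 / real (Suc n)) *\<^sub>R v) - ?q x) * real (Suc n)
      - (?p (x + (1 / real (Suc n)) *\<^sub>R v) - ?p x) * real (Suc n))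
    = (\<lambda>n. (hat h (x + (1 / real (Suc n)) *\<^sub>R v) - hat h x) * real (Suc n))"
  proof
    fix n
    have "hat h y = ?q y - ?p y" for y by (auto simp: hat_def max_def)
    then show "(?q (x + (1 / real (Suc n)) *\<^sub>R v) - ?q x) * real (Suc n)
      - (?p (x + (1 / real (Suc n)) *\<^sub>R v) - ?p x) * real (Suc n)
      = (hat h (x + (1 / real (Suc n)) *\<^sub>R v) - hat h x) * real (Suc n)"
      by (simp add: left_diff_distrib)
  qed
  ultimately show ?thesis unfolding hat_slope_def by (simp add: convergent_LIMSEQ_iff)
qed

lemma hat_slope_bound: "\<bar>hat_slope h v x\<bar> \<le> body_norm K v"
  using LIMSEQ_le_const2[OF tendsto_rabs[OF hat_slope_lim[of h x v]]] hat_quotient_bound by blast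

lemma hat_slope_measurable [measurable]: "hat_slope h v \<in> borel_measurable borel"
  by (rule borel_measurable_LIMSEQ_real[OF hat_slope_lim]) measurable

text \<open>Both sides are limits of difference quotients with step \<open>1 / (n + 1)\<close>: those of the test function, taken
  backwards, on the left, and those of the hat on the right. A translation exchanges them.\<close>

lemma hat_integration_by_parts:
  assumes h: "h > 0" and \<phi>: "\<phi> \<in> test_functions C"
  shows "(LINT x|lebesgue. hat h x * frechet_derivative \<phi> (at x) v) = - (LINT x|lebesgue. hat_slope h v x * \<phi> x)"
proof -
  obtain S where S: "smooth \<phi>" "compact S" "S \<subseteq> C" "\<And>x. x \<notin> S \<Longrightarrow> \<phi> x = 0"
    using test_functionsE[OF \<phi>] by blast
  have \<phi>base_volume [measurable]: "\<phi> \<in> borel_measurable borel"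
    using smooth_continuous[OF S(1)] by (rule borel_measurable_continuous_onI)
  have hl: "locally_integrable_on UNIV (hat h)"
    using hat_bounds[OF h] by (intro bounded_measurable_locally_integrable[where B=h]) auto
  have hlC: "locally_integrable_on C (hat h)"
    using hat_bounds[OF h] by (intro bounded_measurable_locally_integrable[where B=h]) auto
  have i: "integrable lebesgue (\<lambda>x. hat h x * \<phi> (x + y))" for y
  proof (rule integrable_against_test[OF hl, where Q="(\<lambda>x. x - y) ` S"])
    show "continuous_on UNIV (\<lambda>x. \<phi> (x + y))"
      by (intro continuous_on_compose2[OF smooth_continuous[OF S(1)]] continuous_intros) auto
    show "compact ((\<lambda>x. x - y) ` S)" using S(2) by (intro compact_continuous_image continuous_intros)
    show "\<phi> (x + y) = 0" if "x \<notin> (\<lambda>x. x - y) ` S" for x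
    proof (rule S(4))
      show "x + y \<notin> S" using that by (auto simp: image_iff dest: bspec[where x="x + y"])
    qed
  qed simp
  define Q where "Q t = (LINT x|lebesgue. hat h x * ((\<phi> (x + t *\<^sub>R v) - \<phi> x) / t))" for t
  define L where "L = (LINT x|lebesgue. hat h x * frechet_derivative \<phi> (at x) v)"
  have "(Q \<longlongrightarrow> L) (at 0)"
    unfolding Q_def[abs_def] L_def by (rule difference_quotient_tendsto[OF open_C hlC \<phi>])
  moreover have "filterlim (\<lambda>n. - (1 / real (Suc n))) (at 0) sequentially"
    using tendsto_minus[OF LIMSEQ_Suc[OF lim_1_over_n]] by (auto simp: filterlim_at)
  ultimately have lim1: "(\<lambda>n. Q (- (1 / real (Suc n)))) \<longlonglongrightarrow> L"
    by (rule filterlim_compose)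
  obtain B where B: "B \<ge> 0" "\<And>x. \<bar>\<phi> x\<bar> \<le> B"
    using continuous_compact_support_bounded[OF smooth_continuous[OF S(1)] S(2,4)] by blast
  let ?q = "\<lambda>n x. (hat h (x + (1 / real (Suc n)) *\<^sub>R v) - hat h x) * real (Suc n)"
  have one: "locally_integrable_on C (\<lambda>x. 1)" by (rule bounded_measurable_locally_integrable[where B=1]) auto
  have lim2: "(\<lambda>n. LINT x|lebesgue. 1 * (?q n x * \<phi> x)) \<longlonglongrightarrow> (LINT x|lebesgue. 1 * (hat_slope h v x * \<phi> x))"
  proof (rule dominated_convergence_against_locally_integrable(1)[OF one S(2,3), where B="body_norm K v * B"])
    show "(\<lambda>x. ?q n x * \<phi> x) \<in> borel_measurable borel" for n by measurable
    show "(\<lambda>n. ?q n x * \<phi> x) \<longlonglongrightarrow> hat_slope h v x * \<phi> x" for x by (intro tendsto_mult_right hat_slope_lim)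
    show "\<bar>?q n x * \<phi> x\<bar> \<le> body_norm K v * B" for n x
      unfolding abs_mult[of "?q n x" "\<phi> x"] by (intro mult_mono hat_quotient_bound B body_norm_nonneg abs_ge_zero)
    show "\<And>n x. x \<notin> S \<Longrightarrow> ?q n x * \<phi> x = 0" using S(4) by simp
  qed
  have "Q (- (1 / real (Suc n))) = - (LINT x|lebesgue. 1 * (?q n x * \<phi> x))" for n
  proof -
    let ?y = "(1 / real (Suc n)) *\<^sub>R v"
    have i': "integrable lebesgue (\<lambda>x. hat h x * \<phi> (x - ?y))" using i[of "- ?y"] by simp
    have "(LINT x|lebesgue. hat h x * \<phi> (x - ?y)) = (LINT x|lborel. hat h x * \<phi> (x - ?y))"
      by (intro integral_completion) measurable
    also have "\<dots> = (LINT x|lborel. hat h (?y + x) * \<phi> (?y + x - ?y))"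
      by (subst lborel_integral_translate[of "\<lambda>x. hat h x * \<phi> (x - ?y)" ?y]) simp_all
    also have "\<dots> = (LINT x|lborel. hat h (x + ?y) * \<phi> x)" by (simp add: add.commute)
    also have "\<dots> = (LINT x|lebesgue. hat h (x + ?y) * \<phi> x)"
      by (intro integral_completion[symmetric]) measurable
    finally have tr: "(LINT x|lebesgue. hat h x * \<phi> (x - ?y)) = (LINT x|lebesgue. hat h (x + ?y) * \<phi> x)" .
    have i2: "integrable lebesgue (\<lambda>x. hat h (x + ?y) * \<phi> x)"
    proof (rule integrable_against_test[OF _ smooth_continuous[OF S(1)] S(2,3,4)])
      show "locally_integrable_on C (\<lambda>x. hat h (x + ?y))"
        using hat_bounds[OF h] by (intro bounded_measurable_locally_integrable[where B=h]) auto
    qed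
    have i3: "integrable lebesgue (\<lambda>x. hat h x * \<phi> x)" using i[of 0] by simp
    have "Q (- (1 / real (Suc n))) = (LINT x|lebesgue. - real (Suc n) * (hat h x * \<phi> (x - ?y) - hat h x * \<phi> x))"
      unfolding Q_def by (intro Bochner_Integration.integral_cong) (simp_all add: algebra_simps)
    also have "\<dots> = - real (Suc n) * ((LINT x|lebesgue. hat h (x + ?y) * \<phi> x) - (LINT x|lebesgue. hat h x * \<phi> x))"
      using i' i3 unfolding tr[symmetric] by simp
    also have "\<dots> = - (LINT x|lebesgue. real (Suc n) * (hat h (x + ?y) * \<phi> x - hat h x * \<phi> x))"
      using i2 i3 by (simp del: of_nat_Suc)
    also have "(LINT x|lebesgue. real (Suc n) * (hat h (x + ?y) * \<phi> x - hat h x * \<phi> x)) = (LINT x|lebesgue. 1 * (?q n x * \<phi> x))"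
      by (intro Bochner_Integration.integral_cong) (simp_all add: algebra_simps)
    finally show ?thesis .
  qed
  then have "L = - (LINT x|lebesgue. 1 * (hat_slope h v x * \<phi> x))"
    using LIMSEQ_unique[OF lim1] tendsto_minus[OF lim2] by simp
  then show ?thesis by (simp add: L_def)
qed

text \<open>The hat restricted to \<open>C\<close>, in the form in which its integral is known.\<close>

definition extremal_density :: "real \<Rightarrow> 'a \<Rightarrow> real" where
  "extremal_density h x = indicator (piece h) x * (h - body_norm K x)"

lemma extremal_density_eq_hat: "h > 0 \<Longrightarrow> x \<in> C \<Longrightarrow> extremal_density h x = hat h x"
  by (auto simp: extremal_density_def hat_def indicator_def piece_mem)

lemma extremal_density_outside: "h > 0 \<Longrightarrow> x \<notin> C \<Longrightarrow> extremal_density h x = 0"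
  by (auto simp: extremal_density_def piece_mem)

lemma extremal_density_nonneg: "h > 0 \<Longrightarrow> 0 \<le> extremal_density h x"
  by (auto simp: extremal_density_def indicator_def piece_mem)

lemma extremal_density_measurable: "h > 0 \<Longrightarrow> extremal_density h \<in> borel_measurable borel"
  unfolding extremal_density_def[abs_def] by measurable

text \<open>The density exceeds any number below \<open>h\<close> on a small piece near the apex of the cone, a nonempty open
  set.\<close>

lemma AE_extremal_density_le:
  assumes h: "h > 0" and ae: "AE x in lebesgue_on C. extremal_density h x \<le> c"
  shows "h \<le> c"
proof (rule ccontr)
  assume c: "\<not> h \<le> c"
  \<comment> \<open>On the piece of size \<open>r\<close> the density exceeds \<open>c\<close>.\<close>
  define r where "r = h - max 0 c"
  have r: "r > 0" "r \<le> h" using c h by (auto simp: r_def)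
  have "AE x in lebesgue. x \<notin> piece r"
    using ae unfolding AE_lebesgue_on_iff[OF open_C]
  proof eventually_elim
    case (elim x)
    show ?case
    proof
      assume x: "x \<in> piece r"
      then have "x \<in> piece h" "x \<in> C" using r h by (auto simp: piece_mem)
      moreover have "body_norm K x < r" using x r by (simp add: piece_mem)
      ultimately show False using elim by (auto simp: extremal_density_def r_def)
    qed
  qed
  then have "piece r \<in> null_sets lebesgue"
    using open_piece[OF r(1)] by (subst (asm) AE_iff_null_sets[symmetric]) auto
  then show False
    using open_not_negligible[OF open_piece[OF r(1)] piece_nonempty[OF r(1)]] by (simp add: negligible_iff_null_sets)
qed

text \<open>The factor \<open>c\<close> allows the charge to be rescaled to the unit ball, where operator norms are tested.\<close>

definition extremal_charge :: "real \<Rightarrow> real \<Rightarrow> 'a set \<Rightarrow> real" where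
  "extremal_charge c h = charge_of_density C (\<lambda>x. c * extremal_density h x)"

lemma extremal_charge_density:
  assumes h: "h > 0"
  shows "extremal_charge c h \<in> charges C"
    and "is_charge_density C (extremal_charge c h) (\<lambda>x. c * extremal_density h x)"
proof -
  have 1: "(\<lambda>x. c * extremal_density h x) \<in> borel_measurable borel"
    using extremal_density_measurable[OF h] by simp
  have 2: "integrable lborel (\<lambda>x. c * extremal_density h x)"
    unfolding extremal_density_def by (intro integrable_mult_right integral_hat(2) h)
  have 3: "c * extremal_density h x = 0" if "x \<notin> C" for x using that h by (simp add: extremal_density_outside)
  show "extremal_charge c h \<in> charges C"
       "is_charge_density C (extremal_charge c h) (\<lambda>x. c * extremal_density h x)"
    unfolding extremal_charge_def using charge_of_density[OF open_C 1 2 3] by auto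
qed

lemma extremal_charge_scale: "extremal_charge c h A = c * extremal_charge 1 h A"
  by (simp add: extremal_charge_def charge_of_density_def mult.left_commute)

text \<open>The density is nonnegative, so no set has more charge than the whole cone.\<close>

lemma extremal_charge_norm:
  assumes h: "h > 0" and c: "c \<ge> 0"
  shows "charge_norm K C (extremal_charge c h) \<le> ereal (c * (h ^ (DIM('a) + 1) * base_volume / (DIM('a) + 1)))"
  unfolding charge_norm_le_iff Linfty_norm_le_iff
proof (intro allI impI conjI)
  fix t :: real assume t: "t > 0"
  show "(\<lambda>x. \<bar>extremal_charge c h ((+) x ` piece t)\<bar>) \<in> borel_measurable (lebesgue_on C)"
    using charge_of_translated_piece_measurable[OF extremal_charge_density(1)[OF h] t] by simp
  have "\<bar>extremal_charge c h A\<bar> \<le> c * (h ^ (DIM('a) + 1) * base_volume / (DIM('a) + 1))" if A: "A \<in> sets (lebesgue_on C)" for A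
  proof -
    have Cm: "C \<inter> space lebesgue \<in> sets lebesgue" using open_C by auto
    have A': "A \<in> sets lebesgue" using A Cm by (auto simp: sets_restrict_space_iff)
    note d = extremal_charge_density(2)[OF h, of c]
    have i: "integrable lebesgue (\<lambda>x. c * extremal_density h x)" by (rule density_integrable_on(1)[OF open_C d])
    have nn: "0 \<le> c * extremal_density h x" for x using c h by (simp add: extremal_density_nonneg)
    have e: "extremal_charge c h A = (LINT x|lebesgue. indicator A x * (c * extremal_density h x))"
      using d A by (simp add: is_charge_density_def)
    have "0 \<le> extremal_charge c h A" unfolding e using nn by (intro integral_nonneg_AE) auto
    moreover have "extremal_charge c h A \<le> (LINT x|lebesgue. c * extremal_density h x)"
      unfolding e
    proof (rule integral_mono_AE)
      show "integrable lebesgue (\<lambda>x. indicator A x * (c * extremal_density h x))"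
        using integrable_mult_indicator[OF A' i] by simp
    qed (use i nn in \<open>auto simp: indicator_def\<close>)
    moreover have "(LINT x|lebesgue. c * extremal_density h x) = (LINT x|lborel. c * extremal_density h x)"
      using extremal_density_measurable[OF h] by (intro integral_completion) simp
    moreover have "\<dots> = c * (h ^ (DIM('a) + 1) * base_volume / (DIM('a) + 1))"
      using integral_hat(1)[OF h] by (simp add: extremal_density_def)
    ultimately show ?thesis by linarith
  qed
  then show "AE x in lebesgue_on C. \<bar>extremal_charge c h ((+) x ` piece t)\<bar>
      \<le> c * (h ^ (DIM('a) + 1) * base_volume / (DIM('a) + 1))"
    using t by (intro AE_I2) (auto intro!: translated_piece(1))
qed

lemma extremal_charge_bounded: "h > 0 \<Longrightarrow> c \<ge> 0 \<Longrightarrow> extremal_charge c h \<in> bounded_charges K C"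
  using extremal_charge_density(1) extremal_charge_norm
  by (force simp: bounded_charges_def intro: le_less_trans)

text \<open>The slopes of the hat provide bounded weak partial derivatives. For an arbitrary weak gradient \<open>w\<close>,
  integration by parts shows that \<open>v \<bullet> w\<close> and the slope in direction \<open>v\<close> have the same integrals against
  test functions, so \<open>v \<bullet> w \<le> p v\<close> almost everywhere, and countably many \<open>v\<close> suffice.\<close>

lemma extremal_charge_in_class:
  assumes h: "h > 0" shows "extremal_charge 1 h \<in> sobolev_charge_class K C"
proof -
  let ?\<nu> = "extremal_charge 1 h" and ?f = "extremal_density h"
  define D where "D = charge_deriv C ?\<nu>"
  have d: "is_charge_density C ?\<nu> ?f" using extremal_charge_density(2)[OF h, of 1] by simp
  have Di: "integrable (lebesgue_on C) D" and Dae: "AE x in lebesgue_on C. D x = ?f x"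
    unfolding D_def using charge_deriv_eq_density[OF open_C d] by auto
  have Dm: "D \<in> borel_measurable (lebesgue_on C)" using Di by auto
  have Cm: "C \<inter> space lebesgue \<in> sets lebesgue" using open_C by auto
  have AEC: "AE x in lebesgue_on C. x \<in> C" unfolding AE_lebesgue_on_iff[OF open_C] by simp
  have LD: "D \<in> Linfty C"
  proof -
    have "AE x in lebesgue_on C. \<bar>D x\<bar> \<le> h"
      using Dae AEC
    proof eventually_elim
      case (elim x)
      then show ?case using hat_bounds[OF h, of x] by (simp add: extremal_density_eq_hat h)
    qed
    then have "Linfty_norm C D \<le> ereal h" using Dm by (simp add: Linfty_norm_le_iff)
    then show ?thesis using Dm by (auto simp: Linfty_def intro: le_less_trans)
  qed
  have bp: "(LINT x|lebesgue. ?f x * frechet_derivative \<phi> (at x) v) = - (LINT x|lebesgue. hat_slope h v x * \<phi> x)"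
    if \<phi>: "\<phi> \<in> test_functions C" for \<phi> v
  proof -
    have "?f x * frechet_derivative \<phi> (at x) v = hat h x * frechet_derivative \<phi> (at x) v" for x
      using extremal_density_eq_hat[OF h, of x] test_function_vanishes_outside(2)[OF \<phi>, of x] by (cases "x \<in> C") auto
    then show ?thesis using hat_integration_by_parts[OF h \<phi>, of v] by (simp only:)
  qed
  have W: "D \<in> W1infty C"
    unfolding W1infty_def
  proof (intro CollectI conjI ballI LD)
    fix b :: 'a assume b: "b \<in> Basis"
    have sm: "hat_slope h b \<in> borel_measurable (lebesgue_on C)"
      by (intro measurable_restrict_space1 measurable_completion) simp
    have "hat_slope h b \<in> Linfty C"
    proof -
      have "Linfty_norm C (hat_slope h b) \<le> ereal (body_norm K b)"
        using sm hat_slope_bound by (simp add: Linfty_norm_le_iff)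
      then show ?thesis using sm by (auto simp: Linfty_def intro: le_less_trans)
    qed
    moreover have "has_weak_partial C b D (hat_slope h b)"
      unfolding has_weak_partial_def
    proof (intro conjI ballI allI impI)
      show "set_integrable lebesgue Q (hat_slope h b)" if "compact Q \<and> Q \<subseteq> C" for Q
        using bounded_measurable_locally_integrable[of "hat_slope h b" "body_norm K b" C] hat_slope_bound that
        by (simp add: locally_integrable_on_def)
      fix \<phi> assume \<phi>: "\<phi> \<in> test_functions C"
      obtain S where S: "smooth \<phi>" "compact S" "S \<subseteq> C" "\<And>x. x \<notin> S \<Longrightarrow> \<phi> x = 0"
        using test_functionsE[OF \<phi>] by blast
      have pm: "(\<lambda>x. frechet_derivative \<phi> (at x) b) \<in> borel_measurable (lebesgue_on C)"
        using borel_measurable_continuous_onI[OF smooth_partial_continuous[OF S(1), of b]]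
        by (intro measurable_restrict_space1 measurable_completion) auto
      have fm: "?f \<in> borel_measurable (lebesgue_on C)"
        using extremal_density_measurable[OF h] by (intro measurable_restrict_space1 measurable_completion) simp
      have "(LINT x|lebesgue_on C. D x * frechet_derivative \<phi> (at x) b)
          = (LINT x|lebesgue_on C. ?f x * frechet_derivative \<phi> (at x) b)"
        using Dae pm fm Dm by (intro integral_cong_AE) (auto elim!: eventually_mono)
      also have "\<dots> = (LINT x|lebesgue. ?f x * frechet_derivative \<phi> (at x) b)"
        using test_function_vanishes_outside(2)[OF \<phi>] by (intro integral_lebesgue_on_test open_C) simp
      also have "\<dots> = - (LINT x|lebesgue. hat_slope h b x * \<phi> x)" by (rule bp[OF \<phi>])
      also have "\<dots> = - (LINT x|lebesgue_on C. hat_slope h b x * \<phi> x)"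
        using test_function_vanishes_outside(1)[OF \<phi>] by (simp add: integral_lebesgue_on_test[OF open_C])
      finally show "(LINT x|lebesgue_on C. D x * frechet_derivative \<phi> (at x) b)
          = - (LINT x|lebesgue_on C. hat_slope h b x * \<phi> x)" .
    qed
    ultimately show "\<exists>g\<in>Linfty C. has_weak_partial C b D g" by blast
  qed
  define w where "w = weak_gradient C D"
  have wg: "weak_gradient_of C ?f w"
    unfolding w_def by (rule weak_gradient_of_W1infty[OF open_C W Dm Dae density_integrable_on(1)[OF open_C d]])
  have wv: "AE x in lebesgue. x \<in> C \<longrightarrow> v \<bullet> w x \<le> body_norm K v" for v
  proof -
    let ?p = "body_norm K v"
    have vl: "locally_integrable_on C (\<lambda>x. v \<bullet> w x)" using wg by (simp add: weak_gradient_of_def)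
    have pl: "locally_integrable_on C (\<lambda>x. ?p)"
      by (rule bounded_measurable_locally_integrable[where B="\<bar>?p\<bar>"]) auto
    have "locally_integrable_on C (\<lambda>x. v \<bullet> w x - ?p)"
      using vl pl unfolding locally_integrable_on_def by (auto intro!: set_integral_diff)
    then have "AE x in lebesgue. x \<in> C \<longrightarrow> v \<bullet> w x - ?p \<le> 0"
    proof (rule AE_nonpos_if_test_integrals_nonpos[OF open_C])
      fix \<phi> assume \<phi>: "\<phi> \<in> test_functions C" and \<phi>0: "\<And>x. 0 \<le> \<phi> x"
      have sl: "locally_integrable_on C (hat_slope h v)"
        by (rule bounded_measurable_locally_integrable[where B="?p"]) (auto intro: hat_slope_bound)
      note it = integrable_against_test_function[OF _ \<phi>]
      have "(LINT x|lebesgue. (v \<bullet> w x) * \<phi> x) = (LINT x|lebesgue. hat_slope h v x * \<phi> x)"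
        using bp[OF \<phi>, of v] wg \<phi> by (simp add: weak_gradient_of_def)
      also have "\<dots> \<le> (LINT x|lebesgue. ?p * \<phi> x)"
      proof (rule integral_mono_AE)
        have "hat_slope h v x * \<phi> x \<le> ?p * \<phi> x" for x
          using hat_slope_bound[of h v x] \<phi>0[of x] by (intro mult_right_mono) auto
        then show "AE x in lebesgue. hat_slope h v x * \<phi> x \<le> ?p * \<phi> x" by simp
      qed (use it[OF sl] it[OF pl] in simp_all)
      finally show "(LINT x|lebesgue. (v \<bullet> w x - ?p) * \<phi> x) \<le> 0"
        using it[OF vl] it[OF pl] by (simp add: left_diff_distrib)
    qed
    then show ?thesis by eventually_elim simp
  qed
  have "AE x in lebesgue_on C. \<bar>dual_body_norm K (w x)\<bar> \<le> 1"
  proof -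
    obtain Dn :: "'a set" where Dn: "countable Dn" "closure Dn = UNIV"
    proof -
      obtain Dn :: "'a set" where Dn: "countable Dn" "\<And>U. open U \<Longrightarrow> U \<noteq> {} \<Longrightarrow> \<exists>v\<in>Dn. v \<in> U"
        using countable_dense_exists by blast
      have "- closure Dn = {}" using Dn(2)[of "- closure Dn"] closure_subset by blast
      then show ?thesis using Dn(1) that by blast
    qed
    have "AE x in lebesgue. \<forall>v\<in>Dn. x \<in> C \<longrightarrow> v \<bullet> w x \<le> body_norm K v"
      using wv by (subst AE_ball_countable[OF Dn(1)]) auto
    then have "AE x in lebesgue. x \<in> C \<longrightarrow> dual_body_norm K (w x) \<le> 1"
      by eventually_elim (auto intro: dual_body_norm_le_1_dense[OF Dn(2)])
    then show ?thesis
      unfolding AE_lebesgue_on_iff[OF open_C] using dual_body_norm_nonneg by (auto elim!: eventually_mono)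
  qed
  moreover have [measurable]: "w \<in> borel_measurable (lebesgue_on C)"
  proof (rule borel_measurable_euclidean_space[THEN iffD2], intro ballI)
    fix b :: 'a assume "b \<in> Basis"
    have "(\<lambda>x. b \<bullet> w x) \<in> borel_measurable (lebesgue_on C)"
      using wg by (intro locally_integrable_imp_measurable open_C) (simp add: weak_gradient_of_def)
    then show "(\<lambda>x. w x \<bullet> b) \<in> borel_measurable (lebesgue_on C)" by (simp add: inner_commute)
  qed
  have "(\<lambda>x. \<bar>dual_body_norm K (w x)\<bar>) \<in> borel_measurable (lebesgue_on C)" by measurable
  ultimately have "Linfty_norm C (\<lambda>x. dual_body_norm K (w x)) \<le> ereal 1"
    unfolding Linfty_norm_le_iff by simp
  then show ?thesis
    using extremal_charge_bounded[OF h, of 1] W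
    by (simp add: sobolev_charge_class_def sobolev_charges_def w_def D_def one_ereal_def)
qed

end

section \<open>Recovery and approximation by averages\<close>

context body_and_cone
begin

lemma class_subset_bounded: "\<nu> \<in> sobolev_charge_class K C \<Longrightarrow> \<nu> \<in> bounded_charges K C"
  by (simp add: sobolev_charge_class_def sobolev_charges_def)

lemma bounded_charges_are_charges: "\<nu> \<in> bounded_charges K C \<Longrightarrow> \<nu> \<in> charges C"
  by (simp add: bounded_charges_def)

lemma charge_deriv_measurable:
  assumes "\<nu> \<in> charges C" shows "charge_deriv C \<nu> \<in> borel_measurable (lebesgue_on C)"
proof -
  obtain f where "is_charge_density C \<nu> f" using charge_has_density[OF open_C assms] .
  from charge_deriv_eq_density(1)[OF open_C this] show ?thesis by auto
qed

lemma average_measurable: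
  assumes "\<nu> \<in> charges C" "h > 0" shows "average h \<nu> \<in> borel_measurable (lebesgue_on C)"
  unfolding average_def[abs_def] using charge_of_translated_piece_measurable[OF assms] by simp

lemma average_AE_le:
  assumes "charge_norm K C \<nu> \<le> ereal c" "h > 0"
  shows "AE x in lebesgue_on C. \<bar>average h \<nu> x\<bar> \<le> c / (h ^ DIM('a) * base_volume)"
proof -
  have V: "h ^ DIM('a) * base_volume > 0" using assms(2) base_volume_pos by simp
  show ?thesis
    using charge_norm_le_AE[OF assms]
  proof eventually_elim
    case (elim x)
    then have "\<bar>\<nu> ((+) x ` piece h)\<bar> / (h ^ DIM('a) * base_volume) \<le> c / (h ^ DIM('a) * base_volume)"
      using V by (intro divide_right_mono) auto
    then show ?case using V by (simp add: average_def abs_divide)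
  qed
qed

lemma average_operator_norm:
  assumes h: "h > 0"
  shows "operator_norm (bounded_charges K C) (charge_norm K C) (Linfty_norm C) (average h)
           \<le> ereal (1 / (h ^ DIM('a) * base_volume))"
  unfolding operator_norm_def
proof (rule SUP_least, clarify)
  fix \<nu> assume "\<nu> \<in> bounded_charges K C" and le: "charge_norm K C \<nu> \<le> 1"
  then have "average h \<nu> \<in> borel_measurable (lebesgue_on C)"
    by (intro average_measurable bounded_charges_are_charges h)
  moreover have "AE x in lebesgue_on C. \<bar>average h \<nu> x\<bar> \<le> 1 / (h ^ DIM('a) * base_volume)"
    using le by (intro average_AE_le h) (simp add: one_ereal_def)
  ultimately show "Linfty_norm C (average h \<nu>) \<le> ereal (1 / (h ^ DIM('a) * base_volume))"
    by (simp add: Linfty_norm_le_iff)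
qed

lemma Linfty_norm_nonneg:
  fixes f :: "'a \<Rightarrow> real" shows "0 \<le> Linfty_norm C f"
proof (rule ereal_le_real)
  fix c assume "Linfty_norm C f \<le> ereal c"
  then show "0 \<le> ereal c" using Linfty_norm_le_imp_nonneg[OF open_C C_nonempty] by simp
qed

lemma Linfty_norm_zero: "Linfty_norm C (\<lambda>x. 0) = 0"
proof (rule antisym)
  have "Linfty_norm C (\<lambda>x. 0) \<le> ereal 0" unfolding Linfty_norm_le_iff by simp
  then show "Linfty_norm C (\<lambda>x. 0) \<le> 0" by (simp add: zero_ereal_def)
qed (rule Linfty_norm_nonneg)

lemma average_bounded_operator:
  assumes h: "h > 0"
  shows "average h \<in> bounded_operators (bounded_charges K C) (charge_norm K C) (Linfty C) (Linfty_norm C)"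
proof -
  have "average h \<nu> \<in> Linfty C" if \<nu>: "\<nu> \<in> bounded_charges K C" for \<nu>
  proof -
    have fin: "charge_norm K C \<nu> < \<infinity>" using \<nu> by (simp add: bounded_charges_def)
    have "charge_norm K C \<nu> \<noteq> -\<infinity>"
    proof -
      have "0 \<le> charge_norm_at K C 1 \<nu>"
        using Linfty_norm_nonneg unfolding charge_norm_at_def Linfty_norm_def by simp
      also have "\<dots> \<le> charge_norm K C \<nu>" unfolding charge_norm_def by (intro SUP_upper) simp
      finally show ?thesis by auto
    qed
    with fin obtain c where c: "charge_norm K C \<nu> = ereal c" by (cases "charge_norm K C \<nu>") auto
    have "Linfty_norm C (average h \<nu>) \<le> ereal (c / (h ^ DIM('a) * base_volume))"
      using average_AE_le[of \<nu> c h] average_measurable[OF bounded_charges_are_charges[OF \<nu>] h] h c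
      by (simp add: Linfty_norm_le_iff)
    then show ?thesis
      using average_measurable[OF bounded_charges_are_charges[OF \<nu>] h]
      by (auto simp: Linfty_def intro: le_less_trans)
  qed
  moreover have "average h (\<lambda>i. a * x i + b * y i) - (\<lambda>j. a * average h x j + b * average h y j) = (\<lambda>j. 0)"
    for a b and x y :: "'a set \<Rightarrow> real"
    by (simp add: fun_eq_iff average_def add_divide_distrib)
  moreover have "operator_norm (bounded_charges K C) (charge_norm K C) (Linfty_norm C) (average h) < \<infinity>"
    by (rule le_less_trans[OF average_operator_norm[OF h]]) simp
  ultimately show ?thesis
    by (simp add: bounded_operators_def linear_operator_def Linfty_norm_zero)
qed

text \<open>The error of the mean on exact data, plus the effect of the data error on the mean.\<close>

lemma average_recovery:
  assumes \<nu>: "\<nu> \<in> sobolev_charge_class K C" and \<eta>: "\<eta> \<in> bounded_charges K C"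
    and le: "charge_norm K C (\<nu> - \<eta>) \<le> ereal \<delta>" and h: "h > 0"
  shows "Linfty_norm C (charge_deriv C \<nu> - average h \<eta>)
           \<le> ereal (h * DIM('a) / (DIM('a) + 1) + \<delta> / (h ^ DIM('a) * base_volume))"
proof -
  have "AE x in lebesgue_on C. \<bar>(charge_deriv C \<nu> - average h \<eta>) x\<bar> \<le> h * DIM('a) / (DIM('a) + 1) + \<delta> / (h ^ DIM('a) * base_volume)"
    using average_error[OF \<nu> h] average_AE_le[OF le h]
  proof eventually_elim
    case (elim x)
    have "average h (\<nu> - \<eta>) x = average h \<nu> x - average h \<eta> x" by (simp add: average_def diff_divide_distrib)
    then have "(charge_deriv C \<nu> - average h \<eta>) x = (charge_deriv C \<nu> x - average h \<nu> x) + average h (\<nu> - \<eta>) x" by simp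
    then show ?case using elim by linarith
  qed
  moreover have "(\<lambda>x. \<bar>(charge_deriv C \<nu> - average h \<eta>) x\<bar>) \<in> borel_measurable (lebesgue_on C)"
    using charge_deriv_measurable[OF bounded_charges_are_charges[OF class_subset_bounded[OF \<nu>]]]
      average_measurable[OF bounded_charges_are_charges[OF \<eta>] h] by simp
  ultimately show ?thesis by (simp add: Linfty_norm_le_iff)
qed

lemma zero_charge_bounded: "(\<lambda>_. 0) \<in> bounded_charges K C"
proof -
  have "extremal_charge 0 1 = (\<lambda>_. 0)" by (auto simp: fun_eq_iff extremal_charge_def charge_of_density_def)
  then show ?thesis using extremal_charge_bounded[of 1 0] by simp
qed

text \<open>Linearity is required only up to functions of norm \<open>0\<close>, so the image of the zero charge is only almost
  everywhere zero.\<close>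

lemma operator_at_zero:
  assumes "S \<in> bounded_operators (bounded_charges K C) nX Y (Linfty_norm C)"
  shows "AE x in lebesgue_on C. S (\<lambda>_. 0) x = 0"
proof -
  let ?z = "\<lambda>_ :: 'a set. 0 :: real"
  have "Linfty_norm C (S (\<lambda>i. a * x i + b * y i) - (\<lambda>j. a * S x j + b * S y j)) = 0"
    if "x \<in> bounded_charges K C" "y \<in> bounded_charges K C" for x y a b
    using assms that by (simp add: bounded_operators_def linear_operator_def)
  from this[OF zero_charge_bounded zero_charge_bounded, of 0 0]
  have "Linfty_norm C (S (\<lambda>i. 0 * ?z i + 0 * ?z i) - (\<lambda>j. 0 * S ?z j + 0 * S ?z j)) = 0" .
  moreover have "S (\<lambda>i. 0 * ?z i + 0 * ?z i) - (\<lambda>j. 0 * S ?z j + 0 * S ?z j) = S ?z"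
    by (simp add: fun_eq_iff)
  ultimately have "Linfty_norm C (S ?z) \<le> ereal 0" by (simp add: zero_ereal_def)
  then show ?thesis by (simp add: Linfty_norm_le_iff)
qed

text \<open>The operator norm tests charges of seminorm at most \<open>1\<close>; the extremal charge is scaled down to one, and
  linearity scales the estimate back.\<close>

lemma operator_AE_le:
  assumes S: "S \<in> bounded_operators (bounded_charges K C) (charge_norm K C) Y (Linfty_norm C)"
    and N: "operator_norm (bounded_charges K C) (charge_norm K C) (Linfty_norm C) S \<le> ereal N"
    and h: "h > 0"
  shows "AE x in lebesgue_on C. \<bar>S (extremal_charge 1 h) x\<bar> \<le> N * (h ^ (DIM('a) + 1) * base_volume / (DIM('a) + 1))"
proof -
  define r where "r = h ^ (DIM('a) + 1) * base_volume / (DIM('a) + 1)"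
  have r: "r > 0" unfolding r_def using h base_volume_pos by (intro divide_pos_pos mult_pos_pos) auto
  let ?n = "extremal_charge (1 / r) h" and ?o = "extremal_charge 1 h"
  have nX: "?n \<in> bounded_charges K C" using r h by (intro extremal_charge_bounded) auto
  have "charge_norm K C ?n \<le> ereal (1 / r * r)"
    using extremal_charge_norm[OF h, of "1 / r"] r unfolding r_def[symmetric] by simp
  then have "charge_norm K C ?n \<le> 1" using r by (simp add: one_ereal_def)
  then have "Linfty_norm C (S ?n) \<le> operator_norm (bounded_charges K C) (charge_norm K C) (Linfty_norm C) S"
    unfolding operator_norm_def using nX by (intro SUP_upper) auto
  then have "Linfty_norm C (S ?n) \<le> ereal N" using N by (rule order_trans)
  then have 1: "AE x in lebesgue_on C. \<bar>S ?n x\<bar> \<le> N" by (simp add: Linfty_norm_le_iff)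
  have "Linfty_norm C (S (\<lambda>i. r * ?n i + 0 * ?n i) - (\<lambda>j. r * S ?n j + 0 * S ?n j)) = 0"
    using S nX unfolding bounded_operators_def linear_operator_def by blast
  moreover have "(\<lambda>i. r * ?n i + 0 * ?n i) = ?o"
    using r extremal_charge_scale[of "1 / r" h] by (simp add: fun_eq_iff)
  ultimately have "Linfty_norm C (S ?o - (\<lambda>j. r * S ?n j)) \<le> ereal 0" by (simp add: zero_ereal_def)
  then have "AE x in lebesgue_on C. S ?o x = r * S ?n x" by (simp add: Linfty_norm_le_iff)
  with 1 have "AE x in lebesgue_on C. \<bar>S ?o x\<bar> \<le> N * r"
  proof eventually_elim
    case (elim x)
    then show ?case using r by (simp add: abs_mult mult.commute mult_left_mono)
  qed
  then show ?thesis by (simp add: r_def)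
qed

lemma extremal_charge_deriv_AE:
  assumes h: "h > 0"
  shows "AE x in lebesgue_on C. charge_deriv C (extremal_charge 1 h) x = extremal_density h x"
  using charge_deriv_eq_density(2)[OF open_C extremal_charge_density(2)[OF h, of 1]] by simp

end

theorem theorem4:
  fixes K C :: "'a::euclidean_space set" and \<delta> N :: real
  assumes "open K" and "bounded K" and "convex K" and "\<And>x. x \<in> K \<Longrightarrow> - x \<in> K" and "0 \<in> K"
    and "C \<noteq> {}" and "open C" and "convex C" and "positive_cone C"
    and "\<delta> > 0" and "N > 0"
  defines "X \<equiv> bounded_charges K C" and "nX \<equiv> charge_norm K C"
    and "Y \<equiv> Linfty C" and "nY \<equiv> Linfty_norm C"
    and "M \<equiv> sobolev_charge_class K C" and "D \<equiv> charge_deriv C"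
  shows "optimal_recovery_error X nX nY D M (bounded_operators X nX Y nY) \<delta>
           = modulus_of_continuity nX nY D M \<delta>
         \<and> modulus_of_continuity nX nY D M \<delta>
           = ereal (((real DIM('a) + 1) * \<delta> / measure lebesgue (K \<inter> C))
                      powr (1 / (real DIM('a) + 1)))
         \<and> best_approximation X nX Y nY D M N
           = ereal (real DIM('a) / (real DIM('a) + 1)
                      * (1 / (N * measure lebesgue (K \<inter> C))) powr (1 / real DIM('a)))"
proof -
  interpret body_and_cone K C
    using assms(1-9) by unfold_locales auto
  let ?d = "real DIM('a)"
  have d: "?d > 0" by simp
  have split: "x * ?d / (?d + 1) + x / (?d + 1) = x" for x
  proof -
    have "x * ?d / (?d + 1) + x / (?d + 1) = x * (?d + 1) / (?d + 1)"
      by (simp only: add_divide_distrib[symmetric] distrib_left mult_1_right)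
    moreover have "?d + 1 \<noteq> 0" using d by linarith
    ultimately show ?thesis by simp
  qed
  note mp = base_volume_pos
  have mm: "measure lebesgue (K \<inter> C) = base_volume" by (simp add: base_volume_def)

  \<comment> \<open>The minimizer over all sizes \<open>h\<close> of the bound \<open>h d / (d + 1) + \<delta> / (h\<^sup>d V)\<close>, and the minimum itself.\<close>
  define h where "h = ((?d + 1) * \<delta> / base_volume) powr (1 / (?d + 1))"
  have h: "h > 0" using mp \<open>\<delta> > 0\<close> d by (simp add: h_def add_pos_pos)
  have hpow: "h ^ (DIM('a) + 1) = (?d + 1) * \<delta> / base_volume"
  proof -
    have "h ^ (DIM('a) + 1) = h powr real (DIM('a) + 1)" by (rule powr_realpow[OF h, symmetric])
    also have "\<dots> = ((?d + 1) * \<delta> / base_volume) powr 1"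
      unfolding h_def powr_powr by (simp add: add.commute)
    also have "\<dots> = (?d + 1) * \<delta> / base_volume"
      using mp \<open>\<delta> > 0\<close> d by (intro powr_one divide_nonneg_pos mult_nonneg_nonneg) auto
    finally show ?thesis .
  qed
  have \<delta>: "h ^ (DIM('a) + 1) * base_volume / (DIM('a) + 1) = \<delta>"
  proof -
    have nz: "?d + 1 \<noteq> 0" using d by linarith
    have "h ^ (DIM('a) + 1) * base_volume / (DIM('a) + 1) = (?d + 1) * \<delta> / (?d + 1)"
      unfolding hpow using mp by (simp add: add.commute)
    then show ?thesis unfolding nonzero_mult_div_cancel_left[OF nz] .
  qed
  have bound: "h * ?d / (?d + 1) + \<delta> / (h ^ DIM('a) * base_volume) = h"
  proof -
    have "\<delta> / (h ^ DIM('a) * base_volume) = h / (?d + 1)"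
      unfolding \<delta>[symmetric] using mp h by (simp add: add.commute)
    then show ?thesis using split by simp
  qed

  have up: "optimal_recovery_error X nX nY D M (bounded_operators X nX Y nY) \<delta> \<le> ereal h"
  proof -
    have "optimal_recovery_error X nX nY D M (bounded_operators X nX Y nY) \<delta>
      \<le> (SUP (x, \<eta>)\<in>{(x, \<eta>). x \<in> M \<and> \<eta> \<in> X \<and> nX (x - \<eta>) \<le> ereal \<delta>}. nY (D x - average h \<eta>))"
      unfolding optimal_recovery_error_def
      by (rule INF_lower) (unfold X_def nX_def Y_def nY_def, rule average_bounded_operator[OF h])
    also have "\<dots> \<le> ereal h"
    proof (rule SUP_least, clarify)
      fix x \<eta> assume "x \<in> M" "\<eta> \<in> X" "nX (x - \<eta>) \<le> ereal \<delta>"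
      then have "nY (D x - average h \<eta>) \<le> ereal (h * ?d / (?d + 1) + \<delta> / (h ^ DIM('a) * base_volume))"
        unfolding M_def X_def nX_def nY_def D_def using average_recovery[OF _ _ _ h] by (simp add: add.commute)
      then show "nY (D x - average h \<eta>) \<le> ereal h" unfolding bound .
    qed
    finally show ?thesis .
  qed
  have mid: "modulus_of_continuity nX nY D M \<delta> \<le> optimal_recovery_error X nX nY D M (bounded_operators X nX Y nY) \<delta>"
    unfolding optimal_recovery_error_def modulus_of_continuity_def
  proof (intro INF_greatest SUP_least)
    fix S x assume S: "S \<in> bounded_operators X nX Y nY" and x: "x \<in> {x \<in> M. nX x \<le> ereal \<delta>}"
    have "nY (D x) \<le> nY (D x - S (\<lambda>_. 0))"
    proof (rule ereal_le_real)
      fix c assume "nY (D x - S (\<lambda>_. 0)) \<le> ereal c"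
      then have "AE y in lebesgue_on C. \<bar>D x y - S (\<lambda>_. 0) y\<bar> \<le> c" by (simp add: nY_def Linfty_norm_le_iff)
      moreover have "AE y in lebesgue_on C. S (\<lambda>_. 0) y = 0"
        using S unfolding X_def nY_def by (rule operator_at_zero)
      ultimately have "AE y in lebesgue_on C. \<bar>D x y\<bar> \<le> c" by eventually_elim simp
      moreover have "D x \<in> borel_measurable (lebesgue_on C)"
        using x unfolding D_def M_def
        by (intro charge_deriv_measurable bounded_charges_are_charges class_subset_bounded) simp
      ultimately show "nY (D x) \<le> ereal c" by (simp add: nY_def Linfty_norm_le_iff)
    qed
    also have "\<dots> \<le> (SUP (x, \<eta>)\<in>{(x, \<eta>). x \<in> M \<and> \<eta> \<in> X \<and> nX (x - \<eta>) \<le> ereal \<delta>}. nY (D x - S \<eta>))"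
      using x zero_charge_bounded by (intro SUP_upper2[of "(x, \<lambda>_. 0)"]) (auto simp: X_def fun_diff_def)
    finally show "nY (D x) \<le> (SUP (x, \<eta>)\<in>{(x, \<eta>). x \<in> M \<and> \<eta> \<in> X \<and> nX (x - \<eta>) \<le> ereal \<delta>}. nY (D x - S \<eta>))" .
  qed
  have low: "ereal h \<le> modulus_of_continuity nX nY D M \<delta>"
  proof -
    have "ereal h \<le> nY (D (extremal_charge 1 h))"
    proof (rule ereal_le_real)
      fix c assume "nY (D (extremal_charge 1 h)) \<le> ereal c"
      then have "AE x in lebesgue_on C. \<bar>D (extremal_charge 1 h) x\<bar> \<le> c" by (simp add: nY_def Linfty_norm_le_iff)
      then have "AE x in lebesgue_on C. extremal_density h x \<le> c"
        using extremal_charge_deriv_AE[OF h] by eventually_elim (simp add: D_def)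
      then show "ereal h \<le> ereal c" using AE_extremal_density_le[OF h] by simp
    qed
    also have "\<dots> \<le> modulus_of_continuity nX nY D M \<delta>"
      unfolding modulus_of_continuity_def
    proof (rule SUP_upper, intro CollectI conjI)
      show "extremal_charge 1 h \<in> M" unfolding M_def by (rule extremal_charge_in_class[OF h])
      show "nX (extremal_charge 1 h) \<le> ereal \<delta>"
        using extremal_charge_norm[OF h, of 1] \<delta> by (simp add: nX_def)
    qed
    finally show ?thesis .
  qed

  \<comment> \<open>The size for which averaging has norm \<open>N\<close>.\<close>
  define k where "k = (1 / (N * base_volume)) powr (1 / ?d)"
  have k: "k > 0" using mp \<open>N > 0\<close> by (simp add: k_def)
  have kpow: "k ^ DIM('a) = 1 / (N * base_volume)"
  proof -
    have "k ^ DIM('a) = k powr ?d" using k by (simp add: powr_realpow)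
    also have "\<dots> = (1 / (N * base_volume)) powr 1" unfolding k_def powr_powr using d by simp
    also have "\<dots> = 1 / (N * base_volume)" using mp \<open>N > 0\<close> by simp
    finally show ?thesis .
  qed
  have Nk: "1 / (k ^ DIM('a) * base_volume) = N" unfolding kpow using mp \<open>N > 0\<close> by simp
  have Nr: "N * (k ^ (DIM('a) + 1) * base_volume / (DIM('a) + 1)) = k / (?d + 1)"
    using mp \<open>N > 0\<close> by (simp add: kpow)
  have "best_approximation X nX Y nY D M N \<le> (SUP x\<in>M. nY (D x - average k x))"
    unfolding best_approximation_def
  proof (rule INF_lower, intro CollectI conjI)
    show "average k \<in> bounded_operators X nX Y nY"
      unfolding X_def nX_def Y_def nY_def by (rule average_bounded_operator[OF k])
    show "operator_norm X nX nY (average k) \<le> ereal N"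
      using average_operator_norm[OF k] unfolding Nk X_def nX_def nY_def .
  qed
  also have "\<dots> \<le> ereal (?d / (?d + 1) * k)"
  proof (rule SUP_least)
    fix x assume x: "x \<in> M"
    then have "charge_norm K C (x - x) \<le> ereal 0"
      by (auto simp: charge_norm_le_iff Linfty_norm_le_iff)
    from average_recovery[OF x[unfolded M_def] class_subset_bounded[OF x[unfolded M_def]] this k]
    show "nY (D x - average k x) \<le> ereal (?d / (?d + 1) * k)"
      by (simp add: nY_def D_def ac_simps)
  qed
  finally have E1: "best_approximation X nX Y nY D M N \<le> ereal (?d / (?d + 1) * k)" .
  have E2: "ereal (?d / (?d + 1) * k) \<le> best_approximation X nX Y nY D M N"
    unfolding best_approximation_def
  proof (rule INF_greatest, elim CollectE conjE)
    fix S assume S: "S \<in> bounded_operators X nX Y nY" "operator_norm X nX nY S \<le> ereal N"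
    have "ereal (?d / (?d + 1) * k) \<le> nY (D (extremal_charge 1 k) - S (extremal_charge 1 k))"
    proof (rule ereal_le_real)
      fix c assume "nY (D (extremal_charge 1 k) - S (extremal_charge 1 k)) \<le> ereal c"
      then have "AE x in lebesgue_on C. \<bar>D (extremal_charge 1 k) x - S (extremal_charge 1 k) x\<bar> \<le> c"
        by (simp add: nY_def Linfty_norm_le_iff)
      moreover have "AE x in lebesgue_on C. \<bar>S (extremal_charge 1 k) x\<bar> \<le> k / (?d + 1)"
        using operator_AE_le[OF S[unfolded X_def nX_def nY_def] k] unfolding Nr .
      ultimately have "AE x in lebesgue_on C. extremal_density k x \<le> c + k / (?d + 1)"
        using extremal_charge_deriv_AE[OF k]
      proof eventually_elim
        case (elim x)
        then show ?case unfolding D_def by linarith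
      qed
      then have "k \<le> c + k / (?d + 1)" by (rule AE_extremal_density_le[OF k])
      moreover have "k - k / (?d + 1) = ?d / (?d + 1) * k" using split[of k] by (simp add: mult.commute)
      ultimately show "ereal (?d / (?d + 1) * k) \<le> ereal c" by simp
    qed
    also have "\<dots> \<le> (SUP x\<in>M. nY (D x - S x))"
      using extremal_charge_in_class[OF k] by (intro SUP_upper) (simp add: M_def)
    finally show "ereal (?d / (?d + 1) * k) \<le> (SUP x\<in>M. nY (D x - S x))" .
  qed
  from up mid low E1 E2 show ?thesis
    unfolding mm h_def[symmetric] k_def[symmetric] by (auto intro: antisym order_trans)
qed

end
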